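(* Let $\prec$ be a well-order on $\mathbb{N}$ with order type $|{\prec}|$, let $k\ge1$ and $h\in\omega$. If $\pi=(\tau,\lambda)$ is an $I\Sigma_{k+1}(X)$-derivation of $TI(\prec)$ in free variable normal form without redundancy and $|{\prec}|>2_k(\omega^{h+1})\cdot2+\omega$, then $height(\pi)>h$, where $height(\pi)$ is the height of the tree $\tau$. In particular, if $|{\prec}|\ge\omega_{k+2}$, then $I\Sigma_{k+1}(X)\not\vdash TI(\prec)$.
   Context: **Ordinals.** For ordinals $\alpha,\beta$: $\beta_0(\alpha)=\alpha$, $\beta_{j+1}(\alpha)=\beta^{\beta_j(\alpha)}$ (ordinal exponentiation); $\omega_j:=\omega_j(1)$. **Arithmetic.** Formulas are in negation normal form over $\lnot,\land,\lor,\forall,\exists$; $\overline{\varphi}$ is the negation normal form of $\lnot\varphi$. $\mathcal{L}_{\mathbb{N}}$ is the language with a symbol for every function and predicate on $\mathbb{N}$ (so in particular for $=,\le,\prec$), and $\mathcal{L}_{\mathbb{N}}(X)=\mathcal{L}_{\mathbb{N}}\cup\{X\}$ with $X$ a fresh unary predicate; $X(x)$ is written $x\in X$. $\Delta_0$ (resp. $\Delta_0(X)$) is the class of bounded $\mathcal{L}_{\mathbb{N}}$- (resp. $\mathcal{L}_{\mathbb{N}}(X)$-) formulas. $p\Sigma_i$ is the class of $\mathcal{L}_{\mathbb{N}}$-formulas $\exists x_1\forall x_2\cdots\psi$ with exactly $i$ alternating unbounded quantifiers beginning with $\exists$, where $\psi$ is a maximal $\Delta_0$-subformula; $p\Sigma_i(X)$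 is the same with $\Delta_0(X)$. $Th(\mathbb{N})$ is the set of all $\mathcal{L}_{\mathbb{N}}$-sentences in $\bigcup_i p\Sigma_i$ true in $\mathbb{N}$. $I\Sigma_k(X)$ is $Th(\mathbb{N})$ together with the scheme $(\varphi(0)\land\forall x(\varphi(x)\to\varphi(x+1)))\to\forall x\,\varphi(x)$ for $\varphi\in p\Sigma_k(X)$. A sequent is a finite set of formulas, read as the universal closure of its disjunction. $TI(\prec)$ is the sequent $$\{\forall y.\ \overline{y\in X},\ \ \exists x_0\forall x.\,(x_0\in X\land(\overline{x\in X}\lor\overline{x\prec x_0}))\},$$ and $I\Sigma_k(X)\vdash TI(\prec)$ means that the disjunction of these two sentences is provable in first-order logic from $I\Sigma_k(X)$. **Derivations.** $var(t)$ is the set of variables of a term $t$, and $fv$ denotes the set of free variables of a formula or sequent. A rooted tree is a nonempty set of finite sequences of natural numbers closed under initial segments; its height is the maximal length of its elements; the children of $v$ are the elements $v*k$ ($v$ extended by one entry $k$). An $I\Sigma_k(X)$-derivation of a sequent $S$ in free variable normal form without redundancy is a pair $\pi=(\tau,\lambda)$ with $\tau$ a finite rooted tree and $\lambda$ assigning a sequent to each node, such that $\lambda(\emptyset)=S$ and, for each $v\in\tau$, the sequent $\Gamma:=\lambda(v)$ follows from the labels of the children of $v$ by one of these rules (where $\Gamma,\varphi$ means $\Gamma\cup\{\varphi\}$): - Initial Sequent: no premises; $\Gamma$ contains $L$ and $\overline{L}$ for some literal $L$. - $\lor$-Rule: premise $\Gamma,\varphi_{i_0}$, where $\varphi_1\lor\varphi_2\in\Gamma$,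 $i_0\in\{1,2\}$, $\varphi_{i_0}\notin\Gamma$. - $\exists$-Rule: premise $\Gamma,\varphi(u)$, where $\exists x.\varphi(x)\in\Gamma$, $u$ is an $\mathcal{L}_{\mathbb{N}}$-term, $var(u)\subseteq fv(\Gamma\cup\{\varphi(u)\})=fv(\Gamma)$, $\varphi(u)\notin\Gamma$. - $\land$-Rule: premises $\Gamma,\varphi_1$ and $\Gamma,\varphi_2$, where $\varphi_1\land\varphi_2\in\Gamma$, $\varphi_1,\varphi_2\notin\Gamma$. - $\forall$-Rule: premise $\Gamma,\varphi(a)$, where $\forall x.\varphi(x)\in\Gamma$, $a\notin fv(\Gamma)$, $\varphi(a)\notin\Gamma$, $fv(\Gamma\cup\{\varphi(a)\})\subseteq fv(\Gamma)\cup\{a\}$. - True Sentence: premise $\Gamma,\overline{\varphi}$, where $\varphi\in Th(\mathbb{N})$, $\overline{\varphi}\notin\Gamma$. - $p\Sigma_k(X)$-Induction: premises $\Gamma,\varphi(0)$; $\ \Gamma,\overline{\varphi(a)},\varphi(a+1)$; $\ \Gamma,\overline{\varphi(t)}$, where $t$ is an $\mathcal{L}_{\mathbb{N}}$-term with $var(t)\subseteq fv(\varphi(t))$, $\varphi(x)\in p\Sigma_k(X)$, $\varphi(0)\notin\Gamma$, $\varphi(t)\notin\Gamma$, $a\notin fv(\Gamma\cup\{\varphi(0)\})=fv(\Gamma\cup\{\overline{\varphi(t)}\})=fv(\Gamma)$, and $fv(\Gamma\cup\{\overline{\varphi(a)},\varphi(a+1)\})=fv(\Gamma)\cup\{a\}$.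 - $p\Sigma_k(X)$-Cut: premises $\Gamma,\varphi$ and $\Gamma,\overline{\varphi}$, where $\varphi\in p\Sigma_k(X)$, $\varphi,\overline{\varphi}\notin\Gamma$, $fv(\Gamma\cup\{\varphi\})=fv(\Gamma\cup\{\overline{\varphi}\})=fv(\Gamma)$. *)

theory Defs
  imports "HOL-Library.Countable_Set" "HOL-Library.FuncSet" "HOL-Library.Sublist"
begin

section \<open>Ordinals\<close>

unbundle cardinal_syntax

text \<open>
  Countable ordinals, i.e. the order types of well-orders on sets of natural numbers. The order
  type of a well-order on \<open>\<nat>\<close> and all ordinals built from finite ones and \<open>\<omega>\<close> by addition,
  multiplication and exponentiation are of this kind.
\<close>

quotient_type cord = "nat rel" / partial: "\<lambda>r s :: nat rel. r =o s"
proof (rule part_equivpI)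
  show "\<exists>r :: nat rel. r =o r" using natLeq_Well_order ordIso_reflexive by blast
  show "symp (\<lambda>r s :: nat rel. r =o s)" by (auto simp: symp_def intro: ordIso_symmetric)
  show "transp (\<lambda>r s :: nat rel. r =o s)" by (auto simp: transp_def intro: ordIso_transitive)
qed

lemma ordIso_Well_order: "r =o s \<Longrightarrow> Well_order r \<and> Well_order s"
  by (auto simp: ordIso_def)

instantiation cord :: linorder
begin

lift_definition less_eq_cord :: "cord \<Rightarrow> cord \<Rightarrow> bool" is "\<lambda>r s. r \<le>o s"
  by (metis ordIso_ordLeq_trans ordIso_symmetric ordLeq_ordIso_trans)

lift_definition less_cord :: "cord \<Rightarrow> cord \<Rightarrow> bool" is "\<lambda>r s. r <o s"
  by (metis ordIso_ordLess_trans ordIso_symmetric ordLess_ordIso_trans)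

instance
proof
  fix x y z :: cord
  show "(x < y) = (x \<le> y \<and> \<not> y \<le> x)"
    by transfer (metis ordIso_Well_order not_ordLeq_iff_ordLess ordLess_imp_ordLeq)
  show "x \<le> x" by transfer (simp add: ordIso_imp_ordLeq)
  show "x \<le> y \<Longrightarrow> y \<le> z \<Longrightarrow> x \<le> z" by transfer (rule ordLeq_transitive)
  show "x \<le> y \<Longrightarrow> y \<le> x \<Longrightarrow> x = y" by transfer (simp add: ordIso_iff_ordLeq)
  show "x \<le> y \<or> y \<le> x" by transfer (metis ordIso_Well_order ordLeq_total)
qed
end

lemma wf_cord: "wf {(x, y :: cord). x < y}"
proof (rule wf_subset)
  show "wf (inv_image (ordLess :: (nat rel \<times> nat rel) set) rep_cord)"
    by (intro wf_inv_image wf_ordLess)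
  show "{(x, y :: cord). x < y} \<subseteq> inv_image (ordLess :: (nat rel \<times> nat rel) set) rep_cord"
    by (auto simp: less_cord_def inv_image_def)
qed

instance cord :: wellorder
  by (rule wf_wellorderI[OF wf_cord]) intro_classes

text \<open>The value \<open>otype r\<close> is meaningful only if \<open>r\<close> is a well-order.\<close>

lift_definition otype :: "nat rel \<Rightarrow> cord" is "\<lambda>r. if Well_order r then r else {}"
  by (auto simp: ordIso_reflexive)

lemma otype_surj: "\<exists>r. Well_order r \<and> x = otype r"
  by transfer (metis ordIso_Well_order)

lemma otype_less: "Well_order r \<Longrightarrow> Well_order s \<Longrightarrow> otype r < otype s \<longleftrightarrow> r <o s"
  by transfer simp
lemma otype_le: "Well_order r \<Longrightarrow> Well_order s \<Longrightarrow> otype r \<le> otype s \<longleftrightarrow> r \<le>o s"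
  by transfer simp
lemma otype_eq: "Well_order r \<Longrightarrow> Well_order s \<Longrightarrow> otype r = otype s \<longleftrightarrow> r =o s"
  by transfer simp

lemma countable_lessThan_cord: "countable {..<x :: cord}"
proof -
  obtain r where r: "Well_order r" "x = otype r" using otype_surj by blast
  have "{..<x} \<subseteq> range (\<lambda>a. otype (Restr r (underS r a)))"
  proof
    fix y assume "y \<in> {..<x}"
    moreover obtain s where s: "Well_order s" "y = otype s" using otype_surj by blast
    ultimately have "s <o r" using r otype_less by simp
    then obtain a where "s =o Restr r (underS r a)"
      using ordLess_iff_ordIso_Restr r s by blast
    then have "y = otype (Restr r (underS r a))"
      using s r by (metis ordIso_Well_order otype_eq)
    then show "y \<in> range (\<lambda>a. otype (Restr r (underS r a)))" by blast
  qed
  then show ?thesis by (meson countable_image countable_subset countableI_type)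
qed

lemma countable_bounded_cord:
  assumes "countable (A :: cord set)"
  shows "\<exists>b. \<forall>x\<in>A. x < b"
proof -
  let ?c = "cardSuc natLeq"
  have C: "Card_order ?c" "Well_order ?c"
    using cardSuc_Card_order natLeq_Card_order card_order_on_well_order_on by blast+
  have "\<forall>x\<in>A. \<exists>a\<in>Field ?c. \<exists>r. Well_order r \<and> x = otype r \<and> r =o Restr ?c (underS ?c a)"
  proof
    fix x assume "x \<in> A"
    obtain r where r: "Well_order r" "x = otype r" using otype_surj by blast
    have "r <o ?c"
    proof (rule ccontr)
      assume "\<not> r <o ?c"
      then have "?c \<le>o r" using C r not_ordLess_iff_ordLeq by blast
      then have "|Field ?c| \<le>o |Field r|" by (metis card_of_mono2)
      moreover have "|Field r| \<le>o natLeq"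
        by (metis card_of_mono1 card_of_nat ordLeq_ordIso_trans top_greatest)
      ultimately have "?c \<le>o natLeq"
        using C card_of_Field_ordIso ordIso_ordLeq_trans ordIso_symmetric ordLeq_transitive by blast
      then show False using cardSuc_greater[OF natLeq_Card_order] not_ordLess_ordLeq by blast
    qed
    then show "\<exists>a\<in>Field ?c. \<exists>r. Well_order r \<and> x = otype r \<and> r =o Restr ?c (underS ?c a)"
      using ordLess_iff_ordIso_Restr C r by blast
  qed
  then obtain f where f: "\<And>x. x \<in> A \<Longrightarrow> f x \<in> Field ?c \<and>
     (\<exists>r. Well_order r \<and> x = otype r \<and> r =o Restr ?c (underS ?c (f x)))" by metis
  have "|f ` A| \<le>o natLeq"
  proof -
    obtain g :: "_ \<Rightarrow> nat" where "inj_on g (f ` A)"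
      using countable_image[OF assms, of f] unfolding countable_def by blast
    then have "|f ` A| \<le>o |UNIV :: nat set|" using card_of_ordLeq[of "f ` A" "UNIV :: nat set"] by blast
    then show ?thesis using card_of_nat ordLeq_ordIso_trans by blast
  qed
  then have "\<not> |f ` A| =o ?c"
    using cardSuc_greater[OF natLeq_Card_order]
    by (meson not_ordLess_ordIso ordLeq_ordLess_trans)
  moreover have "regularCard ?c"
    using infinite_cardSuc_regularCard natLeq_Card_order Field_natLeq by (metis infinite_UNIV_nat)
  ultimately have "\<not> cofinal (f ` A) ?c"
    using f unfolding regularCard_def by blast
  then obtain b where b: "b \<in> Field ?c" "\<And>x. x \<in> A \<Longrightarrow> b = f x \<or> (b, f x) \<notin> ?c"
    unfolding cofinal_def by blast
  have wo: "wo_rel ?c" using C by (simp add: wo_rel_def)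
  note TOTALS = wo_rel.TOTALS[OF wo] and REFL = wo_rel.REFL[OF wo]
    and TRANS = wo_rel.TRANS[OF wo] and ANTISYM = wo_rel.ANTISYM[OF wo]
  have le: "(f x, b) \<in> ?c" if "x \<in> A" for x
    using b that f TOTALS REFL unfolding refl_on_def by metis
  have "\<not> finite (Field ?c)"
    using C(1) infinite_UNIV_nat cardSuc_finite[OF natLeq_Card_order] Field_natLeq by metis
  then obtain b' where b': "b' \<in> Field ?c" "b' \<noteq> b" "(b, b') \<in> ?c"
    using infinite_Card_order_limit[OF C(1) _ b(1)] by metis
  have "|underS ?c b'| <o ?c" by (rule card_of_underS[OF C(1) b'(1)])
  then have "|underS ?c b'| \<le>o natLeq"
    using cardSuc_ordLeq_ordLess natLeq_Card_order card_of_Card_order by blast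
  then have "|underS ?c b'| \<le>o |UNIV :: nat set|"
    using card_of_nat ordIso_symmetric ordLeq_ordIso_trans by blast
  then obtain g :: "_ \<Rightarrow> nat" where g: "inj_on g (underS ?c b')" 
    using card_of_ordLeq[of "underS ?c b'" "UNIV :: nat set"] by blast
  have W: "well_order_on (underS ?c b') (Restr ?c (underS ?c b'))"
    by (intro well_order_on_Restr C(2)) (auto simp: underS_def Field_def)
  obtain t where t: "well_order_on (g ` underS ?c b') t" "Restr ?c (underS ?c b') =o t"
    using Well_order_iso_copy[OF W inj_on_imp_bij_betw[OF g]] by blast
  have tW: "Well_order t" using t by (simp add: ordIso_Well_order)
  have "x < otype t" if xA: "x \<in> A" for x
  proof -
    obtain r where r: "Well_order r" "x = otype r" "r =o Restr ?c (underS ?c (f x))"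
      using f[OF xA] by blast
    have "underS ?c (f x) \<subset> underS ?c b'"
    proof -
      have "(f x, b') \<in> ?c" "f x \<noteq> b'"
        using le[OF xA] b'(2,3) TRANS[unfolded trans_def] ANTISYM[unfolded antisym_def] by blast+
      then have "f x \<in> underS ?c b'" "underS ?c (f x) \<subseteq> underS ?c b'"
        unfolding underS_def using TRANS[unfolded trans_def] ANTISYM[unfolded antisym_def] by blast+
      moreover have "f x \<notin> underS ?c (f x)" by (simp add: underS_def)
      ultimately show ?thesis by blast
    qed
    then have "Restr ?c (underS ?c (f x)) <o Restr ?c (underS ?c b')"
      using ofilter_subset_ordLess C(2) wo_rel.underS_ofilter[OF wo] by blast
    then show ?thesis using r t tW
      by (meson ordIso_ordLess_trans ordLess_ordIso_trans otype_less)
  qed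
  then show ?thesis by blast
qed

text \<open>
  The following recursions use the exact least upper bounds; the usual equations for zero,
  successors and limits are derived below (\<open>plus_zero_cord\<close>, \<open>plus_succ_cord\<close>,
  \<open>plus_limit_cord\<close> and similarly for products and powers).
\<close>

lemma wf_snd_cord: "wf (inv_image {(x, y). x < y} (snd :: cord \<times> cord \<Rightarrow> cord))"
  by (rule wf_inv_image[OF wf_cord])

instantiation cord :: "{zero, one}"
begin
definition zero_cord :: cord where "0 = otype {}"
definition one_cord :: cord where "1 = otype {(0, 0)}"
instance ..
end

instantiation cord :: plus
begin

function plus_cord :: "cord \<Rightarrow> cord \<Rightarrow> cord" where
  "\<alpha> + \<beta> = (LEAST \<gamma>. \<alpha> \<le> \<gamma> \<and> (\<forall>\<delta><\<beta>. \<alpha> + \<delta> < (\<gamma> :: cord)))"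
  by pat_completeness auto
termination
  by (relation "inv_image {(x, y). x < y} snd") (rule wf_snd_cord, simp)

declare plus_cord.simps [simp del]

instance ..

end

instantiation cord :: times
begin

function times_cord :: "cord \<Rightarrow> cord \<Rightarrow> cord" where
  "\<alpha> * \<beta> = (LEAST \<gamma>. \<forall>\<delta><\<beta>. \<alpha> * \<delta> + \<alpha> \<le> (\<gamma> :: cord))"
  by pat_completeness auto
termination
  by (relation "inv_image {(x, y). x < y} snd") (rule wf_snd_cord, simp)

declare times_cord.simps [simp del]

instance ..

end

function oexp :: "cord \<Rightarrow> cord \<Rightarrow> cord" where
  "oexp \<alpha> \<beta> = (if \<alpha> = 0 then (if \<beta> = 0 then 1 else 0)
     else (LEAST \<gamma>. 1 \<le> \<gamma> \<and> (\<forall>\<delta><\<beta>. oexp \<alpha> \<delta> * \<alpha> \<le> \<gamma>)))"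
  by pat_completeness auto
termination
  by (relation "inv_image {(x, y). x < y} snd") (rule wf_snd_cord, simp)

declare oexp.simps [simp del]

lemma zero_le_cord [simp]: "0 \<le> (x :: cord)"
proof -
  obtain r where r: "Well_order r" "x = otype r" using otype_surj by blast
  have "\<not> r <o ({} :: nat rel)"
    using ordLess_iff_ordIso_Restr[of "{}" r] r(1) by auto
  then show ?thesis
    using r otype_less[of r "{}"] unfolding zero_cord_def by auto
qed

lemma not_less_zero_cord [simp]: "\<not> (x :: cord) < 0"
  by (simp add: not_less)

lemma small_bounded_cord: "\<exists>b :: cord. \<forall>\<delta><\<beta>. f \<delta> < b" for \<beta> :: cord
  using countable_bounded_cord[of "f ` {..<\<beta>}"] countable_lessThan_cord by auto

lemma plus_least:
  fixes \<alpha> \<beta> :: cord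
  shows "\<alpha> \<le> \<alpha> + \<beta>" "\<delta> < \<beta> \<Longrightarrow> \<alpha> + \<delta> < \<alpha> + \<beta>"
    "\<alpha> \<le> \<gamma> \<Longrightarrow> (\<And>\<delta>. \<delta> < \<beta> \<Longrightarrow> \<alpha> + \<delta> < \<gamma>) \<Longrightarrow> \<alpha> + \<beta> \<le> \<gamma>"
proof -
  obtain b where "\<forall>\<delta><\<beta>. \<alpha> + \<delta> < b"
    using small_bounded_cord[of \<beta> "\<lambda>\<delta>. \<alpha> + \<delta>"] by blast
  then have "\<alpha> \<le> max \<alpha> b \<and> (\<forall>\<delta><\<beta>. \<alpha> + \<delta> < max \<alpha> b)" by (auto simp: less_max_iff_disj)
  then have "\<alpha> \<le> \<alpha> + \<beta> \<and> (\<forall>\<delta><\<beta>. \<alpha> + \<delta> < \<alpha> + \<beta>)"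
    unfolding plus_cord.simps[of \<alpha> \<beta>] by (rule LeastI)
  then show "\<alpha> \<le> \<alpha> + \<beta>" "\<delta> < \<beta> \<Longrightarrow> \<alpha> + \<delta> < \<alpha> + \<beta>" by auto
  show "\<alpha> \<le> \<gamma> \<Longrightarrow> (\<And>\<delta>. \<delta> < \<beta> \<Longrightarrow> \<alpha> + \<delta> < \<gamma>) \<Longrightarrow> \<alpha> + \<beta> \<le> \<gamma>"
    unfolding plus_cord.simps[of \<alpha> \<beta>] by (rule Least_le) auto
qed

lemma times_least:
  fixes \<alpha> \<beta> :: cord
  shows "\<delta> < \<beta> \<Longrightarrow> \<alpha> * \<delta> + \<alpha> \<le> \<alpha> * \<beta>"
    "(\<And>\<delta>. \<delta> < \<beta> \<Longrightarrow> \<alpha> * \<delta> + \<alpha> \<le> \<gamma>) \<Longrightarrow> \<alpha> * \<beta> \<le> \<gamma>"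
proof -
  obtain b where "\<forall>\<delta><\<beta>. \<alpha> * \<delta> + \<alpha> < b"
    using small_bounded_cord[of \<beta> "\<lambda>\<delta>. \<alpha> * \<delta> + \<alpha>"] by blast
  then have "\<forall>\<delta><\<beta>. \<alpha> * \<delta> + \<alpha> \<le> b" by (simp add: less_imp_le)
  then have "\<forall>\<delta><\<beta>. \<alpha> * \<delta> + \<alpha> \<le> \<alpha> * \<beta>"
    unfolding times_cord.simps[of \<alpha> \<beta>]
    by (rule LeastI[of "\<lambda>\<gamma>. \<forall>\<delta><\<beta>. \<alpha> * \<delta> + \<alpha> \<le> \<gamma>"])
  then show "\<delta> < \<beta> \<Longrightarrow> \<alpha> * \<delta> + \<alpha> \<le> \<alpha> * \<beta>" by blast
  show "(\<And>\<delta>. \<delta> < \<beta> \<Longrightarrow> \<alpha> * \<delta> + \<alpha> \<le> \<gamma>) \<Longrightarrow> \<alpha> * \<beta> \<le> \<gamma>"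
    unfolding times_cord.simps[of \<alpha> \<beta>] by (rule Least_le) blast
qed

lemma oexp_least:
  assumes "\<alpha> \<noteq> 0"
  shows "1 \<le> oexp \<alpha> \<beta>" "\<delta> < \<beta> \<Longrightarrow> oexp \<alpha> \<delta> * \<alpha> \<le> oexp \<alpha> \<beta>"
    "1 \<le> \<gamma> \<Longrightarrow> (\<And>\<delta>. \<delta> < \<beta> \<Longrightarrow> oexp \<alpha> \<delta> * \<alpha> \<le> \<gamma>) \<Longrightarrow> oexp \<alpha> \<beta> \<le> \<gamma>"
proof -
  have eq: "oexp \<alpha> \<beta> = (LEAST \<gamma>. 1 \<le> \<gamma> \<and> (\<forall>\<delta><\<beta>. oexp \<alpha> \<delta> * \<alpha> \<le> \<gamma>))"
    using assms by (subst oexp.simps) simp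
  obtain b where "\<forall>\<delta><\<beta>. oexp \<alpha> \<delta> * \<alpha> < b"
    using small_bounded_cord[of \<beta> "\<lambda>\<delta>. oexp \<alpha> \<delta> * \<alpha>"] by blast
  then have "1 \<le> max 1 b \<and> (\<forall>\<delta><\<beta>. oexp \<alpha> \<delta> * \<alpha> \<le> max 1 b)"
    by (metis less_imp_le max.cobounded1 max.coboundedI2)
  then have "1 \<le> oexp \<alpha> \<beta> \<and> (\<forall>\<delta><\<beta>. oexp \<alpha> \<delta> * \<alpha> \<le> oexp \<alpha> \<beta>)"
    unfolding eq by (rule LeastI[of "\<lambda>\<gamma>. 1 \<le> \<gamma> \<and> (\<forall>\<delta><\<beta>. oexp \<alpha> \<delta> * \<alpha> \<le> \<gamma>)"])
  then show "1 \<le> oexp \<alpha> \<beta>" "\<delta> < \<beta> \<Longrightarrow> oexp \<alpha> \<delta> * \<alpha> \<le> oexp \<alpha> \<beta>" by blast+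
  show "1 \<le> \<gamma> \<Longrightarrow> (\<And>\<delta>. \<delta> < \<beta> \<Longrightarrow> oexp \<alpha> \<delta> * \<alpha> \<le> \<gamma>) \<Longrightarrow> oexp \<alpha> \<beta> \<le> \<gamma>"
    unfolding eq by (rule Least_le) blast
qed

lemma less_one_cord: "(x :: cord) < 1 \<longleftrightarrow> x = 0"
proof -
  have W: "Well_order {(0 :: nat, 0 :: nat)}"
    by (auto simp: well_order_on_def linear_order_on_def partial_order_on_def preorder_on_def
        refl_on_def trans_def antisym_def total_on_def Field_def)
  have U: "underS {(0 :: nat, 0 :: nat)} a = {}" for a by (auto simp: underS_def)
  obtain r where r: "Well_order r" "x = otype r" using otype_surj by blast
  have "x < 1 \<longleftrightarrow> r <o {(0 :: nat, 0 :: nat)}"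
    unfolding one_cord_def using W r otype_less by blast
  also have "\<dots> \<longleftrightarrow> r =o ({} :: nat rel)"
    using ordLess_iff_ordIso_Restr[OF W r(1)] by (auto simp: U Field_def)
  also have "\<dots> \<longleftrightarrow> x = 0"
    unfolding zero_cord_def using r otype_eq[of r "{}"] by auto
  finally show ?thesis .
qed

lemma plus_zero_cord [simp]: "\<alpha> + 0 = (\<alpha> :: cord)"
  by (rule antisym) (auto intro: plus_least)

lemma less_plus_one_cord: "\<alpha> < \<beta> + 1 \<longleftrightarrow> \<alpha> \<le> (\<beta> :: cord)"
proof
  show "\<alpha> < \<beta> + 1" if "\<alpha> \<le> \<beta>"
    using plus_least(2)[of 0 1 \<beta>] that less_one_cord[of 0] by auto
  show "\<alpha> \<le> \<beta>" if "\<alpha> < \<beta> + 1"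
  proof (rule ccontr)
    assume "\<not> \<alpha> \<le> \<beta>"
    then have "\<beta> + 1 \<le> \<alpha>" by (intro plus_least(3)) (auto simp: less_one_cord)
    then show False using that by simp
  qed
qed

lemma plus_succ_cord: "\<alpha> + (\<beta> + 1) = (\<alpha> + \<beta>) + (1 :: cord)"
proof (rule antisym)
  have mono: "\<alpha> + \<delta> \<le> \<alpha> + \<beta>" if "\<delta> \<le> \<beta>" for \<delta>
    using plus_least(2)[of \<delta> \<beta> \<alpha>] that by (metis le_less)
  show "\<alpha> + (\<beta> + 1) \<le> (\<alpha> + \<beta>) + 1"
    by (rule plus_least(3))
      (auto simp: less_plus_one_cord less_imp_le plus_least(1) intro: mono)
  show "(\<alpha> + \<beta>) + 1 \<le> \<alpha> + (\<beta> + 1)"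
  proof -
    have "\<alpha> + \<beta> < \<alpha> + (\<beta> + 1)" by (rule plus_least(2)) (simp add: less_plus_one_cord)
    then show ?thesis using less_plus_one_cord[of "\<alpha> + (\<beta> + 1)" "\<alpha> + \<beta>"] by (meson not_less)
  qed
qed

lemma plus_limit_cord:
  assumes "\<mu> \<noteq> 0" "\<And>\<delta>. \<delta> < \<mu> \<Longrightarrow> \<delta> + 1 < (\<mu> :: cord)"
  shows "\<alpha> + \<mu> = (LEAST \<gamma>. \<forall>\<delta><\<mu>. \<alpha> + \<delta> \<le> \<gamma>)"
proof (rule Least_equality[symmetric])
  show "\<forall>\<delta><\<mu>. \<alpha> + \<delta> \<le> \<alpha> + \<mu>" by (simp add: less_imp_le plus_least(2))
  fix \<gamma> assume *: "\<forall>\<delta><\<mu>. \<alpha> + \<delta> \<le> \<gamma>"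
  have "0 < \<mu>" using assms(1) by (simp add: less_le)
  then have "\<alpha> \<le> \<gamma>" using * plus_zero_cord by metis
  moreover have "\<alpha> + \<delta> < \<gamma>" if "\<delta> < \<mu>" for \<delta>
  proof -
    have "\<alpha> + \<delta> < \<alpha> + (\<delta> + 1)" by (rule plus_least(2)) (simp add: less_plus_one_cord)
    also have "\<dots> \<le> \<gamma>" using * assms(2)[OF that] by blast
    finally show ?thesis .
  qed
  ultimately show "\<alpha> + \<mu> \<le> \<gamma>" by (rule plus_least(3))
qed

lemma times_zero_cord [simp]: "\<alpha> * 0 = (0 :: cord)"
  by (rule antisym) (auto intro: times_least)

lemma times_mono_cord: "\<delta> \<le> \<beta> \<Longrightarrow> \<alpha> * \<delta> \<le> \<alpha> * (\<beta> :: cord)"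
  by (metis le_less order_trans plus_least(1) times_least(1))

lemma plus_mono_left_cord: "\<alpha> \<le> \<beta> \<Longrightarrow> \<alpha> + \<gamma> \<le> \<beta> + (\<gamma> :: cord)"
proof (induction \<gamma> rule: less_induct)
  case (less \<gamma>)
  show ?case
  proof (rule plus_least(3))
    show "\<alpha> \<le> \<beta> + \<gamma>" using less.prems plus_least(1) order_trans by blast
    show "\<alpha> + \<delta> < \<beta> + \<gamma>" if "\<delta> < \<gamma>" for \<delta>
      using less that plus_least(2) order_le_less_trans by blast
  qed
qed

lemma times_succ_cord: "\<alpha> * (\<beta> + 1) = \<alpha> * \<beta> + (\<alpha> :: cord)"
proof (rule antisym)
  show "\<alpha> * (\<beta> + 1) \<le> \<alpha> * \<beta> + \<alpha>"
    by (rule times_least(2)) (simp add: less_plus_one_cord plus_mono_left_cord times_mono_cord)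
  show "\<alpha> * \<beta> + \<alpha> \<le> \<alpha> * (\<beta> + 1)"
    by (rule times_least(1)) (simp add: less_plus_one_cord)
qed

lemma times_limit_cord:
  assumes "\<And>\<delta>. \<delta> < \<mu> \<Longrightarrow> \<delta> + 1 < (\<mu> :: cord)"
  shows "\<alpha> * \<mu> = (LEAST \<gamma>. \<forall>\<delta><\<mu>. \<alpha> * \<delta> \<le> \<gamma>)"
proof (rule Least_equality[symmetric])
  show "\<forall>\<delta><\<mu>. \<alpha> * \<delta> \<le> \<alpha> * \<mu>" by (simp add: times_mono_cord)
  fix \<gamma> assume "\<forall>\<delta><\<mu>. \<alpha> * \<delta> \<le> \<gamma>"
  then show "\<alpha> * \<mu> \<le> \<gamma>"
    by (intro times_least(2)) (metis assms times_succ_cord)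
qed

lemma times_one_cord [simp]: "\<alpha> * 1 = (\<alpha> :: cord)"
proof -
  have "0 + 1 = (1 :: cord)"
  proof (rule antisym)
    have "(0 :: cord) < 1" by (simp add: less_one_cord)
    then show "0 + 1 \<le> (1 :: cord)" by (intro plus_least(3)) (simp_all add: less_one_cord)
    have "\<not> 0 + 1 < (1 :: cord)"
      using less_plus_one_cord[of 0 0] by (simp add: less_one_cord)
    then show "1 \<le> 0 + (1 :: cord)" by (simp only: not_less)
  qed
  moreover have "0 + \<alpha> = \<alpha>"
  proof (induction \<alpha> rule: less_induct)
    case (less \<alpha>)
    show ?case
    proof (rule antisym)
      show "0 + \<alpha> \<le> \<alpha>" by (rule plus_least(3)[OF zero_le_cord]) (simp only: less.IH)
      show "\<alpha> \<le> 0 + \<alpha>"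
      proof (rule ccontr)
        assume "\<not> \<alpha> \<le> 0 + \<alpha>"
        then have "0 + \<alpha> < \<alpha>" by simp
        then show False
          using less.IH plus_least(2)[of "0 + \<alpha>" \<alpha> 0] by (metis less_irrefl)
      qed
    qed
  qed
  ultimately show ?thesis using times_succ_cord[of \<alpha> 0] by simp
qed

lemma oexp_zero_cord [simp]: "oexp \<alpha> 0 = 1"
  by (subst oexp.simps) (auto intro: Least_equality)

lemma le_times_cord: "\<beta> \<noteq> 0 \<Longrightarrow> \<alpha> \<le> \<alpha> * (\<beta> :: cord)"
  using times_mono_cord[of 1 \<beta> \<alpha>] less_one_cord[of \<beta>] by (simp add: not_less)

lemma oexp_mono_cord: "\<alpha> \<noteq> 0 \<Longrightarrow> \<delta> \<le> \<beta> \<Longrightarrow> oexp \<alpha> \<delta> \<le> oexp \<alpha> \<beta>"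
  using oexp_least(2)[of \<alpha> \<delta> \<beta>] le_times_cord[of \<alpha> "oexp \<alpha> \<delta>"] by (auto simp: le_less)

lemma times_mono_left_cord: "\<alpha> \<le> \<beta> \<Longrightarrow> \<alpha> * \<gamma> \<le> \<beta> * (\<gamma> :: cord)"
proof (induction \<gamma> rule: less_induct)
  case (less \<gamma>)
  have right: "x + y \<le> x + z" if "y \<le> z" for x y z :: cord
    using plus_least(2)[of y z x] that by (metis le_less)
  show ?case
  proof (rule times_least(2))
    show "\<alpha> * \<delta> + \<alpha> \<le> \<beta> * \<gamma>" if "\<delta> < \<gamma>" for \<delta>
    proof -
      have "\<alpha> * \<delta> + \<alpha> \<le> \<alpha> * \<delta> + \<beta>" by (rule right[OF less.prems])
      also have "\<dots> \<le> \<beta> * \<delta> + \<beta>" by (rule plus_mono_left_cord[OF less.IH[OF that less.prems]])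
      also have "\<dots> \<le> \<beta> * \<gamma>" by (rule times_least(1)[OF that])
      finally show ?thesis .
    qed
  qed
qed

lemma oexp_succ_cord:
  assumes "\<alpha> \<noteq> 0" shows "oexp \<alpha> (\<beta> + 1) = oexp \<alpha> \<beta> * \<alpha>"
proof (rule antisym)
  show "oexp \<alpha> (\<beta> + 1) \<le> oexp \<alpha> \<beta> * \<alpha>"
  proof (rule oexp_least(3)[OF assms])
    show "1 \<le> oexp \<alpha> \<beta> * \<alpha>"
      by (rule order_trans[OF oexp_least(1)[OF assms] le_times_cord[OF assms]])
    show "oexp \<alpha> \<delta> * \<alpha> \<le> oexp \<alpha> \<beta> * \<alpha>" if "\<delta> < \<beta> + 1" for \<delta>
      using that by (simp add: less_plus_one_cord times_mono_left_cord oexp_mono_cord assms)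
  qed
  show "oexp \<alpha> \<beta> * \<alpha> \<le> oexp \<alpha> (\<beta> + 1)"
    by (rule oexp_least(2)[OF assms]) (simp add: less_plus_one_cord)
qed

lemma oexp_limit_cord:
  assumes "\<alpha> \<noteq> 0" "\<mu> \<noteq> 0" "\<And>\<delta>. \<delta> < \<mu> \<Longrightarrow> \<delta> + 1 < \<mu>"
  shows "oexp \<alpha> \<mu> = (LEAST \<gamma>. \<forall>\<delta><\<mu>. oexp \<alpha> \<delta> \<le> \<gamma>)"
proof (rule Least_equality[symmetric])
  show "\<forall>\<delta><\<mu>. oexp \<alpha> \<delta> \<le> oexp \<alpha> \<mu>"
    using assms(1) by (simp add: oexp_mono_cord)
  fix \<gamma> assume *: "\<forall>\<delta><\<mu>. oexp \<alpha> \<delta> \<le> \<gamma>"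
  have "0 < \<mu>" using assms(2) by (simp add: less_le)
  then have "1 \<le> \<gamma>" using * oexp_zero_cord by metis
  then show "oexp \<alpha> \<mu> \<le> \<gamma>"
    by (rule oexp_least(3)[OF assms(1)]) (metis * oexp_succ_cord[OF assms(1)] assms(3))
qed

primrec ord_of_nat :: "nat \<Rightarrow> cord" where
  "ord_of_nat 0 = 0"
| "ord_of_nat (Suc n) = ord_of_nat n + 1"

definition omega :: cord (\<open>\<omega>\<close>) where
  "\<omega> = otype natLeq"

primrec tower :: "cord \<Rightarrow> nat \<Rightarrow> cord \<Rightarrow> cord" where
  "tower \<beta> 0 \<alpha> = \<alpha>"
| "tower \<beta> (Suc j) \<alpha> = oexp \<beta> (tower \<beta> j \<alpha>)"

unbundle no cardinal_syntax

section \<open>The language\<close>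

text \<open>
  The function and relation symbols of arity \<open>n\<close> are the functions and relations on lists of
  length \<open>n\<close> themselves: a function symbol is extended by \<^term>\<open>undefined\<close>, a relation symbol
  by falsity, to lists of other lengths (see \<open>lterm\<close>, \<open>latom\<close> below), so that distinct symbols
  denote distinct functions or relations. The arity is the number of arguments.

  The representation is locally nameless: \<open>Var\<close> stands for free variables, \<open>Bnd\<close> for de Bruijn
  indices. Hence formulas are identified up to renaming of bound variables. The binders
  \<open>ForallB\<close>, \<open>ExistsB\<close> and the indices are only used through \<open>Forall x \<phi>\<close> and \<open>Exists x \<phi>\<close>,
  which bind a named variable. Formulas are in negation normal form.
\<close>

datatype tm = Var nat | Bnd nat | Fn "nat list \<Rightarrow> nat" "tm list"

datatype atm = Pr "nat list set" "tm list" | InX tm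

datatype fm = Pos atm | Neg atm | And fm fm | Or fm fm | ForallB fm | ExistsB fm

fun neg :: "fm \<Rightarrow> fm" where
  "neg (Pos a) = Neg a"
| "neg (Neg a) = Pos a"
| "neg (And \<phi> \<psi>) = Or (neg \<phi>) (neg \<psi>)"
| "neg (Or \<phi> \<psi>) = And (neg \<phi>) (neg \<psi>)"
| "neg (ForallB \<phi>) = ExistsB (neg \<phi>)"
| "neg (ExistsB \<phi>) = ForallB (neg \<phi>)"

abbreviation Imp :: "fm \<Rightarrow> fm \<Rightarrow> fm" where
  "Imp \<phi> \<psi> \<equiv> Or (neg \<phi>) \<psi>"

fun tvars :: "tm \<Rightarrow> nat set" where
  "tvars (Var x) = {x}"
| "tvars (Bnd n) = {}"
| "tvars (Fn f ts) = (\<Union>t\<in>set ts. tvars t)"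

fun avars :: "atm \<Rightarrow> nat set" where
  "avars (Pr R ts) = (\<Union>t\<in>set ts. tvars t)"
| "avars (InX t) = tvars t"

fun fv :: "fm \<Rightarrow> nat set" where
  "fv (Pos a) = avars a"
| "fv (Neg a) = avars a"
| "fv (And \<phi> \<psi>) = fv \<phi> \<union> fv \<psi>"
| "fv (Or \<phi> \<psi>) = fv \<phi> \<union> fv \<psi>"
| "fv (ForallB \<phi>) = fv \<phi>"
| "fv (ExistsB \<phi>) = fv \<phi>"

definition fvs :: "fm set \<Rightarrow> nat set" where
  "fvs \<Gamma> = (\<Union>\<phi>\<in>\<Gamma>. fv \<phi>)"

text \<open>Replacement of a free variable by an arbitrary term; \<open>n\<close> is shifted under binders.\<close>

fun replace_tm :: "nat \<Rightarrow> (nat \<Rightarrow> tm) \<Rightarrow> nat \<Rightarrow> tm \<Rightarrow> tm" where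
  "replace_tm x u n (Var y) = (if y = x then u n else Var y)"
| "replace_tm x u n (Bnd m) = Bnd m"
| "replace_tm x u n (Fn f ts) = Fn f (map (replace_tm x u n) ts)"

fun replace_atm :: "nat \<Rightarrow> (nat \<Rightarrow> tm) \<Rightarrow> nat \<Rightarrow> atm \<Rightarrow> atm" where
  "replace_atm x u n (Pr R ts) = Pr R (map (replace_tm x u n) ts)"
| "replace_atm x u n (InX t) = InX (replace_tm x u n t)"

fun replace_fm :: "nat \<Rightarrow> (nat \<Rightarrow> tm) \<Rightarrow> nat \<Rightarrow> fm \<Rightarrow> fm" where
  "replace_fm x u n (Pos a) = Pos (replace_atm x u n a)"
| "replace_fm x u n (Neg a) = Neg (replace_atm x u n a)"
| "replace_fm x u n (And \<phi> \<psi>) = And (replace_fm x u n \<phi>) (replace_fm x u n \<psi>)"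
| "replace_fm x u n (Or \<phi> \<psi>) = Or (replace_fm x u n \<phi>) (replace_fm x u n \<psi>)"
| "replace_fm x u n (ForallB \<phi>) = ForallB (replace_fm x u (Suc n) \<phi>)"
| "replace_fm x u n (ExistsB \<phi>) = ExistsB (replace_fm x u (Suc n) \<phi>)"

abbreviation subst :: "fm \<Rightarrow> nat \<Rightarrow> tm \<Rightarrow> fm" where
  "subst \<phi> x t \<equiv> replace_fm x (\<lambda>_. t) 0 \<phi>"

definition Forall :: "nat \<Rightarrow> fm \<Rightarrow> fm" where
  "Forall x \<phi> = ForallB (replace_fm x Bnd 0 \<phi>)"

definition Exists :: "nat \<Rightarrow> fm \<Rightarrow> fm" where
  "Exists x \<phi> = ExistsB (replace_fm x Bnd 0 \<phi>)"

inductive lterm :: "tm \<Rightarrow> bool" where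
  "lterm (Var x)"
| "f \<in> extensional {xs. length xs = length ts} \<Longrightarrow> \<forall>t\<in>set ts. lterm t \<Longrightarrow> lterm (Fn f ts)"

inductive latom :: "atm \<Rightarrow> bool" where
  "R \<subseteq> {xs. length xs = length ts} \<Longrightarrow> \<forall>t\<in>set ts. lterm t \<Longrightarrow> latom (Pr R ts)"
| "lterm t \<Longrightarrow> latom (InX t)"

text \<open>The formulas of \<open>L\<^sub>N(X)\<close>.\<close>

inductive lformula :: "fm \<Rightarrow> bool" where
  "latom a \<Longrightarrow> lformula (Pos a)"
| "latom a \<Longrightarrow> lformula (Neg a)"
| "lformula \<phi> \<Longrightarrow> lformula \<psi> \<Longrightarrow> lformula (And \<phi> \<psi>)"
| "lformula \<phi> \<Longrightarrow> lformula \<psi> \<Longrightarrow> lformula (Or \<phi> \<psi>)"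
| "lformula \<phi> \<Longrightarrow> lformula (Forall x \<phi>)"
| "lformula \<phi> \<Longrightarrow> lformula (Exists x \<phi>)"

fun X_free :: "fm \<Rightarrow> bool" where
  "X_free (Pos a) = (\<forall>t. a \<noteq> InX t)"
| "X_free (Neg a) = (\<forall>t. a \<noteq> InX t)"
| "X_free (And \<phi> \<psi>) = (X_free \<phi> \<and> X_free \<psi>)"
| "X_free (Or \<phi> \<psi>) = (X_free \<phi> \<and> X_free \<psi>)"
| "X_free (ForallB \<phi>) = X_free \<phi>"
| "X_free (ExistsB \<phi>) = X_free \<phi>"

definition Fn_sym :: "nat \<Rightarrow> (nat list \<Rightarrow> nat) \<Rightarrow> tm list \<Rightarrow> tm" where
  "Fn_sym n f = Fn (restrict f {xs. length xs = n})"

definition tzero :: tm where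
  "tzero = Fn_sym 0 (\<lambda>_. 0) []"

definition tplus1 :: "tm \<Rightarrow> tm" where
  "tplus1 t = Fn_sym 2 (\<lambda>xs. xs ! 0 + xs ! 1) [t, Fn_sym 0 (\<lambda>_. 1) []]"

definition binrel :: "nat rel \<Rightarrow> tm \<Rightarrow> tm \<Rightarrow> atm" where
  "binrel r s t = Pr {[m, n] | m n. (m, n) \<in> r} [s, t]"

abbreviation Eq :: "tm \<Rightarrow> tm \<Rightarrow> atm" where
  "Eq \<equiv> binrel Id"

abbreviation Le :: "tm \<Rightarrow> tm \<Rightarrow> atm" where
  "Le \<equiv> binrel {(m, n). m \<le> n}"

text \<open>
  Bounded quantifiers are \<open>\<forall>x (x \<le> t \<longrightarrow> \<phi>)\<close> and \<open>\<exists>x (x \<le> t \<and> \<phi>)\<close> with \<open>x\<close> not in \<open>t\<close>,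
  the implication being written in negation normal form.
\<close>

inductive_set Delta0_X :: "fm set" where
  "latom a \<Longrightarrow> Pos a \<in> Delta0_X"
| "latom a \<Longrightarrow> Neg a \<in> Delta0_X"
| "\<phi> \<in> Delta0_X \<Longrightarrow> \<psi> \<in> Delta0_X \<Longrightarrow> And \<phi> \<psi> \<in> Delta0_X"
| "\<phi> \<in> Delta0_X \<Longrightarrow> \<psi> \<in> Delta0_X \<Longrightarrow> Or \<phi> \<psi> \<in> Delta0_X"
| "\<phi> \<in> Delta0_X \<Longrightarrow> lterm t \<Longrightarrow> x \<notin> tvars t \<Longrightarrow>
     Forall x (Imp (Pos (Le (Var x) t)) \<phi>) \<in> Delta0_X"
| "\<phi> \<in> Delta0_X \<Longrightarrow> lterm t \<Longrightarrow> x \<notin> tvars t \<Longrightarrow>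
     Exists x (And (Pos (Le (Var x) t)) \<phi>) \<in> Delta0_X"

text \<open>
  The quantifiers of the prefix are unbounded and the matrix is a maximal \<open>\<Delta>\<^sub>0\<close>-subformula:
  no formula obtained by prefixing a quantifier is itself bounded.
\<close>

fun pSigma_X pPi_X :: "nat \<Rightarrow> fm set" where
  "pSigma_X 0 = Delta0_X"
| "pSigma_X (Suc i) = {Exists x \<phi> | x \<phi>. \<phi> \<in> pPi_X i} - Delta0_X"
| "pPi_X 0 = Delta0_X"
| "pPi_X (Suc i) = {Forall x \<phi> | x \<phi>. \<phi> \<in> pSigma_X i} - Delta0_X"

definition pSigma :: "nat \<Rightarrow> fm set" where
  "pSigma i = {\<phi> \<in> pSigma_X i. X_free \<phi>}"

section \<open>Truth and the theories\<close>

text \<open>Evaluation of free variables by \<open>e\<close>, of indices by \<open>b\<close>, and of \<open>X\<close> by \<open>A\<close>.\<close>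

fun tval :: "(nat \<Rightarrow> nat) \<Rightarrow> (nat \<Rightarrow> nat) \<Rightarrow> tm \<Rightarrow> nat" where
  "tval e b (Var x) = e x"
| "tval e b (Bnd n) = b n"
| "tval e b (Fn f ts) = f (map (tval e b) ts)"

fun aval :: "nat set \<Rightarrow> (nat \<Rightarrow> nat) \<Rightarrow> (nat \<Rightarrow> nat) \<Rightarrow> atm \<Rightarrow> bool" where
  "aval A e b (Pr R ts) \<longleftrightarrow> map (tval e b) ts \<in> R"
| "aval A e b (InX t) \<longleftrightarrow> tval e b t \<in> A"

fun sat :: "nat set \<Rightarrow> (nat \<Rightarrow> nat) \<Rightarrow> (nat \<Rightarrow> nat) \<Rightarrow> fm \<Rightarrow> bool" where
  "sat A e b (Pos a) \<longleftrightarrow> aval A e b a"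
| "sat A e b (Neg a) \<longleftrightarrow> \<not> aval A e b a"
| "sat A e b (And \<phi> \<psi>) \<longleftrightarrow> sat A e b \<phi> \<and> sat A e b \<psi>"
| "sat A e b (Or \<phi> \<psi>) \<longleftrightarrow> sat A e b \<phi> \<or> sat A e b \<psi>"
| "sat A e b (ForallB \<phi>) \<longleftrightarrow> (\<forall>n. sat A e (case_nat n b) \<phi>)"
| "sat A e b (ExistsB \<phi>) \<longleftrightarrow> (\<exists>n. sat A e (case_nat n b) \<phi>)"

text \<open>For the sentences of \<open>L\<^sub>N\<close> truth does not depend on the parameters of \<^const>\<open>sat\<close>.\<close>

definition ThN :: "fm set" where
  "ThN = {\<phi> \<in> (\<Union>i. pSigma i). fv \<phi> = {} \<and> (\<forall>A e b. sat A e b \<phi>)}"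

definition induction_axiom :: "nat \<Rightarrow> fm \<Rightarrow> fm" where
  "induction_axiom x \<phi> =
     Imp (And (subst \<phi> x tzero) (Forall x (Imp \<phi> (subst \<phi> x (tplus1 (Var x)))))) (Forall x \<phi>)"

text \<open>
  Instances of induction may contain parameters; in \<open>proves\<close> below, axioms with free variables
  amount to their universal closures.
\<close>

definition ISigma_X :: "nat \<Rightarrow> fm set" where
  "ISigma_X k = ThN \<union> {induction_axiom x \<phi> | x \<phi>. \<phi> \<in> pSigma_X k}"

section \<open>Sequents and first-order provability\<close>

definition sequent :: "fm set \<Rightarrow> bool" where
  "sequent \<Gamma> \<longleftrightarrow> finite \<Gamma> \<and> (\<forall>\<phi>\<in>\<Gamma>. lformula \<phi>)"

text \<open>
  Provability from the axioms \<open>T\<close> in classical first-order logic with equality, as a one-sided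
  sequent calculus with cut. The eigenvariable condition refers to the sequent only and not to
  the axioms, which is why the axioms are used as universally closed.
\<close>

inductive proves :: "fm set \<Rightarrow> fm set \<Rightarrow> bool" for T where
  Axiom: "sequent \<Gamma> \<Longrightarrow> \<phi> \<in> T \<Longrightarrow> \<phi> \<in> \<Gamma> \<Longrightarrow> proves T \<Gamma>"
| Initial: "sequent \<Gamma> \<Longrightarrow> Pos a \<in> \<Gamma> \<Longrightarrow> Neg a \<in> \<Gamma> \<Longrightarrow> proves T \<Gamma>"
| Refl: "sequent \<Gamma> \<Longrightarrow> Pos (Eq t t) \<in> \<Gamma> \<Longrightarrow> proves T \<Gamma>"
| Replace: "sequent \<Gamma> \<Longrightarrow> latom a \<Longrightarrow> lterm s \<Longrightarrow> lterm t \<Longrightarrow>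
    {Neg (Eq s t), subst (Neg a) x s, subst (Pos a) x t} \<subseteq> \<Gamma> \<Longrightarrow> proves T \<Gamma>"
| OrI: "Or \<phi> \<psi> \<in> \<Gamma> \<Longrightarrow> proves T (insert \<phi> (insert \<psi> \<Gamma>)) \<Longrightarrow> proves T \<Gamma>"
| AndI: "And \<phi> \<psi> \<in> \<Gamma> \<Longrightarrow> proves T (insert \<phi> \<Gamma>) \<Longrightarrow> proves T (insert \<psi> \<Gamma>) \<Longrightarrow> proves T \<Gamma>"
| ExistsI: "Exists x \<phi> \<in> \<Gamma> \<Longrightarrow> lformula \<phi> \<Longrightarrow> lterm t \<Longrightarrow> proves T (insert (subst \<phi> x t) \<Gamma>) \<Longrightarrow>
    proves T \<Gamma>"
| ForallI: "Forall x \<phi> \<in> \<Gamma> \<Longrightarrow> lformula \<phi> \<Longrightarrow> a \<notin> fvs \<Gamma> \<Longrightarrow>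
    proves T (insert (subst \<phi> x (Var a)) \<Gamma>) \<Longrightarrow> proves T \<Gamma>"
| Cut: "lformula \<phi> \<Longrightarrow> proves T (insert \<phi> \<Gamma>) \<Longrightarrow> proves T (insert (neg \<phi>) \<Gamma>) \<Longrightarrow> proves T \<Gamma>"

definition provable :: "fm set \<Rightarrow> fm \<Rightarrow> bool" where
  "provable T \<phi> \<longleftrightarrow> proves T {\<phi>}"

definition TI_all :: fm where
  "TI_all = Forall 0 (Neg (InX (Var 0)))"

definition TI_prog :: "nat rel \<Rightarrow> fm" where
  "TI_prog prec = Exists 0 (Forall 1 (And (Pos (InX (Var 0)))
     (Or (Neg (InX (Var 1))) (Neg (binrel prec (Var 1) (Var 0))))))"

text \<open>The argument \<open>prec\<close> is the strict order.\<close>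

definition TI :: "nat rel \<Rightarrow> fm set" where
  "TI prec = {TI_all, TI_prog prec}"

section \<open>Derivations in free variable normal form without redundancy\<close>

text \<open>
  \<open>inference k Ps \<Gamma>\<close>: the sequent \<open>\<Gamma>\<close> follows from the list of premises \<open>Ps\<close> by one rule;
  induction
  and cut formulas are in \<open>p\<Sigma>\<^sub>k(X)\<close>.
\<close>

inductive inference :: "nat \<Rightarrow> fm set list \<Rightarrow> fm set \<Rightarrow> bool" for k where
  Initial: "Pos a \<in> \<Gamma> \<Longrightarrow> Neg a \<in> \<Gamma> \<Longrightarrow> inference k [] \<Gamma>"
| OrR: "Or \<phi>1 \<phi>2 \<in> \<Gamma> \<Longrightarrow> \<phi> \<in> {\<phi>1, \<phi>2} \<Longrightarrow> \<phi> \<notin> \<Gamma> \<Longrightarrow> inference k [insert \<phi> \<Gamma>] \<Gamma>"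
| ExistsR: "Exists x \<phi> \<in> \<Gamma> \<Longrightarrow> lformula \<phi> \<Longrightarrow> lterm u \<Longrightarrow>
    tvars u \<subseteq> fvs (insert (subst \<phi> x u) \<Gamma>) \<Longrightarrow> fvs (insert (subst \<phi> x u) \<Gamma>) = fvs \<Gamma> \<Longrightarrow>
    subst \<phi> x u \<notin> \<Gamma> \<Longrightarrow> inference k [insert (subst \<phi> x u) \<Gamma>] \<Gamma>"
| AndR: "And \<phi>1 \<phi>2 \<in> \<Gamma> \<Longrightarrow> \<phi>1 \<notin> \<Gamma> \<Longrightarrow> \<phi>2 \<notin> \<Gamma> \<Longrightarrow> inference k [insert \<phi>1 \<Gamma>, insert \<phi>2 \<Gamma>] \<Gamma>"
| ForallR: "Forall x \<phi> \<in> \<Gamma> \<Longrightarrow> lformula \<phi> \<Longrightarrow> a \<notin> fvs \<Gamma> \<Longrightarrow> subst \<phi> x (Var a) \<notin> \<Gamma> \<Longrightarrow>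
    fvs (insert (subst \<phi> x (Var a)) \<Gamma>) \<subseteq> fvs \<Gamma> \<union> {a} \<Longrightarrow>
    inference k [insert (subst \<phi> x (Var a)) \<Gamma>] \<Gamma>"
| TrueSentence: "\<phi> \<in> ThN \<Longrightarrow> neg \<phi> \<notin> \<Gamma> \<Longrightarrow> inference k [insert (neg \<phi>) \<Gamma>] \<Gamma>"
| Induction: "\<phi> \<in> pSigma_X k \<Longrightarrow> lterm t \<Longrightarrow> tvars t \<subseteq> fv (subst \<phi> x t) \<Longrightarrow>
    subst \<phi> x tzero \<notin> \<Gamma> \<Longrightarrow> subst \<phi> x t \<notin> \<Gamma> \<Longrightarrow>
    a \<notin> fvs \<Gamma> \<Longrightarrow> fvs (insert (subst \<phi> x tzero) \<Gamma>) = fvs \<Gamma> \<Longrightarrow>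
    fvs (insert (neg (subst \<phi> x t)) \<Gamma>) = fvs \<Gamma> \<Longrightarrow>
    fvs (insert (neg (subst \<phi> x (Var a))) (insert (subst \<phi> x (tplus1 (Var a))) \<Gamma>)) =
      fvs \<Gamma> \<union> {a} \<Longrightarrow>
    inference k
      [insert (subst \<phi> x tzero) \<Gamma>,
       insert (neg (subst \<phi> x (Var a))) (insert (subst \<phi> x (tplus1 (Var a))) \<Gamma>),
       insert (neg (subst \<phi> x t)) \<Gamma>] \<Gamma>"
| Cut: "\<phi> \<in> pSigma_X k \<Longrightarrow> \<phi> \<notin> \<Gamma> \<Longrightarrow> neg \<phi> \<notin> \<Gamma> \<Longrightarrow>
    fvs (insert \<phi> \<Gamma>) = fvs \<Gamma> \<Longrightarrow> fvs (insert (neg \<phi>) \<Gamma>) = fvs \<Gamma> \<Longrightarrow>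
    inference k [insert \<phi> \<Gamma>, insert (neg \<phi>) \<Gamma>] \<Gamma>"

definition rooted_tree :: "nat list set \<Rightarrow> bool" where
  "rooted_tree \<tau> \<longleftrightarrow> \<tau> \<noteq> {} \<and> (\<forall>v\<in>\<tau>. \<forall>u. prefix u v \<longrightarrow> u \<in> \<tau>)"

definition height :: "nat list set \<Rightarrow> nat" where
  "height \<tau> = Max (length ` \<tau>)"

text \<open>
  The children of a node correspond one-to-one, in any order, to the premises of the rule.
\<close>

definition ISigma_X_derivation ::
  "nat \<Rightarrow> fm set \<Rightarrow> nat list set \<Rightarrow> (nat list \<Rightarrow> fm set) \<Rightarrow> bool" where
  "ISigma_X_derivation k S \<tau> l \<longleftrightarrow>
     rooted_tree \<tau> \<and> finite \<tau> \<and> (\<forall>v\<in>\<tau>. sequent (l v)) \<and> l [] = S \<and>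
     (\<forall>v\<in>\<tau>. \<exists>ks. distinct ks \<and> set ks = {i. v @ [i] \<in> \<tau>} \<and>
        inference k (map (\<lambda>i. l (v @ [i])) ks) (l v))"

end

theory Submission
  imports Defs
begin

text \<open>
  Both parts go through infinitary derivations with the \<open>\<omega>\<close>-rule over closed formulas. A finite derivation of
  height \<open>h\<close> becomes an infinitary one of height \<open>h\<close> that still has an induction rule and cuts of rank
  \<open>k + 1\<close>. Unfolding inductions into chains of cuts raises the height to some \<open>\<alpha> < \<omega> * (h + 1)\<close>, and
  eliminating \<open>k + 1\<close> levels of cuts raises it to less than \<open>2\<^sub>k(2\<^bsup>\<omega>(h+1)\<^esup>) = 2\<^sub>k(\<omega>\<^bsup>h+1\<^esup>)\<close>. A cut-free
  derivation of transfinite induction of height \<open>\<gamma>\<close> exists only for order types at most \<open>\<omega> * \<gamma>\<close>, and the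
  factor \<open>\<omega>\<close> is absorbed by \<open>2\<^sub>k(\<omega>\<^bsup>h+1\<^esup>)\<close> for \<open>h \<ge> 1\<close>. For first-order provability, cuts of rank
  above \<open>k + 1\<close> are eliminated first, while induction is still a rule and heights are finite.
\<close>

section \<open>Arithmetic of countable ordinals\<close>

text \<open>The number of exponentials must be exact, so the rank may count only the unbounded
  quantifiers of a prefix. This forces whole bounded formulas to be atoms; such an atom consults
  several values of \<open>X\<close>, so atoms are sets of interpretations instead of single
  literals. Of the k + 1 exponentials the innermost does not show up as a level of the tower,
  because 2^(omega * n) = omega^n; this is the origin of omega^(h+1). The cuts of a first-order
  proof have a rank bounded only by the proof itself. If inductions were unfolded before the surplus
  ranks are removed, each surplus level would exponentiate an infinite height and the tower would
  depend on the proof. Finite heights stay finite under 2^x, so with induction still a rule the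
  surplus is free.\<close>

lemma plus_right_mono_cord: "b \<le> c \<Longrightarrow> a + b \<le> a + (c :: cord)"
  using plus_least(2)[of b c a] by (auto simp: le_less)

lemma zero_plus_cord: "0 + a = (a :: cord)"
proof (induction a rule: less_induct)
  case (less a)
  have "0 + a \<le> a" by (rule plus_least(3)) (simp_all add: less)
  moreover have "\<not> 0 + a < a"
    using less[of "0 + a"] plus_least(2)[of "0 + a" a 0] by auto
  ultimately show ?case by simp
qed

lemma le_plus_right_cord: "b \<le> a + (b :: cord)"
  using plus_mono_left_cord[of 0 a b] by (simp add: zero_plus_cord)

lemma less_plusE_cord:
  assumes "e < b + (c :: cord)"
  obtains "e < b" | d where "d < c" "e \<le> b + d"
  using assms plus_least(3)[of b e c] by (meson not_le)

lemma plus_assoc_cord: "(a + b) + c = a + (b + (c :: cord))"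
proof (induction c rule: less_induct)
  case (less c)
  show ?case
  proof (rule antisym)
    show "(a + b) + c \<le> a + (b + c)"
      by (rule plus_least(3)) (simp_all add: less plus_least plus_right_mono_cord)
    show "a + (b + c) \<le> (a + b) + c"
    proof (rule plus_least(3))
      show "a \<le> (a + b) + c" using plus_least(1) order_trans by blast
      fix e assume "e < b + c"
      then show "a + e < (a + b) + c"
      proof (cases rule: less_plusE_cord)
        case 1
        then show ?thesis using plus_least(1,2) less_le_trans by blast
      next
        case (2 d)
        have "a + e \<le> (a + b) + d" using 2 less by (simp add: plus_right_mono_cord)
        then show ?thesis using 2 plus_least(2) le_less_trans by blast
      qed
    qed
  qed
qed

text \<open>Left subtraction: minimality of \<open>?c\<close> gives \<open>a + d < b\<close> for
  every smaller \<open>d\<close>, which is what bounds \<open>a + ?c\<close> from above.\<close>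

lemma le_imp_plus_cord:
  assumes "a \<le> (b :: cord)"
  obtains c where "b = a + c"
proof
  let ?c = "LEAST c. b \<le> a + c"
  have "b \<le> a + ?c" by (rule LeastI[of _ b]) (rule le_plus_right_cord)
  moreover have "a + ?c \<le> b"
    by (rule plus_least(3)[OF assms]) (use not_less_Least in force)
  ultimately show "b = a + ?c" by simp
qed

lemma less_timesE_cord:
  assumes "e < a * (c :: cord)"
  obtains d where "d < c" "e < a * d + a"
  using assms times_least(2)[of c a e] by (meson not_le)

lemma times_plus_cord: "a * (b + c) = a * b + a * (c :: cord)"
proof (induction c rule: less_induct)
  case (less c)
  show ?case
  proof (rule antisym)
    show "a * (b + c) \<le> a * b + a * c"
    proof (rule times_least(2))
      fix e assume "e < b + c"
      then show "a * e + a \<le> a * b + a * c"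
      proof (cases rule: less_plusE_cord)
        case 1
        then show ?thesis using times_least(1) plus_least(1) order_trans by blast
      next
        case (2 d)
        have "a * e + a \<le> (a * b + a * d) + a"
          using 2 less by (metis plus_mono_left_cord times_mono_cord)
        also have "\<dots> \<le> a * b + a * c"
          using 2 by (simp add: plus_assoc_cord plus_right_mono_cord times_least(1))
        finally show ?thesis .
      qed
    qed
    show "a * b + a * c \<le> a * (b + c)"
    proof (rule plus_least(3))
      show "a * b \<le> a * (b + c)" by (simp add: plus_least(1) times_mono_cord)
      fix e assume "e < a * c"
      then obtain d where d: "d < c" "e < a * d + a" by (rule less_timesE_cord)
      have "a * b + e < a * b + (a * d + a)" using d by (simp add: plus_least(2))
      also have "\<dots> = a * (b + d) + a" using d less by (simp add: plus_assoc_cord)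
      also have "\<dots> \<le> a * (b + c)" using d by (simp add: times_least(1) plus_least(2))
      finally show "a * b + e < a * (b + c)" .
    qed
  qed
qed

lemma times_assoc_cord: "(a * b) * c = a * (b * (c :: cord))"
proof (induction c rule: less_induct)
  case (less c)
  show ?case
  proof (rule antisym)
    show "(a * b) * c \<le> a * (b * c)"
    proof (rule times_least(2))
      fix d assume "d < c"
      then show "(a * b) * d + a * b \<le> a * (b * c)"
        using less by (simp add: times_plus_cord[symmetric] times_mono_cord times_least(1))
    qed
    show "a * (b * c) \<le> (a * b) * c"
    proof (rule times_least(2))
      fix e assume "e < b * c"
      then obtain d where d: "d < c" "e < b * d + b" by (rule less_timesE_cord)
      have "a * e + a \<le> a * (b * d + b)" using d(2) by (rule times_least(1))
      also have "\<dots> = (a * b) * d + a * b" using d less by (simp add: times_plus_cord)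
      also have "\<dots> \<le> (a * b) * c" using d by (simp add: times_least(1))
      finally show "a * e + a \<le> (a * b) * c" .
    qed
  qed
qed

lemma one_le_cord: "1 \<le> x \<longleftrightarrow> x \<noteq> (0 :: cord)"
  using less_one_cord[of x] by (simp add: not_less[symmetric])

lemma oexp_nonzero: "a \<noteq> 0 \<Longrightarrow> oexp a b \<noteq> 0"
  using oexp_least(1)[of a b] by (simp add: one_le_cord)

lemma oexp_plus:
  assumes a: "a \<noteq> 0"
  shows "oexp a (b + c) = oexp a b * oexp a c"
proof (induction c rule: less_induct)
  case (less c)
  show ?case
  proof (rule antisym)
    show "oexp a (b + c) \<le> oexp a b * oexp a c"
    proof (rule oexp_least(3)[OF a])
      show "1 \<le> oexp a b * oexp a c"
        using oexp_least(1)[OF a] le_times_cord oexp_nonzero[OF a] order_trans by blast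
      fix e assume "e < b + c"
      then show "oexp a e * a \<le> oexp a b * oexp a c"
      proof (cases rule: less_plusE_cord)
        case 1
        then show ?thesis
          using oexp_least(2)[OF a] le_times_cord oexp_nonzero[OF a] order_trans by blast
      next
        case (2 d)
        have "oexp a e * a \<le> oexp a (b + d) * a"
          using 2 by (simp add: times_mono_left_cord oexp_mono_cord a)
        also have "\<dots> = oexp a b * (oexp a d * a)" using 2 less by (simp add: times_assoc_cord)
        also have "\<dots> \<le> oexp a b * oexp a c"
          using 2 by (simp add: times_mono_cord oexp_least(2) a)
        finally show ?thesis .
      qed
    qed
    show "oexp a b * oexp a c \<le> oexp a (b + c)"
    proof (rule times_least(2))
      fix e assume e: "e < oexp a c"
      \<comment> \<open>Being below a least upper bound, \<open>e\<close> lies under its starting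
        value 1 or under one of the earlier stages.\<close>
      then consider "e = 0" | d where "d < c" "e < oexp a d * a"
        using oexp_least(3)[OF a, of e c] less_one_cord by (meson not_le)
      then show "oexp a b * e + oexp a b \<le> oexp a (b + c)"
      proof cases
        case 1
        then show ?thesis by (simp add: zero_plus_cord oexp_mono_cord a plus_least(1))
      next
        case (2 d)
        have "oexp a b * e + oexp a b \<le> oexp a b * (oexp a d * a)"
          using 2(2) by (rule times_least(1))
        also have "\<dots> = oexp a (b + d) * a" using 2 less by (simp add: times_assoc_cord)
        also have "\<dots> \<le> oexp a (b + c)" using 2 by (simp add: oexp_least(2) a plus_least(2))
        finally show ?thesis .
      qed
    qed
  qed
qed

lemma ord_of_nat_2: "ord_of_nat 2 = 1 + 1"
  by (simp add: numeral_2_eq_2 zero_plus_cord)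

lemma times_two_cord: "a * ord_of_nat 2 = a + (a :: cord)"
  by (simp add: ord_of_nat_2 times_succ_cord)

lemma oexp_strict_mono:
  assumes a: "ord_of_nat 2 \<le> a" and "b < c"
  shows "oexp a b < oexp a c"
proof -
  have a0: "a \<noteq> 0" using a less_plus_one_cord[of 0 1] by (auto simp: ord_of_nat_2)
  have "oexp a b < oexp a b + oexp a b"
    using plus_least(2)[of 0 "oexp a b" "oexp a b"] oexp_nonzero[OF a0, of b] by (simp add: less_le)
  also have "\<dots> \<le> oexp a b * a" by (metis times_two_cord times_mono_cord a)
  also have "\<dots> \<le> oexp a c" by (rule oexp_least(2)[OF a0 assms(2)])
  finally show ?thesis .
qed

text \<open>At a least failure \<open>b\<close> the ordinal \<open>c = oexp a b\<close> is below
  \<open>b\<close>, so \<open>c \<le> oexp a c\<close> by hypothesis, while strict monotonicity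
  gives \<open>oexp a c < c\<close>.\<close>

lemma le_oexp:
  assumes a: "ord_of_nat 2 \<le> a"
  shows "b \<le> oexp a b"
proof (induction b rule: less_induct)
  case (less b)
  show ?case
  proof (rule ccontr)
    assume "\<not> b \<le> oexp a b"
    then have "oexp a b < b" by simp
    then show False using less oexp_strict_mono[OF a, of "oexp a b" b] by (meson leD)
  qed
qed

lemma oexp_mono_base:
  assumes "a \<noteq> 0" "a \<le> b"
  shows "oexp a c \<le> oexp b c"
proof (induction c rule: less_induct)
  case (less c)
  have b: "b \<noteq> 0" using assms by (metis antisym zero_le_cord)
  show ?case
  proof (rule oexp_least(3)[OF assms(1)])
    show "1 \<le> oexp b c" by (rule oexp_least(1)[OF b])
    fix d assume "d < c"
    then have "oexp a d * a \<le> oexp b d * b"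
      using less assms(2) by (meson order_trans times_mono_cord times_mono_left_cord)
    then show "oexp a d * a \<le> oexp b c" using oexp_least(2)[OF b \<open>d < c\<close>] order_trans by blast
  qed
qed

section \<open>Ranks of the elements of a well-order\<close>

unbundle cardinal_syntax

text \<open>This is the rank of \<open>a\<close>. For a well-order on \<nat> the ranks are exactly
  the ordinals below its order type.\<close>

definition seg_otype :: "nat rel \<Rightarrow> nat \<Rightarrow> cord" where
  "seg_otype r a = otype (Restr r (underS r a))"

lemma less_otype_imp_seg:
  assumes r: "well_order_on UNIV r" and x: "x < otype r"
  shows "\<exists>a. x = seg_otype r a"
proof -
  have rW: "Well_order r" using r by (metis well_order_on_Well_order)
  obtain s where s: "Well_order s" "x = otype s" using otype_surj by blast
  have "s <o r" using x s rW otype_less by simp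
  then obtain a where "s =o Restr r (underS r a)"
    using ordLess_iff_ordIso_Restr rW s by blast
  then show ?thesis
    unfolding seg_otype_def using s rW by (metis ordIso_Well_order otype_eq)
qed

lemma seg_otype_less_otype:
  assumes r: "well_order_on UNIV r"
  shows "seg_otype r a < otype r"
proof -
  have F: "Field r = UNIV" using well_order_on_Well_order[OF r] by simp
  have rW: "Well_order r" using r unfolding F .
  have "Restr r (underS r a) <o r"
    using underS_Restr_ordLess[OF rW, of a] F by auto
  then show ?thesis
    unfolding seg_otype_def using otype_less[OF Well_order_Restr[OF rW] rW] by blast
qed

lemma seg_otype_less_iff:
  assumes r: "well_order_on UNIV r"
  shows "seg_otype r a < seg_otype r b \<longleftrightarrow> (a, b) \<in> r - Id"
proof -
  have F: "Field r = UNIV" using well_order_on_Well_order[OF r] by simp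
  have rW: "Well_order r" using r unfolding F .
  have wo: "wo_rel r" using rW by (simp add: wo_rel_def)
  note TOTALS = wo_rel.TOTALS[OF wo] and TRANS = wo_rel.TRANS[OF wo]
    and ANTISYM = wo_rel.ANTISYM[OF wo]
  have less: "seg_otype r a < seg_otype r b" if "(a, b) \<in> r - Id" for a b
  proof -
    have "a \<in> underS r b" "underS r a \<subseteq> underS r b" "a \<notin> underS r a"
      using that TRANS ANTISYM unfolding underS_def trans_def antisym_def by blast+
    then have "underS r a \<subset> underS r b" by blast
    then have "Restr r (underS r a) <o Restr r (underS r b)"
      using ofilter_subset_ordLess rW wo_rel.underS_ofilter[OF wo] by blast
    then show ?thesis
      unfolding seg_otype_def
      using otype_less[OF Well_order_Restr[OF rW] Well_order_Restr[OF rW]] by blast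
  qed
  show ?thesis
  proof
    assume lt: "seg_otype r a < seg_otype r b"
    show "(a, b) \<in> r - Id"
    proof (rule ccontr)
      assume "(a, b) \<notin> r - Id"
      then have "a = b \<or> (b, a) \<in> r - Id" using TOTALS F by auto
      then show False using lt less[of b a] by auto
    qed
  qed (rule less)
qed

unbundle no cardinal_syntax

section \<open>Finite ordinals and omega\<close>

lemma less_omega_iff: "x < \<omega> \<longleftrightarrow> (\<exists>n. x = ord_of_nat n)"
proof -
  let ?f = "seg_otype natLeq"
  have W: "well_order_on UNIV natLeq" using natLeq_Well_order by (simp add: Field_natLeq)
  have iff: "?f m < ?f n \<longleftrightarrow> m < n" for m n
    unfolding seg_otype_less_iff[OF W] by (auto simp: natLeq_def)
  have ex: "x < \<omega> \<longleftrightarrow> (\<exists>n. x = ?f n)" for x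
    unfolding omega_def using less_otype_imp_seg[OF W] seg_otype_less_otype[OF W] by blast
  \<comment> \<open>\<open>\<omega>\<close> is given as an order type but \<open>ord_of_nat\<close>
    by recursion; they meet because the rank of \<open>n\<close> in \<open>natLeq\<close> is
    \<open>n\<close>. The successor case compares the ordinals below both sides.\<close>
  have "?f n = ord_of_nat n" for n
  proof (induction n)
    case 0
    have "\<not> 0 < ?f 0" using ex[of 0] ex[of "?f 0"] iff by (metis less_trans not_less_zero)
    then show ?case by (simp add: less_le)
  next
    case (Suc n)
    have "x < ?f (Suc n) \<longleftrightarrow> x < ?f n + 1" for x
    proof
      assume x: "x < ?f (Suc n)"
      then obtain m where "x = ?f m" using ex by (metis less_trans)
      then show "x < ?f n + 1"
        using x iff less_plus_one_cord by (metis less_Suc_eq_le not_le)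
    next
      assume "x < ?f n + 1"
      then show "x < ?f (Suc n)"
        using iff[of n "Suc n"] less_plus_one_cord by (metis le_less_trans lessI)
    qed
    then have "?f (Suc n) = ?f n + 1" by (metis antisym_conv3 less_irrefl)
    then show ?case using Suc by simp
  qed
  then show ?thesis using ex by simp
qed

lemma ord_of_nat_plus: "ord_of_nat (m + n) = ord_of_nat m + ord_of_nat n"
  by (induction n) (simp_all add: plus_succ_cord)

lemma ord_of_nat_less_iff: "ord_of_nat m < ord_of_nat n \<longleftrightarrow> m < n"
proof -
  have "ord_of_nat m < ord_of_nat n" if "m < n" for m n
    using that by (induction n) (auto simp: less_plus_one_cord less_Suc_eq)
  then show ?thesis by (metis less_asym' linorder_neqE_nat)
qed

lemma ord_of_nat_le_iff: "ord_of_nat m \<le> ord_of_nat n \<longleftrightarrow> m \<le> n"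
  by (simp add: not_less[symmetric] ord_of_nat_less_iff)

lemma less_ord_Suc: "ord_of_nat n < ord_of_nat (Suc n)"
  unfolding ord_of_nat_less_iff by simp

lemma ord_of_nat_less_omega [simp]: "ord_of_nat n < \<omega>"
  using less_omega_iff by blast

lemma omega_nonzero [simp]: "\<omega> \<noteq> 0"
  using ord_of_nat_less_omega[of 0] by auto

lemma two_le_omega: "ord_of_nat 2 \<le> \<omega>"
  by (simp add: less_imp_le)

lemma two_nonzero: "ord_of_nat 2 \<noteq> 0"
  using ord_of_nat_less_iff[of 0 2] by auto

lemma oexp_two_less_omega:
  assumes "a < \<omega>"
  shows "oexp (ord_of_nat 2) a < \<omega>"
proof -
  have "\<exists>m. oexp (ord_of_nat 2) (ord_of_nat n) = ord_of_nat m" for n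
  proof (induction n)
    case 0
    show ?case by (rule exI[of _ 1]) (simp add: zero_plus_cord)
  next
    case (Suc n)
    then show ?case
      by (metis ord_of_nat.simps(2) oexp_succ_cord two_nonzero times_two_cord ord_of_nat_plus)
  qed
  then show ?thesis using assms less_omega_iff by metis
qed

lemma plus_one_less_omega: "a < \<omega> \<Longrightarrow> a + 1 < \<omega>"
  by (metis less_omega_iff ord_of_nat.simps(2))

lemma oexp_two_omega: "oexp (ord_of_nat 2) \<omega> = \<omega>"
proof (rule antisym)
  show "oexp (ord_of_nat 2) \<omega> \<le> \<omega>"
  proof (rule oexp_least(3)[OF two_nonzero])
    show "1 \<le> \<omega>" by (simp add: one_le_cord)
    fix d assume "d < \<omega>"
    then have "oexp (ord_of_nat 2) (d + 1) < \<omega>"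
      by (intro oexp_two_less_omega plus_one_less_omega)
    then show "oexp (ord_of_nat 2) d * ord_of_nat 2 \<le> \<omega>"
      by (simp add: oexp_succ_cord two_nonzero)
  qed
qed (simp add: le_oexp)

text \<open>Sums of exponents become products, and each summand omega contributes the factor
  \<open>2^omega = omega\<close>. One level of cut elimination at height \<open>omega * n\<close>
  thus reaches only \<open>omega^n\<close>.\<close>

lemma oexp_two_omega_times:
  "oexp (ord_of_nat 2) (\<omega> * ord_of_nat n) = oexp \<omega> (ord_of_nat n)"
proof (induction n)
  case (Suc n)
  have "oexp (ord_of_nat 2) (\<omega> * ord_of_nat (Suc n)) = oexp \<omega> (ord_of_nat n) * \<omega>"
    by (simp add: times_succ_cord oexp_plus two_nonzero oexp_two_omega Suc)
  then show ?case by (simp add: oexp_succ_cord)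
qed simp

lemma one_plus_omega: "1 + \<omega> = \<omega>"
proof (rule antisym)
  show "1 + \<omega> \<le> \<omega>"
  proof (rule plus_least(3))
    show "1 \<le> \<omega>" by (simp add: one_le_cord)
    fix d assume "d < \<omega>"
    then obtain n where "d = ord_of_nat n" using less_omega_iff by blast
    then have "1 + d = ord_of_nat (1 + n)"
      unfolding ord_of_nat_plus by (simp add: zero_plus_cord)
    then show "1 + d < \<omega>" using ord_of_nat_less_omega by metis
  qed
qed (rule le_plus_right_cord)

text \<open>Since \<open>1 + omega = omega\<close>, a summand omega disappears in front of
  \<open>omega * omega\<close>, hence in front of every ordinal that begins with it.\<close>

lemma omega_plus_absorb:
  assumes "\<omega> * \<omega> \<le> d"
  shows "\<omega> + d = d"
proof -
  obtain e where e: "d = \<omega> * \<omega> + e" using assms by (rule le_imp_plus_cord)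
  have "\<omega> + \<omega> * \<omega> = \<omega> * (1 + \<omega>)" by (simp add: times_plus_cord)
  then show ?thesis by (simp add: e plus_assoc_cord[symmetric] one_plus_omega)
qed

section \<open>Towers of exponentials\<close>

lemma le_tower: "ord_of_nat 2 \<le> b \<Longrightarrow> a \<le> tower b j a"
  by (induction j) (auto intro: order_trans le_oexp)

lemma tower_strict_mono: "ord_of_nat 2 \<le> b \<Longrightarrow> x < y \<Longrightarrow> tower b j x < tower b j y"
  by (induction j) (auto intro: oexp_strict_mono)

lemma tower_mono_base: "ord_of_nat 2 \<le> b \<Longrightarrow> tower (ord_of_nat 2) j x \<le> tower b j x"
proof (induction j)
  case (Suc j)
  have b: "b \<noteq> 0" using Suc.prems two_nonzero by (metis antisym zero_le_cord)
  have "oexp (ord_of_nat 2) (tower (ord_of_nat 2) j x) \<le> oexp b (tower (ord_of_nat 2) j x)"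
    by (rule oexp_mono_base[OF two_nonzero Suc.prems])
  also have "\<dots> \<le> oexp b (tower b j x)" by (rule oexp_mono_cord[OF b Suc.IH[OF Suc.prems]])
  finally show ?case by simp
qed simp

text \<open>Allows the innermost exponential to be evaluated separately from the others.\<close>

lemma tower_Suc_inner: "tower b (Suc j) x = tower b j (oexp b x)"
  by (induction j) simp_all

text \<open>By \<open>omega = 2^omega\<close> the factor becomes a summand omega in the outermost
  exponent, which exists because \<open>k \<ge> 1\<close>. That exponent absorbs the summand if it
  is at least \<open>omega^2\<close>, and this is what \<open>h \<ge> 1\<close> provides.\<close>

lemma omega_times_tower:
  assumes "k \<ge> 1" "h \<ge> 1"
  shows "\<omega> * tower (ord_of_nat 2) k (oexp \<omega> (ord_of_nat (h + 1))) =
    tower (ord_of_nat 2) k (oexp \<omega> (ord_of_nat (h + 1)))"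
proof -
  obtain j where k: "k = Suc j" using assms by (cases k) auto
  let ?d = "tower (ord_of_nat 2) j (oexp \<omega> (ord_of_nat (h + 1)))"
  have "oexp \<omega> (0 + 1) = \<omega>"
    using oexp_succ_cord[of \<omega> 0] times_assoc_cord[of 1 1 \<omega>] oexp_two_omega_times[of 1]
    by (simp add: zero_plus_cord oexp_two_omega)
  then have "\<omega> * \<omega> = oexp \<omega> (ord_of_nat 2)"
    using oexp_succ_cord[of \<omega> 1] by (simp add: ord_of_nat_2 zero_plus_cord)
  also have "\<dots> \<le> oexp \<omega> (ord_of_nat (h + 1))"
    using assms ord_of_nat_less_iff by (intro oexp_mono_cord) (simp_all add: not_less[symmetric] del: ord_of_nat.simps)
  also have "\<dots> \<le> ?d" by (rule le_tower) simp
  finally have "\<omega> + ?d = ?d" by (rule omega_plus_absorb)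
  moreover have "\<omega> * oexp (ord_of_nat 2) ?d = oexp (ord_of_nat 2) (\<omega> + ?d)"
    by (simp add: oexp_plus two_nonzero oexp_two_omega del: ord_of_nat.simps)
  ultimately show ?thesis by (simp add: k)
qed

text \<open>The reason for base 2: cut reduction adds the heights of the two premises, and both lie
  below the height of the conclusion.\<close>

lemma oexp_two_sum_le:
  assumes "a < c" "b < c"
  shows "oexp (ord_of_nat 2) a + oexp (ord_of_nat 2) b \<le> oexp (ord_of_nat 2) c"
proof -
  let ?e = "oexp (ord_of_nat 2)" and ?m = "max a b"
  have "?e a + ?e b \<le> ?e ?m + ?e ?m"
    using oexp_mono_cord[OF two_nonzero] plus_mono_left_cord plus_right_mono_cord
    by (meson max.cobounded1 max.cobounded2 order_trans)
  also have "\<dots> = ?e ?m * ord_of_nat 2" by (rule times_two_cord[symmetric])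
  also have "\<dots> \<le> ?e c" using assms by (intro oexp_least(2)[OF two_nonzero]) auto
  finally show ?thesis .
qed

lemma omega_times_Suc_le: "\<beta> < \<alpha> \<Longrightarrow> \<omega> * (\<beta> + 1) \<le> \<omega> * \<alpha>"
  by (simp add: times_succ_cord times_least(1))

section \<open>Infinitary derivations\<close>

definition clopen :: "nat set set \<Rightarrow> bool" where
  "clopen S \<longleftrightarrow> (\<exists>E. finite E \<and> (\<forall>A B. A \<inter> E = B \<inter> E \<longrightarrow> (A \<in> S \<longleftrightarrow> B \<in> S)))"

lemma clopen_compl: "clopen (- S) \<longleftrightarrow> clopen S"
  unfolding clopen_def by simp

lemma clopen_UNIV [simp]: "clopen UNIV" and clopen_empty [simp]: "clopen {}"
  unfolding clopen_def by (rule exI[of _ "{}"], simp)+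

lemma clopen_member [simp]: "clopen {A. n \<in> A}"
  unfolding clopen_def by (rule exI[of _ "{n}"]) auto

lemma clopen_Int:
  assumes "clopen S" "clopen T"
  shows "clopen (S \<inter> T)"
proof -
  obtain E F where E: "finite E" "\<And>A B. A \<inter> E = B \<inter> E \<Longrightarrow> A \<in> S \<longleftrightarrow> B \<in> S"
    and F: "finite F" "\<And>A B. A \<inter> F = B \<inter> F \<Longrightarrow> A \<in> T \<longleftrightarrow> B \<in> T"
    using assms unfolding clopen_def by metis
  show ?thesis
    unfolding clopen_def
  proof (intro exI[of _ "E \<union> F"] conjI allI impI)
    show "finite (E \<union> F)" using E F by simp
    fix A B assume "A \<inter> (E \<union> F) = B \<inter> (E \<union> F)"
    then have "A \<inter> E = B \<inter> E" "A \<inter> F = B \<inter> F" by blast+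
    then show "A \<in> S \<inter> T \<longleftrightarrow> B \<in> S \<inter> T" using E F by blast
  qed
qed

lemma clopen_INT:
  assumes "finite I" "\<And>i. i \<in> I \<Longrightarrow> clopen (S i)"
  shows "clopen (\<Inter>i\<in>I. S i)"
  using assms by (induction I) (auto intro: clopen_Int)

lemma clopen_support:
  assumes "finite \<S>" "\<forall>S\<in>\<S>. clopen S"
  obtains E where "finite E" "\<And>S A B. S \<in> \<S> \<Longrightarrow> A \<inter> E = B \<inter> E \<Longrightarrow> A \<in> S \<longleftrightarrow> B \<in> S"
proof -
  obtain e where e: "\<And>S. S \<in> \<S> \<Longrightarrow> finite (e S) \<and>
      (\<forall>A B. A \<inter> e S = B \<inter> e S \<longrightarrow> (A \<in> S \<longleftrightarrow> B \<in> S))"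
    using assms(2) unfolding clopen_def by metis
  show ?thesis
  proof (rule that[of "\<Union>(e ` \<S>)"])
    show "finite (\<Union>(e ` \<S>))" using e assms(1) by blast
    fix S A B assume S: "S \<in> \<S>" and "A \<inter> \<Union>(e ` \<S>) = B \<inter> \<Union>(e ` \<S>)"
    then have "A \<inter> e S = B \<inter> e S" by blast
    then show "A \<in> S \<longleftrightarrow> B \<in> S" using e S by blast
  qed
qed

text \<open>All connectives are indexed by \<nat>; a binary one will repeat its second component, so
  that one pair of rules covers both connectives and quantifiers.\<close>

datatype ifm = Lit "nat set set" | Dis "nat \<Rightarrow> ifm" | Con "nat \<Rightarrow> ifm"

primrec dual :: "ifm \<Rightarrow> ifm" where
  "dual (Lit S) = Lit (- S)"
| "dual (Dis f) = Con (\<lambda>i. dual (f i))"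
| "dual (Con f) = Dis (\<lambda>i. dual (f i))"

lemma dual_dual [simp]: "dual (dual F) = F"
  by (induction F) auto

text \<open>An upper bound rather than an exact depth: a clopen literal has every rank, so literal
  cuts survive elimination down to rank 0. Clopenness is demanded because boundedness has to decide
  such cuts by finitely many exclusions.\<close>

inductive rk :: "nat \<Rightarrow> ifm \<Rightarrow> bool" where
  "clopen S \<Longrightarrow> rk n (Lit S)"
| "(\<And>i. rk n (f i)) \<Longrightarrow> rk (Suc n) (Dis f)"
| "(\<And>i. rk n (f i)) \<Longrightarrow> rk (Suc n) (Con f)"

inductive_cases rk_LitE: "rk n (Lit S)"
inductive_cases rk_DisE: "rk n (Dis f)"
inductive_cases rk_ConE: "rk n (Con f)"

lemma rk_dual: "rk n F \<Longrightarrow> rk n (dual F)"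
  by (induction rule: rk.induct) (auto intro: rk.intros simp: clopen_compl)

lemma rk_mono: "rk m F \<Longrightarrow> m \<le> n \<Longrightarrow> rk n F"
proof (induction arbitrary: n rule: rk.induct)
  case (2 m f)
  then obtain n' where "n = Suc n'" "m \<le> n'" by (cases n) auto
  with 2 show ?case by (auto intro: rk.intros)
next
  case (3 m f)
  then obtain n' where "n = Suc n'" "m \<le> n'" by (cases n) auto
  with 3 show ?case by (auto intro: rk.intros)
qed (auto intro: rk.intros)

text \<open>
  Literals are clopen sets of interpretations of \<open>X\<close>, and \<open>Sem\<close> is a cut on finitely many of them at once,
  so that quantifier-free and bounded reasoning costs one step however many values of \<open>X\<close> it
  involves. The rule \<open>Ind\<close> has no principal formula and therefore commutes with cut elimination;
  the parameter \<open>I\<close> lists the sequences it may be applied to.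
\<close>

inductive der :: "(nat \<Rightarrow> ifm) set \<Rightarrow> nat \<Rightarrow> cord \<Rightarrow> ifm set \<Rightarrow> bool" for I r where
  Sem: "finite \<S> \<Longrightarrow>
    (\<And>S. S \<in> \<S> \<Longrightarrow> clopen S \<and> (\<exists>\<beta><\<alpha>. der I r \<beta> (insert (Lit S) \<Gamma>))) \<Longrightarrow>
    \<Inter>\<S> \<subseteq> \<Union>{T. Lit T \<in> \<Gamma>} \<Longrightarrow> der I r \<alpha> \<Gamma>"
| DisI: "Dis f \<in> \<Gamma> \<Longrightarrow> \<beta> < \<alpha> \<Longrightarrow> der I r \<beta> (insert (f i) \<Gamma>) \<Longrightarrow> der I r \<alpha> \<Gamma>"
| ConI: "Con f \<in> \<Gamma> \<Longrightarrow> (\<And>i. \<exists>\<beta><\<alpha>. der I r \<beta> (insert (f i) \<Gamma>)) \<Longrightarrow> der I r \<alpha> \<Gamma>"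
| Cut: "rk r F \<Longrightarrow> \<beta> < \<alpha> \<Longrightarrow> \<beta>' < \<alpha> \<Longrightarrow> der I r \<beta> (insert F \<Gamma>) \<Longrightarrow>
    der I r \<beta>' (insert (dual F) \<Gamma>) \<Longrightarrow> der I r \<alpha> \<Gamma>"
| Ind: "f \<in> I \<Longrightarrow> \<beta> < \<alpha> \<Longrightarrow> \<beta>' < \<alpha> \<Longrightarrow> der I r \<beta> (insert (f 0) \<Gamma>) \<Longrightarrow>
    (\<And>n. \<exists>\<gamma><\<alpha>. der I r \<gamma> (insert (dual (f n)) (insert (f (Suc n)) \<Gamma>))) \<Longrightarrow>
    der I r \<beta>' (insert (dual (f m)) \<Gamma>) \<Longrightarrow> der I r \<alpha> \<Gamma>"

section \<open>Monotonicity and inversion\<close>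

lemma der_mono_height: "der I r \<alpha> \<Gamma> \<Longrightarrow> \<alpha> \<le> \<alpha>' \<Longrightarrow> der I r \<alpha>' \<Gamma>"
proof (induction rule: der.cases)
  case (Sem \<S> \<alpha>1 \<Gamma>1)
  have *: "\<And>S. S \<in> \<S> \<Longrightarrow> clopen S \<and> (\<exists>\<beta><\<alpha>'. der I r \<beta> (insert (Lit S) \<Gamma>))"
    using Sem less_le_trans by metis
  show ?case by (rule der.Sem[OF _ *]) (use Sem in auto)
next
  case (DisI f \<Gamma> \<beta> \<alpha> i)
  then show ?case by - (rule der.DisI[of f _ \<beta> _ _ _ i], auto)
next
  case (ConI f \<Gamma>1 \<alpha>1)
  have *: "\<And>i. \<exists>\<beta><\<alpha>'. der I r \<beta> (insert (f i) \<Gamma>)"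
    using ConI less_le_trans by metis
  show ?case by (rule der.ConI[OF _ *]) (use ConI in auto)
next
  case (Cut F \<beta> \<alpha> \<beta>' \<Gamma>)
  then show ?case by - (rule der.Cut[of r F \<beta> _ \<beta>'], auto)
next
  case (Ind f \<beta> \<alpha>1 \<beta>' \<Gamma>1 m)
  have *: "\<And>n. \<exists>\<gamma><\<alpha>'. der I r \<gamma> (insert (dual (f n)) (insert (f (Suc n)) \<Gamma>))"
    using Ind less_le_trans by metis
  show ?case by (rule der.Ind[of f _ \<beta> _ \<beta>' _ _ m, OF _ _ _ _ *]) (use Ind in auto)
qed

lemma der_weaken: "der I r \<alpha> \<Gamma> \<Longrightarrow> \<Gamma> \<subseteq> \<Delta> \<Longrightarrow> r \<le> r' \<Longrightarrow> der I r' \<alpha> \<Delta>"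
proof (induction arbitrary: \<Delta> rule: der.induct)
  case (Sem \<S> \<alpha> \<Gamma>)
  show ?case
  proof (rule der.Sem)
    show "finite \<S>" by fact
    show "\<Inter>\<S> \<subseteq> \<Union>{T. Lit T \<in> \<Delta>}" using Sem.hyps Sem.prems by blast
    fix S assume S: "S \<in> \<S>"
    then obtain \<beta> where "\<beta> < \<alpha>"
      "\<And>\<Delta>. insert (Lit S) \<Gamma> \<subseteq> \<Delta> \<Longrightarrow> der I r' \<beta> \<Delta>"
      using Sem.IH[OF S] Sem.prems(2) by meson
    then have "\<beta> < \<alpha> \<and> der I r' \<beta> (insert (Lit S) \<Delta>)"
      using Sem.prems(1) by blast
    then show "clopen S \<and> (\<exists>\<beta><\<alpha>. der I r' \<beta> (insert (Lit S) \<Delta>))"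
      using Sem.IH[OF S] by auto
  qed
next
  case (DisI f \<Gamma> \<beta> \<alpha> i)
  have "der I r' \<beta> (insert (f i) \<Delta>)" using DisI.prems by (intro DisI.IH insert_mono)
  moreover have "Dis f \<in> \<Delta>" using DisI by auto
  ultimately show ?case using DisI.hyps by - (rule der.DisI)
next
  case (ConI f \<Gamma> \<alpha>)
  have *: "\<exists>\<beta><\<alpha>. der I r' \<beta> (insert (f i) \<Delta>)" for i
  proof -
    obtain \<beta> where "\<beta> < \<alpha>" "\<And>\<Delta>. insert (f i) \<Gamma> \<subseteq> \<Delta> \<Longrightarrow> der I r' \<beta> \<Delta>"
      using ConI.IH[of i] ConI.prems(2) by meson
    then show ?thesis using ConI.prems(1) by (meson insert_mono)
  qed
  have "Con f \<in> \<Delta>" using ConI by auto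
  then show ?case using * by (rule der.ConI)
next
  case (Cut F \<beta> \<alpha> \<beta>' \<Gamma>)
  show ?case
    by (rule der.Cut[of r' F \<beta> \<alpha> \<beta>'])
      (use Cut.hyps Cut.prems in \<open>auto intro: Cut.IH rk_mono\<close>)
next
  case (Ind f \<beta> \<alpha> \<beta>' \<Gamma> m)
  show ?case
  proof (rule der.Ind[of f I \<beta> \<alpha> \<beta>'])
    show "der I r' \<beta> (insert (f 0) \<Delta>)" "der I r' \<beta>' (insert (dual (f m)) \<Delta>)"
      using Ind.prems by (intro Ind.IH insert_mono; simp)+
    fix n
    obtain \<gamma> where "\<gamma> < \<alpha>"
      "\<And>\<Delta>. insert (dual (f n)) (insert (f (Suc n)) \<Gamma>) \<subseteq> \<Delta> \<Longrightarrow> der I r' \<gamma> \<Delta>"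
      using Ind.IH(2)[of n] Ind.prems(2) by meson
    then show "\<exists>\<gamma><\<alpha>. der I r' \<gamma> (insert (dual (f n)) (insert (f (Suc n)) \<Delta>))"
      using Ind.prems(1) by (meson insert_mono)
  qed fact+
qed

lemma der_mono: "der I r \<alpha> \<Gamma> \<Longrightarrow> \<Gamma> \<subseteq> \<Delta> \<Longrightarrow> \<alpha> \<le> \<alpha>' \<Longrightarrow> der I r \<alpha>' \<Delta>"
  by (rule der_mono_height[OF der_weaken]) auto

lemma der_axiom: "UNIV \<subseteq> \<Union>{T. Lit T \<in> \<Gamma>} \<Longrightarrow> der I r \<alpha> \<Gamma>"
  by (rule der.Sem[of "{}"]) auto

lemma der_inversion:
  "der I r \<alpha> \<Gamma> \<Longrightarrow> der I r \<alpha> (insert (f i) (\<Gamma> - {Con f}))"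
proof (induction rule: der.induct)
  case (Sem \<S> \<alpha> \<Gamma>)
  show ?case
  proof (rule der.Sem)
    show "finite \<S>" by fact
    show "\<Inter>\<S> \<subseteq> \<Union>{T. Lit T \<in> insert (f i) (\<Gamma> - {Con f})}" using Sem by blast
    fix S assume S: "S \<in> \<S>"
    then obtain \<beta> where b: "\<beta> < \<alpha>" "der I r \<beta> (insert (f i) (insert (Lit S) \<Gamma> - {Con f}))"
      using Sem.IH by blast
    have "der I r \<beta> (insert (Lit S) (insert (f i) (\<Gamma> - {Con f})))"
      by (rule der_mono[OF b(2)]) auto
    then show "clopen S \<and> (\<exists>\<beta><\<alpha>. der I r \<beta> (insert (Lit S) (insert (f i) (\<Gamma> - {Con f}))))"
      using b Sem.IH[OF S] by blast
  qed
next
  case (DisI g \<Gamma> \<beta> \<alpha> j)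
  have "der I r \<beta> (insert (g j) (insert (f i) (\<Gamma> - {Con f})))"
    by (rule der_mono[OF DisI.IH]) auto
  then show ?case using DisI.hyps by - (rule der.DisI[of g _ \<beta> \<alpha>], auto)
next
  case (ConI g \<Gamma> \<alpha>)
  have *: "\<exists>\<beta><\<alpha>. der I r \<beta> (insert (g j) (insert (f i) (\<Gamma> - {Con f})))" for j
  proof -
    obtain \<beta> where b: "\<beta> < \<alpha>" "der I r \<beta> (insert (f i) (insert (g j) \<Gamma> - {Con f}))"
      using ConI.IH by blast
    have "der I r \<beta> (insert (g j) (insert (f i) (\<Gamma> - {Con f})))"
      by (rule der_mono[OF b(2)]) auto
    then show ?thesis using b by blast
  qed
  show ?case
  proof (cases "g = f")
    case True
    \<comment> \<open>The \<open>i\<close>-th premise already is the inverted sequent; the induction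
      hypothesis has removed its remaining occurrence of \<open>Con f\<close>.\<close>
    obtain \<beta> where b: "\<beta> < \<alpha>" "der I r \<beta> (insert (f i) (insert (f i) (\<Gamma> - {Con f})))"
      using *[of i] True by blast
    show ?thesis by (rule der_mono[OF b(2)]) (use b(1) in auto)
  next
    case False
    then have "Con g \<in> insert (f i) (\<Gamma> - {Con f})" using ConI.hyps by auto
    then show ?thesis using * by (rule der.ConI)
  qed
next
  case (Cut F \<beta> \<alpha> \<beta>' \<Gamma>)
  show ?case
  proof (rule der.Cut[of r F \<beta> \<alpha> \<beta>'])
    show "der I r \<beta> (insert F (insert (f i) (\<Gamma> - {Con f})))"
      by (rule der_mono[OF Cut.IH(1)]) auto
    show "der I r \<beta>' (insert (dual F) (insert (f i) (\<Gamma> - {Con f})))"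
      by (rule der_mono[OF Cut.IH(2)]) auto
  qed fact+
next
  case (Ind g \<beta> \<alpha> \<beta>' \<Gamma> m)
  show ?case
  proof (rule der.Ind[of g I \<beta> \<alpha> \<beta>'])
    show "der I r \<beta> (insert (g 0) (insert (f i) (\<Gamma> - {Con f})))"
      by (rule der_mono[OF Ind.IH(1)]) auto
    show "der I r \<beta>' (insert (dual (g m)) (insert (f i) (\<Gamma> - {Con f})))"
      by (rule der_mono[OF Ind.IH(3)]) auto
    fix n
    obtain \<gamma> where g: "\<gamma> < \<alpha>"
      "der I r \<gamma> (insert (f i) (insert (dual (g n)) (insert (g (Suc n)) \<Gamma>) - {Con f}))"
      using Ind.IH(2) by blast
    have "der I r \<gamma> (insert (dual (g n)) (insert (g (Suc n)) (insert (f i) (\<Gamma> - {Con f}))))"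
      by (rule der_mono[OF g(2)]) auto
    then show "\<exists>\<gamma><\<alpha>. der I r \<gamma> (insert (dual (g n)) (insert (g (Suc n)) (insert (f i) (\<Gamma> - {Con f}))))"
      using g(1) by blast
  qed fact+
qed

text \<open>Each use of \<open>Dis f\<close> with index \<open>i\<close> becomes a cut of rank
  \<open>r\<close> on \<open>f i\<close> against the \<open>i\<close>-th inversion of
  \<open>D\<close>. The height of \<open>D\<close> is the left summand because addition is strictly
  monotone on the right, where the induction runs.\<close>

lemma der_reduction:
  assumes rk: "\<And>i. rk r (f i)" and D: "der I r \<beta> (insert (Con (\<lambda>i. dual (f i))) \<Delta>)"
  shows "der I r \<alpha> \<Gamma> \<Longrightarrow> der I r (\<beta> + \<alpha>) ((\<Gamma> - {Dis f}) \<union> \<Delta>)"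
proof (induction rule: der.induct)
  case (Sem \<S> \<alpha> \<Gamma>)
  show ?case
  proof (rule der.Sem)
    show "finite \<S>" by fact
    show "\<Inter>\<S> \<subseteq> \<Union>{T. Lit T \<in> \<Gamma> - {Dis f} \<union> \<Delta>}" using Sem by blast
    fix S assume S: "S \<in> \<S>"
    then obtain \<gamma> where g: "\<gamma> < \<alpha>" "der I r (\<beta> + \<gamma>) (insert (Lit S) \<Gamma> - {Dis f} \<union> \<Delta>)"
      using Sem.IH by blast
    have "der I r (\<beta> + \<gamma>) (insert (Lit S) (\<Gamma> - {Dis f} \<union> \<Delta>))"
      by (rule der_mono[OF g(2)]) auto
    then show "clopen S \<and> (\<exists>\<gamma><\<beta> + \<alpha>. der I r \<gamma> (insert (Lit S) (\<Gamma> - {Dis f} \<union> \<Delta>)))"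
      using g Sem.IH[OF S] plus_least(2) by blast
  qed
next
  case (DisI g \<Gamma> \<gamma> \<alpha> i)
  have less: "\<beta> + \<gamma> < \<beta> + \<alpha>" using DisI.hyps by (simp add: plus_least(2))
  have *: "der I r (\<beta> + \<gamma>) (insert (g i) (\<Gamma> - {Dis f} \<union> \<Delta>))"
    by (rule der_mono[OF DisI.IH]) auto
  show ?case
  proof (cases "g = f")
    case True
    show ?thesis
    proof (rule der.Cut[of r "f i"])
      show "der I r (\<beta> + \<gamma>) (insert (f i) (\<Gamma> - {Dis f} \<union> \<Delta>))" using * True by simp
      show "der I r (\<beta> + \<gamma>) (insert (dual (f i)) (\<Gamma> - {Dis f} \<union> \<Delta>))"
        by (rule der_mono[OF der_inversion[OF D, of _ i]]) (auto simp: plus_least(1))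
    qed (use less rk in auto)
  next
    case False
    then show ?thesis using DisI.hyps less by - (rule der.DisI[of g _ "\<beta> + \<gamma>" _ _ _ i], use * in auto)
  qed
next
  case (ConI g \<Gamma> \<alpha>)
  have *: "\<exists>\<gamma><\<beta> + \<alpha>. der I r \<gamma> (insert (g j) (\<Gamma> - {Dis f} \<union> \<Delta>))" for j
  proof -
    obtain \<gamma> where g: "\<gamma> < \<alpha>" "der I r (\<beta> + \<gamma>) (insert (g j) \<Gamma> - {Dis f} \<union> \<Delta>)"
      using ConI.IH by blast
    have "der I r (\<beta> + \<gamma>) (insert (g j) (\<Gamma> - {Dis f} \<union> \<Delta>))"
      by (rule der_mono[OF g(2)]) auto
    then show ?thesis using g plus_least(2) by blast
  qed
  show ?case by (rule der.ConI[OF _ *]) (use ConI.hyps in auto)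
next
  case (Cut F \<gamma> \<alpha> \<gamma>' \<Gamma>)
  show ?case
  proof (rule der.Cut[of r F "\<beta> + \<gamma>" _ "\<beta> + \<gamma>'"])
    show "der I r (\<beta> + \<gamma>) (insert F (\<Gamma> - {Dis f} \<union> \<Delta>))"
      by (rule der_mono[OF Cut.IH(1)]) auto
    show "der I r (\<beta> + \<gamma>') (insert (dual F) (\<Gamma> - {Dis f} \<union> \<Delta>))"
      by (rule der_mono[OF Cut.IH(2)]) auto
  qed (use Cut.hyps plus_least(2) in auto)
next
  case (Ind g \<gamma> \<alpha> \<gamma>' \<Gamma> m)
  show ?case
  proof (rule der.Ind[of g I "\<beta> + \<gamma>" _ "\<beta> + \<gamma>'"])
    show "der I r (\<beta> + \<gamma>) (insert (g 0) (\<Gamma> - {Dis f} \<union> \<Delta>))"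
      by (rule der_mono[OF Ind.IH(1)]) auto
    show "der I r (\<beta> + \<gamma>') (insert (dual (g m)) (\<Gamma> - {Dis f} \<union> \<Delta>))"
      by (rule der_mono[OF Ind.IH(3)]) auto
    fix n
    obtain \<delta> where d: "\<delta> < \<alpha>"
      "der I r (\<beta> + \<delta>) (insert (dual (g n)) (insert (g (Suc n)) \<Gamma>) - {Dis f} \<union> \<Delta>)"
      using Ind.IH(2) by blast
    have "der I r (\<beta> + \<delta>) (insert (dual (g n)) (insert (g (Suc n)) (\<Gamma> - {Dis f} \<union> \<Delta>)))"
      by (rule der_mono[OF d(2)]) auto
    then show "\<exists>\<delta><\<beta> + \<alpha>. der I r \<delta> (insert (dual (g n)) (insert (g (Suc n)) (\<Gamma> - {Dis f} \<union> \<Delta>)))"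
      using d(1) plus_least(2) by blast
  qed (use Ind.hyps plus_least(2) in auto)
qed

text \<open>Only cuts on \<open>Dis\<close> and \<open>Con\<close> need reduction, and the premise
  containing the \<open>Dis\<close> side is the one that \<open>der_reduction\<close> traverses. All
  other rules, \<open>Ind\<close> included, are repeated at exponentiated heights.\<close>

lemma cut_elimination_step:
  "der I (Suc r) \<alpha> \<Gamma> \<Longrightarrow> der I r (oexp (ord_of_nat 2) \<alpha>) \<Gamma>"
proof (induction rule: der.induct)
  note less = oexp_strict_mono[OF order_refl]
  case (Sem \<S> \<alpha> \<Gamma>)
  show ?case by (rule der.Sem[OF Sem.hyps(1) _ Sem.hyps(2)]) (use Sem.IH less in blast)
next
  note less = oexp_strict_mono[OF order_refl]
  case (DisI f \<Gamma> \<beta> \<alpha> i)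
  then show ?case using der.DisI less by blast
next
  note less = oexp_strict_mono[OF order_refl]
  case (ConI f \<Gamma> \<alpha>)
  show ?case by (rule der.ConI[OF ConI.hyps(1)]) (use ConI.IH less in blast)
next
  note less = oexp_strict_mono[OF order_refl]
  case (Cut F \<beta> \<alpha> \<beta>' \<Gamma>)
  show ?case
  proof (cases F)
    case (Lit S)
    then have "rk r F" using Cut.hyps rk_LitE rk.intros(1) by metis
    then show ?thesis using Cut less der.Cut by blast
  next
    case (Dis f)
    have rkf: "rk r (f i)" for i using Cut.hyps(1) Dis by (auto elim: rk_DisE)
    have "der I r (oexp (ord_of_nat 2) \<beta>' + oexp (ord_of_nat 2) \<beta>) ((insert F \<Gamma> - {Dis f}) \<union> \<Gamma>)"
      by (rule der_reduction[OF rkf _ Cut.IH(1)]) (use Cut.IH(2) Dis in simp)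
    then show ?thesis
      by (rule der_mono) (use Dis oexp_two_sum_le Cut.hyps in auto)
  next
    case (Con f)
    have rkf: "rk r (dual (f i))" for i using Cut.hyps(1) Con by (auto elim: rk_ConE intro: rk_dual)
    have "der I r (oexp (ord_of_nat 2) \<beta> + oexp (ord_of_nat 2) \<beta>')
        ((insert (dual F) \<Gamma> - {Dis (\<lambda>i. dual (f i))}) \<union> \<Gamma>)"
      by (rule der_reduction[OF rkf _ Cut.IH(2)]) (use Cut.IH(1) Con in simp)
    then show ?thesis
      by (rule der_mono) (use Con oexp_two_sum_le Cut.hyps in auto)
  qed
next
  note less = oexp_strict_mono[OF order_refl]
  case (Ind f \<beta> \<alpha> \<beta>' \<Gamma> m)
  show ?case
    by (rule der.Ind[OF Ind.hyps(1) less[OF Ind.hyps(2)] less[OF Ind.hyps(3)] Ind.IH(1) _ Ind.IH(3)])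
      (use Ind.IH(2) less in blast)
qed

lemma cut_elimination:
  "der I (r + n) \<alpha> \<Gamma> \<Longrightarrow> der I r (tower (ord_of_nat 2) n \<alpha>) \<Gamma>"
proof (induction n arbitrary: r)
  case (Suc n)
  have "der I (Suc r) (tower (ord_of_nat 2) n \<alpha>) \<Gamma>" by (rule Suc.IH) (use Suc.prems in simp)
  then show ?case by (simp add: cut_elimination_step)
qed simp

text \<open>Unfolding an induction up to \<open>m\<close> takes m + 1 cuts, and \<open>m\<close> is
  not bounded along the derivation. Spending omega on every step of the original height leaves room
  for any such chain: the premises end below \<open>\<omega> * \<alpha>\<close>, and the chain adds
  only finitely many steps to it.\<close>

lemma induction_elimination:
  assumes I: "\<And>f n. f \<in> I \<Longrightarrow> rk r (f n)"
  shows "der I r \<alpha> \<Gamma> \<Longrightarrow> \<exists>\<beta><\<omega> * (\<alpha> + 1). der {} r \<beta> \<Gamma>"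
proof -
  have step: "\<exists>\<beta><\<omega> * (\<alpha> + 1). der {} r \<beta> \<Gamma>" if "der {} r (\<omega> * \<alpha> + ord_of_nat n) \<Gamma>" for \<alpha> \<Gamma> n
    using that plus_least(2)[OF ord_of_nat_less_omega] by (auto simp: times_succ_cord)
  note lt = less_le_trans[OF _ omega_times_Suc_le]
  show "der I r \<alpha> \<Gamma> \<Longrightarrow> \<exists>\<beta><\<omega> * (\<alpha> + 1). der {} r \<beta> \<Gamma>"
  proof (induction rule: der.induct)
    case (Sem \<S> \<alpha> \<Gamma>)
    have "der {} r (\<omega> * \<alpha>) \<Gamma>"
      by (rule der.Sem[OF Sem.hyps(1) _ Sem.hyps(2)]) (use Sem.IH lt in blast)
    then show ?case using step[of \<alpha> 0] by simp
  next
    case (DisI f \<Gamma> \<beta> \<alpha> i)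
    then have "der {} r (\<omega> * \<alpha>) \<Gamma>" using lt der.DisI by blast
    then show ?case using step[of \<alpha> 0] by simp
  next
    case (ConI f \<Gamma> \<alpha>)
    have "der {} r (\<omega> * \<alpha>) \<Gamma>"
      by (rule der.ConI[OF ConI.hyps(1)]) (use ConI.IH lt in blast)
    then show ?case using step[of \<alpha> 0] by simp
  next
    case (Cut F \<beta> \<alpha> \<beta>' \<Gamma>)
    then have "der {} r (\<omega> * \<alpha>) \<Gamma>" using lt der.Cut by meson
    then show ?case using step[of \<alpha> 0] by simp
  next
    case (Ind f \<beta> \<alpha> \<beta>' \<Gamma> m)
    have suc: "\<omega> * \<alpha> + ord_of_nat n < \<omega> * \<alpha> + ord_of_nat (Suc n)" for n
      by (simp add: plus_least(2) less_plus_one_cord)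
    have le: "\<omega> * \<alpha> \<le> \<omega> * \<alpha> + ord_of_nat n" for n by (rule plus_least(1))
    have chain: "der {} r (\<omega> * \<alpha> + ord_of_nat n) (insert (f n) \<Gamma>)" for n
    proof (induction n)
      case 0
      obtain \<gamma> where "\<gamma> < \<omega> * \<alpha>" "der {} r \<gamma> (insert (f 0) \<Gamma>)"
        using Ind.IH(1) Ind.hyps lt by blast
      then show ?case by (auto elim!: der_mono)
    next
      case (Suc n)
      obtain \<gamma> where g: "\<gamma> < \<omega> * \<alpha>" "der {} r \<gamma> (insert (dual (f n)) (insert (f (Suc n)) \<Gamma>))"
        using Ind.IH(2)[of n] lt by blast
      show ?case
      proof (rule der.Cut[of r "f n"])
        show "rk r (f n)" using I Ind.hyps by blast
        show "der {} r (\<omega> * \<alpha> + ord_of_nat n) (insert (f n) (insert (f (Suc n)) \<Gamma>))"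
          by (rule der_mono[OF Suc]) auto
        show "der {} r (\<omega> * \<alpha> + ord_of_nat n) (insert (dual (f n)) (insert (f (Suc n)) \<Gamma>))"
          by (rule der_mono[OF g(2)]) (use g(1) le in \<open>auto intro: order_trans[OF less_imp_le]\<close>)
      qed (rule suc)+
    qed
    obtain \<gamma> where g: "\<gamma> < \<omega> * \<alpha>" "der {} r \<gamma> (insert (dual (f m)) \<Gamma>)"
      using Ind.IH(3) Ind.hyps lt by blast
    have "der {} r (\<omega> * \<alpha> + ord_of_nat (Suc m)) \<Gamma>"
    proof (rule der.Cut[of r "f m"])
      show "rk r (f m)" using I Ind.hyps by blast
      show "der {} r (\<omega> * \<alpha> + ord_of_nat m) (insert (f m) \<Gamma>)" by (rule chain)
      show "der {} r (\<omega> * \<alpha> + ord_of_nat m) (insert (dual (f m)) \<Gamma>)"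
        by (rule der_mono[OF g(2)]) (use g(1) le in \<open>auto intro: order_trans[OF less_imp_le]\<close>)
    qed (rule suc)+
    then show ?case by (rule step)
  qed
qed

text \<open>Each rank costs one \<open>ConI\<close> and one \<open>DisI\<close>, hence the factor 2.
  A literal and its complement cover all interpretations and need no height.\<close>

lemma der_identity:
  "rk n F \<Longrightarrow> F \<in> \<Gamma> \<Longrightarrow> dual F \<in> \<Gamma> \<Longrightarrow> der I r (ord_of_nat (2 * n)) \<Gamma>"
proof (induction arbitrary: \<Gamma> rule: rk.induct)
  case (1 S n)
  then show ?case by (intro der_axiom) auto
next
  case (2 n f)
  have lt: "ord_of_nat (2 * n) < ord_of_nat (Suc (2 * n))"
    "ord_of_nat (Suc (2 * n)) < ord_of_nat (2 * Suc n)"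
    unfolding ord_of_nat_less_iff by simp_all
  have "der I r (ord_of_nat (Suc (2 * n))) (insert (dual (f i)) \<Gamma>)" for i
  proof (rule der.DisI[OF _ lt(1)])
    show "Dis f \<in> insert (dual (f i)) \<Gamma>" using 2 by simp
    show "der I r (ord_of_nat (2 * n)) (insert (f i) (insert (dual (f i)) \<Gamma>))"
      by (rule 2(2)[of i]) simp_all
  qed
  moreover have "Con (\<lambda>i. dual (f i)) \<in> \<Gamma>" using 2 by simp
  ultimately show ?case using lt(2) der.ConI by metis
next
  case (3 n f)
  have lt: "ord_of_nat (2 * n) < ord_of_nat (Suc (2 * n))"
    "ord_of_nat (Suc (2 * n)) < ord_of_nat (2 * Suc n)"
    unfolding ord_of_nat_less_iff by simp_all
  have "der I r (ord_of_nat (Suc (2 * n))) (insert (f i) \<Gamma>)" for i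
  proof (rule der.DisI[OF _ lt(1)])
    show "Dis (\<lambda>i. dual (f i)) \<in> insert (f i) \<Gamma>" using 3 by simp
    show "der I r (ord_of_nat (2 * n)) (insert (dual (f i)) (insert (f i) \<Gamma>))"
      by (rule 3(2)[of i]) simp_all
  qed
  then show ?case using 3 lt(2) der.ConI by metis
qed

section \<open>Boundedness\<close>

text \<open>Stronger than falsity throughout \<open>P\<close>: of a conjunction one fixed conjunct
  must be refuted, and this is the branch to follow at \<open>ConI\<close>.\<close>

primrec refuted :: "nat set set \<Rightarrow> ifm \<Rightarrow> bool" where
  "refuted P (Lit S) \<longleftrightarrow> S \<inter> P = {}"
| "refuted P (Dis f) \<longleftrightarrow> (\<forall>i. refuted P (f i))"
| "refuted P (Con f) \<longleftrightarrow> (\<exists>i. refuted P (f i))"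

lemma refuted_mono: "refuted P F \<Longrightarrow> Q \<subseteq> P \<Longrightarrow> refuted Q F"
  by (induction F) auto

text \<open>A forcing condition: \<open>In\<close> holds the numbers already put into
  \<open>X\<close>, \<open>Out\<close> those already excluded.\<close>

definition cond :: "nat set \<Rightarrow> nat set \<Rightarrow> nat set set" where
  "cond In Out = {A. In \<subseteq> A \<and> A \<inter> Out = {}}"

lemma cond_mono: "In \<subseteq> In' \<Longrightarrow> Out \<subseteq> Out' \<Longrightarrow> cond In' Out' \<subseteq> cond In Out"
  unfolding cond_def by blast

text \<open>The matrix of \<open>TI_prog\<close>. Holding for all \<open>y\<close> it makes
  \<open>x\<close> a minimal element of \<open>A\<close>, so a single failing \<open>y\<close>
  refutes the minimality of \<open>x\<close>.\<close>

definition minimal_instance :: "nat rel \<Rightarrow> nat \<Rightarrow> nat \<Rightarrow> nat set set" where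
  "minimal_instance prec x y = {A. x \<in> A \<and> (y \<notin> A \<or> (y, x) \<notin> prec)}"

text \<open>The ranks \<open>\<beta> + n\<close> belong to infinitely many predecessors of
  \<open>x\<close>, and finitely many exclusions cannot catch them all. This search is the source of
  the factor omega in the bound.\<close>

lemma infinite_seg_interval:
  assumes r: "well_order_on UNIV r" and x: "\<beta> + \<omega> \<le> seg_otype r x" and "finite Out"
  shows "\<exists>y. y \<notin> Out \<and> (y, x) \<in> r - Id \<and> \<beta> \<le> seg_otype r y"
proof -
  have lt: "\<beta> + ord_of_nat n < seg_otype r x" for n
    by (rule less_le_trans[OF plus_least(2)[OF ord_of_nat_less_omega] x])
  have "\<exists>y. \<beta> + ord_of_nat n = seg_otype r y" for n
    by (rule less_otype_imp_seg[OF r less_trans[OF lt seg_otype_less_otype[OF r]]])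
  then obtain f where f: "\<And>n. seg_otype r (f n) = \<beta> + ord_of_nat n" by metis
  have "inj f"
  proof (rule linorder_injI)
    fix m n :: nat assume "m < n"
    then have "seg_otype r (f m) < seg_otype r (f n)"
      by (simp add: f plus_least(2) ord_of_nat_less_iff)
    then show "f m \<noteq> f n" by auto
  qed
  then have "infinite (range f)" by (rule range_inj_infinite)
  then have "range f - Out \<noteq> {}" using \<open>finite Out\<close> by (metis Diff_infinite_finite finite.emptyI)
  then obtain n where "f n \<notin> Out" by blast
  moreover have "(f n, x) \<in> r - Id" using lt[of n] f seg_otype_less_iff[OF r] by metis
  ultimately show ?thesis using f plus_least(1) by metis
qed

text \<open>
  A branch of the derivation is followed along which everything except the progressiveness formula
  stays refuted by a condition on \<open>X\<close> with finitely many exclusions. Undecided queries are excluded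
  from \<open>X\<close>; only witnesses against the minimality of a previous member enter \<open>X\<close>. Every step lowers the
  height, and so the required rank by at least \<open>\<omega>\<close>, which leaves room below that member outside the
  finite set of exclusions.
\<close>

lemma boundedness_aux:
  assumes r: "well_order_on UNIV r"
    and g: "\<And>x. g x = Lit (\<Inter>y. minimal_instance (r - Id) x y) \<or>
                 g x = Con (\<lambda>y. Lit (minimal_instance (r - Id) x y))"
  shows "der {} 0 \<alpha> \<Gamma> \<Longrightarrow> \<Gamma> \<subseteq> insert (Dis g) {F. refuted (cond In Out) F} \<Longrightarrow>
    finite Out \<Longrightarrow> In \<inter> Out = {} \<Longrightarrow> (\<And>y. y \<in> In \<Longrightarrow> \<omega> * \<alpha> \<le> seg_otype r y) \<Longrightarrow> False"
proof (induction arbitrary: In Out rule: der.induct)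
  case (Sem \<S> \<alpha> \<Gamma>)
  obtain E where E: "finite E" "\<And>S A B. S \<in> \<S> \<Longrightarrow> A \<inter> E = B \<inter> E \<Longrightarrow> A \<in> S \<longleftrightarrow> B \<in> S"
    using clopen_support[of \<S>] Sem.hyps(1) Sem.IH by metis
  \<comment> \<open>\<open>In\<close> itself, read as an interpretation, meets the condition and so
    falsifies every literal of the sequent. Hence some query fails at it, and excluding the rest of
    the support makes that query false on the whole condition.\<close>
  have In: "In \<in> cond In Out" using Sem.prems(3) by (simp add: cond_def)
  have "In \<notin> T" if "Lit T \<in> \<Gamma>" for T
    using subsetD[OF Sem.prems(1) that] In by auto
  then have "In \<notin> \<Inter>\<S>" using Sem.hyps(2) by blast
  then obtain S where S: "S \<in> \<S>" "In \<notin> S" by blast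
  let ?Out = "Out \<union> (E - In)"
  have sub: "cond In ?Out \<subseteq> cond In Out" by (rule cond_mono) auto
  have ref: "refuted (cond In ?Out) (Lit S)"
  proof -
    have "A \<notin> S" if "A \<in> cond In ?Out" for A
    proof -
      have "A \<inter> E = In \<inter> E" using that unfolding cond_def by blast
      then show ?thesis using E(2)[OF S(1)] S(2) by blast
    qed
    then show ?thesis by auto
  qed
  obtain \<beta> where b: "\<beta> < \<alpha>" and IH: "\<And>In Out. insert (Lit S) \<Gamma> \<subseteq> insert (Dis g) {F. refuted (cond In Out) F} \<Longrightarrow>
    finite Out \<Longrightarrow> In \<inter> Out = {} \<Longrightarrow> (\<And>y. y \<in> In \<Longrightarrow> \<omega> * \<beta> \<le> seg_otype r y) \<Longrightarrow> False"
    using Sem.IH[OF S(1)] by meson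
  show False
  proof (rule IH[of In ?Out])
    show "insert (Lit S) \<Gamma> \<subseteq> insert (Dis g) {F. refuted (cond In ?Out) F}"
      using Sem.prems(1) ref refuted_mono[OF _ sub] by auto
    show "\<omega> * \<beta> \<le> seg_otype r y" if "y \<in> In" for y
      using Sem.prems(4)[OF that] b times_mono_cord[of \<beta> \<alpha> \<omega>] by (meson less_imp_le order_trans)
  qed (use Sem.prems E in auto)
next
  case (DisI f \<Gamma> \<beta> \<alpha> i)
  have refuted_g: "refuted P (g i)" if "minimal_instance (r - Id) i y \<inter> P = {}" for P i y
    using g[of i]
  proof
    assume "g i = Lit (\<Inter>y. minimal_instance (r - Id) i y)"
    then show ?thesis using that by auto
  next
    assume "g i = Con (\<lambda>y. Lit (minimal_instance (r - Id) i y))"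
    then show ?thesis using that by (simp only: refuted.simps) blast
  qed
  have le: "\<omega> * \<beta> + \<omega> \<le> \<omega> * \<alpha>" using DisI.hyps by (simp add: times_least(1))
  then have le': "\<omega> * \<beta> \<le> \<omega> * \<alpha>" using plus_least(1) order_trans by blast
  have "\<exists>In' Out'. In \<subseteq> In' \<and> Out \<subseteq> Out' \<and> finite Out' \<and> In' \<inter> Out' = {} \<and>
      (\<forall>y\<in>In'. \<omega> * \<beta> \<le> seg_otype r y) \<and> refuted (cond In' Out') (f i)"
  proof (cases "refuted (cond In Out) (Dis f)")
    case True
    then show ?thesis using DisI.prems le' by (intro exI[of _ In] exI[of _ Out]) (auto intro: order_trans)
  next
    case False
    then have f: "f = g" using DisI.hyps DisI.prems(1) by auto
    show ?thesis
    proof (cases "i \<in> In")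
      case True
      have "\<omega> * \<beta> + \<omega> \<le> seg_otype r i" using le DisI.prems(4)[OF True] by (rule order_trans)
      \<comment> \<open>The witness against the minimality of \<open>i\<close>: it may enter
        \<open>X\<close> because it is not excluded, and its rank still suffices for the remaining
        height \<open>\<beta>\<close>.\<close>
      then obtain y where y: "y \<notin> Out" "(y, i) \<in> r - Id" "\<omega> * \<beta> \<le> seg_otype r y"
        using infinite_seg_interval[OF r _ DisI.prems(2)] by blast
      have "minimal_instance (r - Id) i y \<inter> cond (insert y In) Out = {}"
        using y unfolding minimal_instance_def cond_def by blast
      then have "refuted (cond (insert y In) Out) (g i)" by (rule refuted_g)
      then show ?thesis
        using y DisI.prems le' f by (intro exI[of _ "insert y In"] exI[of _ Out]) (auto intro: order_trans)
    next
      case False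
      \<comment> \<open>The index 0 is arbitrary: with \<open>i\<close> outside \<open>X\<close>
        every instance at \<open>i\<close> fails.\<close>
      have "minimal_instance (r - Id) i 0 \<inter> cond In (insert i Out) = {}"
        unfolding minimal_instance_def cond_def by blast
      then have "refuted (cond In (insert i Out)) (g i)" by (rule refuted_g)
      then show ?thesis
        using False DisI.prems le' f by (intro exI[of _ In] exI[of _ "insert i Out"]) (auto intro: order_trans)
    qed
  qed
  then obtain In' Out' where *: "In \<subseteq> In'" "Out \<subseteq> Out'" "finite Out'" "In' \<inter> Out' = {}"
      "\<And>y. y \<in> In' \<Longrightarrow> \<omega> * \<beta> \<le> seg_otype r y" "refuted (cond In' Out') (f i)" by blast
  show False
  proof (rule DisI.IH[of In' Out'])
    show "insert (f i) \<Gamma> \<subseteq> insert (Dis g) {F. refuted (cond In' Out') F}"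
      using DisI.prems(1) *(6) refuted_mono[OF _ cond_mono[OF *(1,2)]] by auto
  qed (use * in auto)
next
  case (ConI f \<Gamma> \<alpha>)
  have "refuted (cond In Out) (Con f)" using ConI.hyps ConI.prems(1) by auto
  then obtain i where i: "refuted (cond In Out) (f i)" by auto
  obtain \<beta> where b: "\<beta> < \<alpha>" and IH: "\<And>In Out. insert (f i) \<Gamma> \<subseteq> insert (Dis g) {F. refuted (cond In Out) F} \<Longrightarrow>
    finite Out \<Longrightarrow> In \<inter> Out = {} \<Longrightarrow> (\<And>y. y \<in> In \<Longrightarrow> \<omega> * \<beta> \<le> seg_otype r y) \<Longrightarrow> False"
    using ConI.IH[of i] by meson
  show False
  proof (rule IH[of In Out])
    show "insert (f i) \<Gamma> \<subseteq> insert (Dis g) {F. refuted (cond In Out) F}"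
      using ConI.prems(1) i by auto
    show "\<omega> * \<beta> \<le> seg_otype r y" if "y \<in> In" for y
      using ConI.prems(4)[OF that] b times_mono_cord[of \<beta> \<alpha> \<omega>] by (meson less_imp_le order_trans)
  qed (use ConI.prems in auto)
next
  case (Cut F \<beta> \<alpha> \<beta>' \<Gamma>)
  \<comment> \<open>Rank 0 leaves only clopen cut formulas. Once the support is fixed, the value at
    \<open>In\<close> selects the premise to follow.\<close>
  obtain S where S: "F = Lit S" "clopen S" using Cut.hyps(1) by (cases F) (auto elim: rk.cases)
  obtain E where E: "finite E" "\<And>A B. A \<inter> E = B \<inter> E \<Longrightarrow> A \<in> S \<longleftrightarrow> B \<in> S"
    using S unfolding clopen_def by blast
  let ?Out = "Out \<union> (E - In)"
  have sub: "cond In ?Out \<subseteq> cond In Out" by (rule cond_mono) auto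
  have eq: "A \<in> S \<longleftrightarrow> In \<in> S" if "A \<in> cond In ?Out" for A
  proof -
    have "A \<inter> E = In \<inter> E" using that unfolding cond_def by blast
    then show ?thesis by (rule E(2))
  qed
  have rank: "\<omega> * \<delta> \<le> seg_otype r y" if "y \<in> In" "\<delta> < \<alpha>" for y \<delta>
    using Cut.prems(4)[OF that(1)] that(2) times_mono_cord[of \<delta> \<alpha> \<omega>] by (meson less_imp_le order_trans)
  show False
  proof (cases "In \<in> S")
    case False
    show False
    proof (rule Cut.IH(1)[of In ?Out])
      show "insert F \<Gamma> \<subseteq> insert (Dis g) {F. refuted (cond In ?Out) F}"
        using Cut.prems(1) refuted_mono[OF _ sub] eq False S by auto
    qed (use Cut rank E in auto)
  next
    case True
    show False
    proof (rule Cut.IH(2)[of In ?Out])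
      show "insert (dual F) \<Gamma> \<subseteq> insert (Dis g) {F. refuted (cond In ?Out) F}"
        using Cut.prems(1) refuted_mono[OF _ sub] eq True S by auto
    qed (use Cut rank E in auto)
  qed
\<comment> \<open>\<open>Ind\<close> cannot occur over the empty set of sequences.\<close>
qed simp

text \<open>If the order type were larger, some \<open>m\<close> would have rank exactly
  \<open>\<omega> * \<alpha>\<close>. The branch starts with this \<open>m\<close> as the only
  number put into \<open>X\<close>, which refutes \<open>F\<close>.\<close>

lemma boundedness:
  assumes r: "well_order_on UNIV r"
    and g: "\<And>x. g x = Lit (\<Inter>y. minimal_instance (r - Id) x y) \<or>
                 g x = Con (\<lambda>y. Lit (minimal_instance (r - Id) x y))"
    and F: "\<And>m. refuted {A. m \<in> A} F"
    and D: "der {} 0 \<alpha> {F, Dis g}"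
  shows "otype r \<le> \<omega> * \<alpha>"
proof (rule ccontr)
  assume "\<not> otype r \<le> \<omega> * \<alpha>"
  then obtain m where m: "\<omega> * \<alpha> = seg_otype r m" using less_otype_imp_seg[OF r] by force
  have "refuted (cond {m} {}) F" using F[of m] by (simp add: cond_def)
  then show False using boundedness_aux[OF r g D, of "{m}" "{}"] m by auto
qed

section \<open>Interpretation of formulas\<close>

text \<open>
  The truth value of a decided formula, and of each of its subformulas, depends on finitely many values
  of \<open>X\<close>, with quantifiers reducible to finitely many instances. Bounded formulas and formulas without
  \<open>X\<close> are of this kind; interpreting decided formulas as literals keeps them out of the cut rank.
\<close>

fun decided :: "(nat \<Rightarrow> nat) \<Rightarrow> (nat \<Rightarrow> nat) \<Rightarrow> fm \<Rightarrow> bool" where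
  "decided e b (Pos a) = True"
| "decided e b (Neg a) = True"
| "decided e b (And \<phi> \<psi>) \<longleftrightarrow> decided e b \<phi> \<and> decided e b \<psi>"
| "decided e b (Or \<phi> \<psi>) \<longleftrightarrow> decided e b \<phi> \<and> decided e b \<psi>"
| "decided e b (ForallB \<phi>) \<longleftrightarrow> (\<forall>n. decided e (case_nat n b) \<phi>) \<and>
     (\<exists>N. \<forall>A. (\<forall>n<N. sat A e (case_nat n b) \<phi>) \<longrightarrow> (\<forall>n. sat A e (case_nat n b) \<phi>))"
| "decided e b (ExistsB \<phi>) \<longleftrightarrow> (\<forall>n. decided e (case_nat n b) \<phi>) \<and>
     (\<exists>N. \<forall>A. (\<exists>n. sat A e (case_nat n b) \<phi>) \<longrightarrow> (\<exists>n<N. sat A e (case_nat n b) \<phi>))"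

fun tr :: "(nat \<Rightarrow> nat) \<Rightarrow> (nat \<Rightarrow> nat) \<Rightarrow> fm \<Rightarrow> ifm" where
  "tr e b (Pos a) = Lit {A. sat A e b (Pos a)}"
| "tr e b (Neg a) = Lit {A. sat A e b (Neg a)}"
| "tr e b (And \<phi> \<psi>) = (if decided e b (And \<phi> \<psi>) then Lit {A. sat A e b (And \<phi> \<psi>)}
     else Con (\<lambda>i. if i = 0 then tr e b \<phi> else tr e b \<psi>))"
| "tr e b (Or \<phi> \<psi>) = (if decided e b (Or \<phi> \<psi>) then Lit {A. sat A e b (Or \<phi> \<psi>)}
     else Dis (\<lambda>i. if i = 0 then tr e b \<phi> else tr e b \<psi>))"
| "tr e b (ForallB \<phi>) = (if decided e b (ForallB \<phi>) then Lit {A. sat A e b (ForallB \<phi>)}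
     else Con (\<lambda>n. tr e (case_nat n b) \<phi>))"
| "tr e b (ExistsB \<phi>) = (if decided e b (ExistsB \<phi>) then Lit {A. sat A e b (ExistsB \<phi>)}
     else Dis (\<lambda>n. tr e (case_nat n b) \<phi>))"

lemma tr_decided: "decided e b \<phi> \<Longrightarrow> tr e b \<phi> = Lit {A. sat A e b \<phi>}"
  by (cases \<phi>) simp_all

lemma sat_neg [simp]: "sat A e b (neg \<phi>) \<longleftrightarrow> \<not> sat A e b \<phi>"
  by (induction \<phi> arbitrary: b) auto

lemma neg_neg [simp]: "neg (neg \<phi>) = \<phi>"
  by (induction \<phi>) auto

lemma decided_neg [simp]: "decided e b (neg \<phi>) \<longleftrightarrow> decided e b \<phi>"
  by (induction \<phi> arbitrary: b) (simp_all, (intro conj_cong refl ex_cong1; blast)+)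

lemma tr_neg: "tr e b (neg \<phi>) = dual (tr e b \<phi>)"
proof (induction \<phi> arbitrary: b)
  case (ForallB \<phi>)
  show ?case
  proof (cases "decided e b (ForallB \<phi>)")
    case True
    then have "tr e b (neg (ForallB \<phi>)) = Lit {A. sat A e b (neg (ForallB \<phi>))}"
      by (intro tr_decided) (simp only: decided_neg)
    then show ?thesis unfolding tr_decided[OF True] sat_neg by (auto simp only: dual.simps)
  next
    case False
    then have "\<not> decided e b (neg (ForallB \<phi>))" unfolding decided_neg .
    then show ?thesis using False ForallB by (simp del: decided.simps)
  qed
next
  case (ExistsB \<phi>)
  show ?case
  proof (cases "decided e b (ExistsB \<phi>)")
    case True
    then have "tr e b (neg (ExistsB \<phi>)) = Lit {A. sat A e b (neg (ExistsB \<phi>))}"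
      by (intro tr_decided) (simp only: decided_neg)
    then show ?thesis unfolding tr_decided[OF True] sat_neg by (auto simp only: dual.simps)
  next
    case False
    then have "\<not> decided e b (neg (ExistsB \<phi>))" unfolding decided_neg .
    then show ?thesis using False ExistsB by (simp del: decided.simps)
  qed
qed auto

text \<open>The bound contained in \<open>decided\<close> reduces a quantifier to finitely many
  instances, uniformly in the interpretation.\<close>

lemma clopen_decided: "decided e b \<phi> \<Longrightarrow> clopen {A. sat A e b \<phi>}"
proof (induction \<phi> arbitrary: b)
  case (Pos a)
  then show ?case by (cases a) simp_all
next
  case (Neg a)
  then show ?case
    using clopen_compl[of "{A. sat A e b (Pos a)}"] by (cases a) (simp_all add: Collect_neg_eq)
next
  case (And \<phi> \<psi>)
  then show ?case using clopen_Int[of "{A. sat A e b \<phi>}" "{A. sat A e b \<psi>}"]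
    by (simp add: Collect_conj_eq)
next
  case (Or \<phi> \<psi>)
  then have "clopen (- {A. sat A e b \<phi>} \<inter> - {A. sat A e b \<psi>})"
    by (intro clopen_Int) (simp_all add: clopen_compl)
  then have "clopen (- (- {A. sat A e b \<phi>} \<inter> - {A. sat A e b \<psi>}))" by (simp only: clopen_compl)
  then show ?case by (simp add: Collect_disj_eq)
next
  case (ForallB \<phi>)
  then obtain N where N: "\<And>A. (\<forall>n<N. sat A e (case_nat n b) \<phi>) \<Longrightarrow> \<forall>n. sat A e (case_nat n b) \<phi>"
    by auto
  have "clopen (\<Inter>n\<in>{..<N}. {A. sat A e (case_nat n b) \<phi>})"
    using ForallB by (intro clopen_INT) auto
  also have "(\<Inter>n\<in>{..<N}. {A. sat A e (case_nat n b) \<phi>}) = {A. sat A e b (ForallB \<phi>)}"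
    using N by auto
  finally show ?case .
next
  case (ExistsB \<phi>)
  then obtain N where N: "\<And>A. (\<exists>n. sat A e (case_nat n b) \<phi>) \<Longrightarrow> \<exists>n<N. sat A e (case_nat n b) \<phi>"
    by auto
  have "clopen (\<Inter>n\<in>{..<N}. - {A. sat A e (case_nat n b) \<phi>})"
    using ExistsB by (intro clopen_INT) (auto simp: clopen_compl)
  then have "clopen (- (\<Inter>n\<in>{..<N}. - {A. sat A e (case_nat n b) \<phi>}))" by (simp only: clopen_compl)
  also have "- (\<Inter>n\<in>{..<N}. - {A. sat A e (case_nat n b) \<phi>}) = {A. sat A e b (ExistsB \<phi>)}"
    using N by auto
  finally show ?case .
qed

lemma rk_decided: "decided e b \<phi> \<Longrightarrow> rk n (tr e b \<phi>)"
  by (simp add: tr_decided clopen_decided rk.intros)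


text \<open>A crude rank for the cuts and identities of first-order proofs, where only its
  finiteness matters. The prefix classes get their exact count in \<open>rk_pSigma\<close>.\<close>

lemma rk_tr_size: "rk (size \<phi>) (tr e b \<phi>)"
proof (induction \<phi> arbitrary: b)
  case (And \<phi> \<psi>)
  have "rk (size \<phi> + size \<psi>) (tr e b \<phi>)" "rk (size \<phi> + size \<psi>) (tr e b \<psi>)"
    using rk_mono[OF And(1)] rk_mono[OF And(2)] by simp_all
  then show ?case using rk_decided[of e b "And \<phi> \<psi>" "size (And \<phi> \<psi>)"]
    by (cases "decided e b (And \<phi> \<psi>)") (auto intro!: rk.intros)
next
  case (Or \<phi> \<psi>)
  have "rk (size \<phi> + size \<psi>) (tr e b \<phi>)" "rk (size \<phi> + size \<psi>) (tr e b \<psi>)"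
    using rk_mono[OF Or(1)] rk_mono[OF Or(2)] by simp_all
  then show ?case using rk_decided[of e b "Or \<phi> \<psi>" "size (Or \<phi> \<psi>)"]
    by (cases "decided e b (Or \<phi> \<psi>)") (auto intro!: rk.intros)
next
  case (ForallB \<phi>)
  then show ?case using rk_decided[of e b "ForallB \<phi>" "size (ForallB \<phi>)"]
    by (cases "decided e b (ForallB \<phi>)") (auto intro!: rk.intros simp del: decided.simps)
next
  case (ExistsB \<phi>)
  then show ?case using rk_decided[of e b "ExistsB \<phi>" "size (ExistsB \<phi>)"]
    by (cases "decided e b (ExistsB \<phi>)") (auto intro!: rk.intros simp del: decided.simps)
qed (auto intro: rk_decided simp del: tr.simps)

text \<open>A principal formula that has become a literal admits no logical rule. One
  \<open>Sem\<close> on finitely many premises takes the place of that rule, so decided formulas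
  cost one step like all others.\<close>

lemma der_decided:
  assumes "Lit S \<in> \<Gamma>" "finite J" "\<beta> < \<alpha>" "(\<Inter>j\<in>J. {A. sat A e (b j) (\<phi> j)}) \<subseteq> S"
    and "\<And>j. j \<in> J \<Longrightarrow> decided e (b j) (\<phi> j)"
    and "\<And>j. j \<in> J \<Longrightarrow> der I r \<beta> (insert (tr e (b j) (\<phi> j)) \<Gamma>)"
  shows "der I r \<alpha> \<Gamma>"
proof (rule der.Sem[of "(\<lambda>j. {A. sat A e (b j) (\<phi> j)}) ` J"])
  show "\<Inter>((\<lambda>j. {A. sat A e (b j) (\<phi> j)}) ` J) \<subseteq> \<Union>{T. Lit T \<in> \<Gamma>}"
    using assms(1,4) by blast
  fix T assume "T \<in> (\<lambda>j. {A. sat A e (b j) (\<phi> j)}) ` J"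
  then obtain j where j: "j \<in> J" "T = {A. sat A e (b j) (\<phi> j)}" by blast
  then show "clopen T \<and> (\<exists>\<beta><\<alpha>. der I r \<beta> (insert (Lit T) \<Gamma>))"
    using assms(3) assms(5,6)[OF j(1)] clopen_decided tr_decided by metis
qed (use assms in simp)

lemma der_Or:
  assumes "tr e b (Or \<phi> \<psi>) \<in> \<Gamma>" "\<chi> \<in> {\<phi>, \<psi>}" "\<beta> < \<alpha>" "der I r \<beta> (insert (tr e b \<chi>) \<Gamma>)"
  shows "der I r \<alpha> \<Gamma>"
proof (cases "decided e b (Or \<phi> \<psi>)")
  case True
  show ?thesis
    by (rule der_decided[of "{A. sat A e b (Or \<phi> \<psi>)}" \<Gamma> "{0::nat}" \<beta> \<alpha> e "\<lambda>_. b" "\<lambda>_. \<chi>"])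
      (use True assms in \<open>auto simp: tr_decided\<close>)
next
  case False
  then have "Dis (\<lambda>i. if i = 0 then tr e b \<phi> else tr e b \<psi>) \<in> \<Gamma>"
    using assms(1) by (simp del: decided.simps)
  then show ?thesis
  proof (rule der.DisI[OF _ assms(3)])
    show "der I r \<beta> (insert (if (if \<chi> = \<phi> then 0 else (1::nat)) = 0 then tr e b \<phi> else tr e b \<psi>) \<Gamma>)"
      using assms by auto
  qed
qed

lemma der_And:
  assumes "tr e b (And \<phi> \<psi>) \<in> \<Gamma>" "\<beta> < \<alpha>"
    "der I r \<beta> (insert (tr e b \<phi>) \<Gamma>)" "der I r \<beta> (insert (tr e b \<psi>) \<Gamma>)"
  shows "der I r \<alpha> \<Gamma>"
proof (cases "decided e b (And \<phi> \<psi>)")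
  case True
  show ?thesis
    by (rule der_decided[of "{A. sat A e b (And \<phi> \<psi>)}" \<Gamma> "{\<phi>, \<psi>}" \<beta> \<alpha> e "\<lambda>_. b" "\<lambda>\<chi>. \<chi>"])
      (use True assms in \<open>auto simp: tr_decided\<close>)
next
  case False
  then have "Con (\<lambda>i. if i = 0 then tr e b \<phi> else tr e b \<psi>) \<in> \<Gamma>"
    using assms(1) by (simp del: decided.simps)
  then show ?thesis
    by (rule der.ConI) (use assms in auto)
qed

lemma der_ForallB:
  assumes "tr e b (ForallB \<phi>) \<in> \<Gamma>" "\<beta> < \<alpha>"
    "\<And>n. der I r \<beta> (insert (tr e (case_nat n b) \<phi>) \<Gamma>)"
  shows "der I r \<alpha> \<Gamma>"
proof (cases "decided e b (ForallB \<phi>)")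
  case True
  then obtain N where "\<And>A. (\<forall>n<N. sat A e (case_nat n b) \<phi>) \<Longrightarrow> (\<forall>n. sat A e (case_nat n b) \<phi>)"
    by auto
  then have *: "(\<Inter>n\<in>{..<N}. {A. sat A e (case_nat n b) \<phi>}) \<subseteq> {A. sat A e b (ForallB \<phi>)}"
    by auto
  show ?thesis
    by (rule der_decided[OF _ _ assms(2) *])
      (use assms tr_decided[OF True] True in auto)
next
  case False
  then have "Con (\<lambda>n. tr e (case_nat n b) \<phi>) \<in> \<Gamma>" using assms(1) by (simp del: decided.simps)
  then show ?thesis by (rule der.ConI) (use assms in auto)
qed

lemma der_ExistsB:
  assumes "tr e b (ExistsB \<phi>) \<in> \<Gamma>" "\<beta> < \<alpha>"
    "der I r \<beta> (insert (tr e (case_nat n b) \<phi>) \<Gamma>)"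
  shows "der I r \<alpha> \<Gamma>"
proof (cases "decided e b (ExistsB \<phi>)")
  case True
  show ?thesis
    by (rule der_decided[of "{A. sat A e b (ExistsB \<phi>)}" \<Gamma> "{n}" \<beta> \<alpha> e "\<lambda>n. case_nat n b" "\<lambda>_. \<phi>"])
      (use assms tr_decided[OF True] True in auto)
next
  case False
  then have "Dis (\<lambda>n. tr e (case_nat n b) \<phi>) \<in> \<Gamma>" using assms(1) by (simp del: decided.simps)
  then show ?thesis by (rule der.DisI) (use assms in auto)
qed

lemma der_tr_Cut:
  assumes "rk r (tr e b \<phi>)" "\<beta> < \<alpha>"
    "der I r \<beta> (insert (tr e b \<phi>) \<Gamma>)" "der I r \<beta> (insert (tr e b (neg \<phi>)) \<Gamma>)"
  shows "der I r \<alpha> \<Gamma>"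
  using assms der.Cut[of r "tr e b \<phi>" \<beta> \<alpha> \<beta> I \<Gamma>] by (simp add: tr_neg)

text \<open>\<open>tr\<close> branches on \<open>decided\<close>, which in turn speaks about truth,
  so invariance of \<open>tr\<close> alone is not inductive; the three facts are carried through
  together.\<close>

definition alike where
  "alike e b \<phi> e' b' \<phi>' \<longleftrightarrow> decided e b \<phi> = decided e' b' \<phi>' \<and>
     (\<forall>A. sat A e b \<phi> = sat A e' b' \<phi>') \<and> tr e b \<phi> = tr e' b' \<phi>'"

lemma alike_And:
  "alike e b \<phi> e' b' \<phi>' \<Longrightarrow> alike e b \<psi> e' b' \<psi>' \<Longrightarrow> alike e b (And \<phi> \<psi>) e' b' (And \<phi>' \<psi>')"
  by (auto simp: alike_def)

lemma alike_Or:
  "alike e b \<phi> e' b' \<phi>' \<Longrightarrow> alike e b \<psi> e' b' \<psi>' \<Longrightarrow> alike e b (Or \<phi> \<psi>) e' b' (Or \<phi>' \<psi>')"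
  by (auto simp: alike_def)

lemma alike_ForallB:
  assumes "\<And>n. alike e (case_nat n b) \<phi> e' (case_nat n b') \<phi>'"
  shows "alike e b (ForallB \<phi>) e' b' (ForallB \<phi>')"
proof -
  have "decided e (case_nat n b) \<phi> = decided e' (case_nat n b') \<phi>'"
    "sat A e (case_nat n b) \<phi> = sat A e' (case_nat n b') \<phi>'"
    "tr e (case_nat n b) \<phi> = tr e' (case_nat n b') \<phi>'" for n A
    using assms unfolding alike_def by blast+
  then show ?thesis by (simp only: alike_def decided.simps sat.simps tr.simps simp_thms)
qed

lemma alike_ExistsB:
  assumes "\<And>n. alike e (case_nat n b) \<phi> e' (case_nat n b') \<phi>'"
  shows "alike e b (ExistsB \<phi>) e' b' (ExistsB \<phi>')"
proof -
  have "decided e (case_nat n b) \<phi> = decided e' (case_nat n b') \<phi>'"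
    "sat A e (case_nat n b) \<phi> = sat A e' (case_nat n b') \<phi>'"
    "tr e (case_nat n b) \<phi> = tr e' (case_nat n b') \<phi>'" for n A
    using assms unfolding alike_def by blast+
  then show ?thesis by (simp only: alike_def decided.simps sat.simps tr.simps simp_thms)
qed

lemmas alike_intros = alike_And alike_Or alike_ForallB alike_ExistsB

lemma alike_trans: "alike e b \<phi> e' b' \<phi>' \<Longrightarrow> alike e' b' \<phi>' e'' b'' \<phi>'' \<Longrightarrow> alike e b \<phi> e'' b'' \<phi>''"
  by (simp add: alike_def)

lemma alike_sym: "alike e b \<phi> e' b' \<phi>' \<Longrightarrow> alike e' b' \<phi>' e b \<phi>"
  by (simp add: alike_def)

section \<open>Substitution and change of assignment\<close>

lemma tval_replace: "tval e b (replace_tm x u n t) = tval (e(x := tval e b (u n))) b t"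
  by (induction t) (simp_all cong: map_cong)

lemma aval_replace: "aval A e b (replace_atm x u n a) = aval A (e(x := tval e b (u n))) b a"
  by (cases a) (simp_all add: tval_replace comp_def)

text \<open>The hypothesis says that \<open>u\<close> keeps its value when shifted under a binder.
  It covers a fixed term without indices as well as \<open>Bnd\<close>, that is, both substitution
  and the binding of a named variable.\<close>

lemma alike_replace:
  assumes u: "\<And>b n m. tval e (case_nat m b) (u (Suc n)) = tval e b (u n)"
  shows "alike e b (replace_fm x u n \<phi>) (e(x := tval e b (u n))) b \<phi>"
proof (induction \<phi> arbitrary: b n)
  case (ForallB \<phi>)
  show ?case
    using ForallB[of "case_nat m b" "Suc n" for m] by (simp add: u alike_ForallB)
next
  case (ExistsB \<phi>)
  show ?case
    using ExistsB[of "case_nat m b" "Suc n" for m] by (simp add: u alike_ExistsB)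
qed (simp_all add: alike_intros, simp_all add: alike_def aval_replace)

lemma alike_Bnd: "alike e (case_nat m b) (replace_fm x Bnd 0 \<phi>) (e(x := m)) (case_nat m b) \<phi>"
  using alike_replace[of e Bnd "case_nat m b" x 0 \<phi>] by simp

lemma tr_Bnd: "tr e (case_nat m b) (replace_fm x Bnd 0 \<phi>) = tr (e(x := m)) (case_nat m b) \<phi>"
  using alike_Bnd unfolding alike_def by blast

lemma tval_lterm: "lterm t \<Longrightarrow> tval e b t = tval e b' t"
  by (induction rule: lterm.induct) (auto cong: map_cong)

lemma aval_latom: "latom a \<Longrightarrow> aval A e b a = aval A e b' a"
  by (induction rule: latom.induct) (auto cong: map_cong simp: tval_lterm[of _ e b b'])

text \<open>Formulas of the language are locally closed. At a quantifier the de Bruijn instance is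
  traded for an update of the named variable, where the induction hypothesis applies, and then
  traded back.\<close>

lemma alike_bound: "lformula \<phi> \<Longrightarrow> alike e b \<phi> e b' \<phi>"
proof (induction arbitrary: e b b' rule: lformula.induct)
  case (1 a)
  then show ?case by (simp add: alike_def aval_latom[of a _ e b b'])
next
  case (2 a)
  then show ?case by (simp add: alike_def aval_latom[of a _ e b b'])
next
  case (3 \<phi> \<psi>)
  show ?case by (rule alike_And) (rule 3)+
next
  case (4 \<phi> \<psi>)
  show ?case by (rule alike_Or) (rule 4)+
next
  case (5 \<phi> x)
  show ?case
    unfolding Forall_def
    by (rule alike_ForallB[OF alike_trans[OF alike_Bnd alike_trans[OF 5(2) alike_sym[OF alike_Bnd]]]])
next
  case (6 \<phi> x)
  show ?case
    unfolding Exists_def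
    by (rule alike_ExistsB[OF alike_trans[OF alike_Bnd alike_trans[OF 6(2) alike_sym[OF alike_Bnd]]]])
qed

lemma tr_instance:
  assumes "lformula \<phi>"
  shows "tr e (case_nat m b) (replace_fm x Bnd 0 \<phi>) = tr (e(x := m)) b \<phi>"
  using alike_Bnd[of e m b x \<phi>] alike_bound[OF assms, of "e(x := m)" "case_nat m b" b]
  unfolding alike_def by simp

lemma tr_subst:
  assumes "\<And>b b'. tval e b t = tval e b' t"
  shows "tr e b (subst \<phi> x t) = tr (e(x := tval e b t)) b \<phi>"
  using alike_replace[of e "\<lambda>_. t" b x 0 \<phi>] assms unfolding alike_def by blast

lemma tval_cong: "(\<And>y. y \<in> tvars t \<Longrightarrow> e y = e' y) \<Longrightarrow> tval e b t = tval e' b t"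
proof (induction t)
  case (Fn f ts)
  have "map (tval e b) ts = map (tval e' b) ts"
    by (rule map_cong[OF refl Fn.IH]) (use Fn.prems in auto)
  then show ?case by (simp only: tval.simps)
qed simp_all

lemma aval_cong: "(\<And>y. y \<in> avars a \<Longrightarrow> e y = e' y) \<Longrightarrow> aval A e b a = aval A e' b a"
proof (cases a)
  case (Pr R ts)
  assume *: "\<And>y. y \<in> avars a \<Longrightarrow> e y = e' y"
  have "map (tval e b) ts = map (tval e' b) ts"
    by (rule map_cong[OF refl tval_cong]) (use * Pr in auto)
  then show ?thesis by (simp only: Pr aval.simps)
next
  case (InX t)
  assume "\<And>y. y \<in> avars a \<Longrightarrow> e y = e' y"
  then show ?thesis using tval_cong[of t e e' b] InX by simp
qed

lemma alike_fv: "(\<And>y. y \<in> fv \<phi> \<Longrightarrow> e y = e' y) \<Longrightarrow> alike e b \<phi> e' b \<phi>"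
proof (induction \<phi> arbitrary: b)
  case (Pos a)
  then show ?case using aval_cong[of a e e'] by (simp add: alike_def)
next
  case (Neg a)
  then show ?case using aval_cong[of a e e'] by (simp add: alike_def)
qed (auto intro!: alike_intros)

lemma tr_fv: "(\<And>y. y \<in> fv \<phi> \<Longrightarrow> e y = e' y) \<Longrightarrow> tr e b \<phi> = tr e' b \<phi>"
  using alike_fv unfolding alike_def by blast

lemma tvars_replace: "tvars t - {x} \<subseteq> tvars (replace_tm x u n t)"
  by (induction t) auto

lemma avars_replace: "avars a - {x} \<subseteq> avars (replace_atm x u n a)"
  using tvars_replace by (cases a) (simp_all, blast+)

lemma fv_replace: "fv \<phi> - {x} \<subseteq> fv (replace_fm x u n \<phi>)"
proof (induction \<phi> arbitrary: n)
  case (Pos a) then show ?case using avars_replace by simp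
next
  case (Neg a) then show ?case using avars_replace by simp
next
  case (And \<phi> \<psi>) then show ?case by simp blast
next
  case (Or \<phi> \<psi>) then show ?case by simp blast
qed simp_all

text \<open>Only \<open>fv \<phi> - {x}\<close> has to be avoided, so the eigenvariable may coincide
  with \<open>x\<close>.\<close>

lemma tr_eigenvariable:
  assumes "a \<notin> fv \<phi> - {x}"
  shows "tr (e(a := n)) b (subst \<phi> x (Var a)) = tr (e(x := n)) b \<phi>"
proof -
  have "tr (e(a := n)) b (subst \<phi> x (Var a)) = tr (e(a := n, x := n)) b \<phi>"
    by (subst tr_subst) simp_all
  also have "\<dots> = tr (e(x := n)) b \<phi>" by (rule tr_fv) (use assms in auto)
  finally show ?thesis .
qed

lemma tr_tzero: "tr e b (subst \<phi> x tzero) = tr (e(x := 0)) b \<phi>"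
  by (subst tr_subst) (simp_all add: tzero_def Fn_sym_def)

lemma tr_tplus1:
  assumes "a \<notin> fv \<phi> - {x}"
  shows "tr (e(a := n)) b (subst \<phi> x (tplus1 (Var a))) = tr (e(x := Suc n)) b \<phi>"
proof -
  have "tr (e(a := n)) b (subst \<phi> x (tplus1 (Var a))) = tr (e(a := n, x := Suc n)) b \<phi>"
    by (subst tr_subst) (simp_all add: tplus1_def Fn_sym_def)
  also have "\<dots> = tr (e(x := Suc n)) b \<phi>" by (rule tr_fv) (use assms in auto)
  finally show ?thesis .
qed

lemma image_tr_fresh: "a \<notin> fvs \<Gamma> \<Longrightarrow> tr (e(a := n)) b ` \<Gamma> = tr e b ` \<Gamma>"
  by (rule image_cong[OF refl tr_fv]) (auto simp: fvs_def)

section \<open>Bounded formulas, prefix classes and formulas without X\<close>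

lemma decided_Delta0: "\<phi> \<in> Delta0_X \<Longrightarrow> decided e b \<phi>"
proof (induction arbitrary: e b rule: Delta0_X.induct)
  case (5 \<phi> t x)
  let ?\<psi> = "Imp (Pos (Le (Var x) t)) \<phi>"
  have t: "tval (e(x := n)) (case_nat n b) t = tval e b t" for n
    using tval_lterm[OF 5(2)] tval_cong[of t "e(x := n)" e] 5(3) by (metis fun_upd_other)
  \<comment> \<open>Beyond the value of \<open>t\<close> the guard fails and the implication holds,
    so the successor of that value is a bound independent of \<open>A\<close>.\<close>
  have "\<forall>A. (\<forall>n<Suc (tval e b t). sat A (e(x := n)) (case_nat n b) ?\<psi>) \<longrightarrow>
      (\<forall>n. sat A (e(x := n)) (case_nat n b) ?\<psi>)"
    by (auto simp: binrel_def t)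
  then have "\<exists>N. \<forall>A. (\<forall>n<N. sat A (e(x := n)) (case_nat n b) ?\<psi>) \<longrightarrow>
      (\<forall>n. sat A (e(x := n)) (case_nat n b) ?\<psi>)" by blast
  moreover have "decided (e(x := n)) (case_nat n b) ?\<psi>" for n using 5 by simp
  ultimately show ?case
    unfolding Forall_def using alike_Bnd[of e _ b x ?\<psi>] unfolding alike_def decided.simps(5) by presburger
next
  case (6 \<phi> t x)
  let ?\<psi> = "And (Pos (Le (Var x) t)) \<phi>"
  have t: "tval (e(x := n)) (case_nat n b) t = tval e b t" for n
    using tval_lterm[OF 6(2)] tval_cong[of t "e(x := n)" e] 6(3) by (metis fun_upd_other)
  have "\<forall>A. (\<exists>n. sat A (e(x := n)) (case_nat n b) ?\<psi>) \<longrightarrow>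
      (\<exists>n<Suc (tval e b t). sat A (e(x := n)) (case_nat n b) ?\<psi>)"
    by (auto simp: binrel_def t less_Suc_eq_le)
  then have "\<exists>N. \<forall>A. (\<exists>n. sat A (e(x := n)) (case_nat n b) ?\<psi>) \<longrightarrow>
      (\<exists>n<N. sat A (e(x := n)) (case_nat n b) ?\<psi>)" by blast
  moreover have "decided (e(x := n)) (case_nat n b) ?\<psi>" for n using 6 by simp
  ultimately show ?case
    unfolding Exists_def using alike_Bnd[of e _ b x ?\<psi>] unfolding alike_def decided.simps(6) by presburger
qed simp_all

text \<open>The matrix is decided, hence a literal of rank 0, and each quantifier of the prefix adds
  one. A prefix formula that happens to be decided is itself a literal and has every rank.\<close>

lemma rk_pSigma_pPi:
  "(\<phi> \<in> pSigma_X i \<longrightarrow> rk i (tr e b \<phi>)) \<and> (\<phi> \<in> pPi_X i \<longrightarrow> rk i (tr e b \<phi>))"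
proof (induction i arbitrary: \<phi> e b)
  case 0
  then show ?case by (simp add: rk_decided decided_Delta0)
next
  case (Suc i)
  show ?case
  proof (intro conjI impI)
    assume "\<phi> \<in> pSigma_X (Suc i)"
    then obtain x \<psi> where \<psi>: "\<phi> = Exists x \<psi>" "\<psi> \<in> pPi_X i" by auto
    show "rk (Suc i) (tr e b \<phi>)"
    proof (cases "decided e b \<phi>")
      case False
      then show ?thesis using \<psi> Suc
        by (auto simp: Exists_def tr_Bnd simp del: decided.simps intro: rk.intros)
    qed (rule rk_decided)
  next
    assume "\<phi> \<in> pPi_X (Suc i)"
    then obtain x \<psi> where \<psi>: "\<phi> = Forall x \<psi>" "\<psi> \<in> pSigma_X i" by auto
    show "rk (Suc i) (tr e b \<phi>)"
    proof (cases "decided e b \<phi>")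
      case False
      then show ?thesis using \<psi> Suc
        by (auto simp: Forall_def tr_Bnd simp del: decided.simps intro: rk.intros)
    qed (rule rk_decided)
  qed
qed

lemma rk_pSigma: "\<phi> \<in> pSigma_X i \<Longrightarrow> rk i (tr e b \<phi>)"
  using rk_pSigma_pPi by blast

lemma lformula_Delta0: "\<phi> \<in> Delta0_X \<Longrightarrow> lformula \<phi>"
proof (induction rule: Delta0_X.induct)
  case (5 \<phi> t x)
  have "latom (Le (Var x) t)" unfolding binrel_def using 5 by (intro latom.intros) (auto intro: lterm.intros)
  then show ?case using 5 by (auto intro: lformula.intros)
next
  case (6 \<phi> t x)
  have "latom (Le (Var x) t)" unfolding binrel_def using 6 by (intro latom.intros) (auto intro: lterm.intros)
  then show ?case using 6 by (auto intro: lformula.intros)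
qed (auto intro: lformula.intros)

lemma lformula_pSigma_pPi:
  "(\<phi> \<in> pSigma_X i \<longrightarrow> lformula \<phi>) \<and> (\<phi> \<in> pPi_X i \<longrightarrow> lformula \<phi>)"
proof (induction i arbitrary: \<phi>)
  case 0
  then show ?case by (simp add: lformula_Delta0)
next
  case (Suc i)
  then show ?case by (auto intro: lformula.intros)
qed

text \<open>Truth does not vary with the interpretation, so a single counterexample or witness
  bounds the search for all of them; even unbounded quantifiers are decided.\<close>

lemma decided_X_free: "X_free \<phi> \<Longrightarrow> decided e b \<phi> \<and> (\<forall>A B. sat A e b \<phi> = sat B e b \<phi>)"
proof (induction \<phi> arbitrary: b)
  case (Pos a)
  then show ?case by (cases a) auto
next
  case (Neg a)
  then show ?case by (cases a) auto
next
  case (And \<phi> \<psi>)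
  then show ?case unfolding decided.simps sat.simps X_free.simps by blast
next
  case (Or \<phi> \<psi>)
  then show ?case unfolding decided.simps sat.simps X_free.simps by blast
next
  case (ForallB \<phi>)
  have d: "decided e (case_nat n b) \<phi>" and s: "sat A e (case_nat n b) \<phi> = sat {} e (case_nat n b) \<phi>" for n A
    using ForallB by auto
  have "\<exists>N. \<forall>A. (\<forall>n<N. sat A e (case_nat n b) \<phi>) \<longrightarrow> (\<forall>n. sat A e (case_nat n b) \<phi>)"
  proof (cases "\<forall>n. sat {} e (case_nat n b) \<phi>")
    case False
    then obtain n where "\<not> sat {} e (case_nat n b) \<phi>" by blast
    then show ?thesis using s by (intro exI[of _ "Suc n"]) blast
  qed (use s in blast)
  moreover have "sat A e b (ForallB \<phi>) = sat B e b (ForallB \<phi>)" for A B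
    by (simp add: s[of A] s[of B])
  ultimately show ?case using d unfolding decided.simps by blast
next
  case (ExistsB \<phi>)
  have d: "decided e (case_nat n b) \<phi>" and s: "sat A e (case_nat n b) \<phi> = sat {} e (case_nat n b) \<phi>" for n A
    using ExistsB by auto
  have "\<exists>N. \<forall>A. (\<exists>n. sat A e (case_nat n b) \<phi>) \<longrightarrow> (\<exists>n<N. sat A e (case_nat n b) \<phi>)"
  proof (cases "\<exists>n. sat {} e (case_nat n b) \<phi>")
    case True
    then obtain n where "sat {} e (case_nat n b) \<phi>" by blast
    then show ?thesis using s by (intro exI[of _ "Suc n"]) blast
  qed (use s in blast)
  moreover have "sat A e b (ExistsB \<phi>) = sat B e b (ExistsB \<phi>)" for A B
    by (simp add: s[of A] s[of B])
  ultimately show ?case using d unfolding decided.simps by blast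
qed

lemma tr_ThN: "\<phi> \<in> ThN \<Longrightarrow> tr e b \<phi> = Lit UNIV"
  unfolding ThN_def pSigma_def using decided_X_free[of \<phi> e b] by (auto simp: tr_decided)

section \<open>Embedding of derivations\<close>

lemma der_Forall:
  assumes "lformula \<phi>" "tr e b (Forall x \<phi>) \<in> \<Gamma>" "\<beta> < \<alpha>"
    "\<And>n. der I r \<beta> (insert (tr (e(x := n)) b \<phi>) \<Gamma>)"
  shows "der I r \<alpha> \<Gamma>"
  using assms der_ForallB[of e b "replace_fm x Bnd 0 \<phi>" \<Gamma> \<beta> \<alpha> I r]
  by (simp add: Forall_def tr_instance del: tr.simps)

lemma der_Exists:
  assumes "lformula \<phi>" "tr e b (Exists x \<phi>) \<in> \<Gamma>" "\<beta> < \<alpha>"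
    "der I r \<beta> (insert (tr (e(x := n)) b \<phi>) \<Gamma>)"
  shows "der I r \<alpha> \<Gamma>"
  using assms der_ExistsB[of e b "replace_fm x Bnd 0 \<phi>" \<Gamma> \<beta> \<alpha> I r n]
  by (simp add: Exists_def tr_instance del: tr.simps)

text \<open>More sequences than the instances of induction formulas: unfolding an induction uses
  only the rank of its cuts.\<close>

definition ranked :: "nat \<Rightarrow> (nat \<Rightarrow> ifm) set" where
  "ranked k = {f. \<forall>n. rk k (f n)}"

lemma ranked_tr: "\<phi> \<in> pSigma_X k \<Longrightarrow> (\<lambda>n. tr (e(x := n)) b \<phi>) \<in> ranked k"
  by (simp add: ranked_def rk_pSigma)

lemma image_tr_eigenvariable:
  assumes "a \<notin> fvs \<Gamma>" "fv \<phi> - {x} \<subseteq> fvs \<Gamma>"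
  shows "tr (e(a := n)) b ` insert (subst \<phi> x (Var a)) \<Gamma> = insert (tr (e(x := n)) b \<phi>) (tr e b ` \<Gamma>)"
proof -
  have "a \<notin> fv \<phi> - {x}" using assms by blast
  then have "tr (e(a := n)) b (subst \<phi> x (Var a)) = tr (e(x := n)) b \<phi>" by (rule tr_eigenvariable)
  then show ?thesis by (simp only: image_insert image_tr_fresh[OF assms(1)])
qed

lemma fv_Forall_subset:
  assumes "Forall x \<phi> \<in> \<Gamma>"
  shows "fv \<phi> - {x} \<subseteq> fvs \<Gamma>"
proof -
  have "fv \<phi> - {x} \<subseteq> fv (Forall x \<phi>)" using fv_replace by (simp add: Forall_def)
  then show ?thesis using assms unfolding fvs_def by blast
qed

text \<open>Every rule costs one infinitary step, so the height of the finite derivation is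
  preserved. The premises are assumed for all \<open>e\<close> because eigenvariables are read at
  each number; a rule without premises makes no demand on the heights.\<close>

lemma der_inference:
  assumes "inference k Ps \<Gamma>" and ht: "Ps \<noteq> [] \<Longrightarrow> \<beta> < \<alpha>"
    and Ps: "\<And>\<Delta> e. \<Delta> \<in> set Ps \<Longrightarrow> der (ranked k) k \<beta> (tr e b ` \<Delta>)"
  shows "der (ranked k) k \<alpha> (tr e b ` \<Gamma>)"
  using assms(1)
proof cases
  case (Initial a)
  have "Lit {A. aval A e b a} \<in> tr e b ` \<Gamma>" "Lit {A. \<not> aval A e b a} \<in> tr e b ` \<Gamma>"
    using imageI[OF Initial(2), of "tr e b"] imageI[OF Initial(3), of "tr e b"] by simp_all
  then show ?thesis by (intro der_axiom) blast
next
  case (OrR \<phi>1 \<phi>2 \<phi>)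
  have "der (ranked k) k \<beta> (insert (tr e b \<phi>) (tr e b ` \<Gamma>))" "\<beta> < \<alpha>"
    using Ps[of "insert \<phi> \<Gamma>" e] ht OrR by simp_all
  then show ?thesis using der_Or[OF imageI[OF OrR(2), of "tr e b"] OrR(3)] by blast
next
  case (ExistsR x \<phi> u)
  have "tr e b (subst \<phi> x u) = tr (e(x := tval e b u)) b \<phi>"
    by (rule tr_subst) (rule tval_lterm[OF ExistsR(4)])
  then have "der (ranked k) k \<beta> (insert (tr (e(x := tval e b u)) b \<phi>) (tr e b ` \<Gamma>))" "\<beta> < \<alpha>"
    using Ps[of "insert (subst \<phi> x u) \<Gamma>" e] ht ExistsR by simp_all
  then show ?thesis using der_Exists[OF ExistsR(3) imageI[OF ExistsR(2), of "tr e b"]] by blast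
next
  case (AndR \<phi>1 \<phi>2)
  have "der (ranked k) k \<beta> (insert (tr e b \<phi>1) (tr e b ` \<Gamma>))"
    "der (ranked k) k \<beta> (insert (tr e b \<phi>2) (tr e b ` \<Gamma>))"
    using Ps[of "insert \<phi>1 \<Gamma>" e] Ps[of "insert \<phi>2 \<Gamma>" e] AndR by simp_all
  then show ?thesis using der_And[OF imageI[OF AndR(2), of "tr e b"]] ht AndR(1) by blast
next
  case (ForallR x \<phi> a)
  have "der (ranked k) k \<beta> (insert (tr (e(x := n)) b \<phi>) (tr e b ` \<Gamma>))" for n
    using Ps[of "insert (subst \<phi> x (Var a)) \<Gamma>" "e(a := n)"] ForallR(1)
    unfolding image_tr_eigenvariable[OF ForallR(4) fv_Forall_subset[OF ForallR(2)]] by simp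
  moreover have "\<beta> < \<alpha>" using ht ForallR(1) by simp
  ultimately show ?thesis using der_Forall[OF ForallR(3) imageI[OF ForallR(2), of "tr e b"]] by blast
next
  case (TrueSentence \<phi>)
  have "der (ranked k) k \<beta> (insert (Lit {}) (tr e b ` \<Gamma>))"
    using Ps[of "insert (neg \<phi>) \<Gamma>" e] TrueSentence by (simp add: tr_neg tr_ThN)
  \<comment> \<open>The negated true sentence is the literal of the empty set, a query that holds
    under no interpretation.\<close>
  then show ?thesis using ht TrueSentence(1) by (intro der.Sem[of "{{}}"]) auto
next
  case (Induction \<phi> t x a)
  let ?f = "\<lambda>n. tr (e(x := n)) b \<phi>"
  \<comment> \<open>The variable condition on the first premise puts the parameters of
    \<open>\<phi>\<close> into \<open>\<Gamma>\<close>, which makes the eigenvariable fresh for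
    \<open>\<phi>\<close> too.\<close>
  have "fv (subst \<phi> x tzero) \<subseteq> fvs \<Gamma>" using Induction(8) unfolding fvs_def by blast
  then have fv: "fv \<phi> - {x} \<subseteq> fvs \<Gamma>" using fv_replace by blast
  have a: "a \<notin> fv \<phi> - {x}" using fv Induction(7) by blast
  have lt: "\<beta> < \<alpha>" using ht Induction(1) by simp
  have p1: "der (ranked k) k \<beta> (insert (?f 0) (tr e b ` \<Gamma>))"
    using Ps[of "insert (subst \<phi> x tzero) \<Gamma>" e] Induction(1) by (simp add: tr_tzero)
  have "tr e b (subst \<phi> x t) = ?f (tval e b t)"
    by (rule tr_subst) (rule tval_lterm[OF Induction(3)])
  then have p3: "der (ranked k) k \<beta> (insert (dual (?f (tval e b t))) (tr e b ` \<Gamma>))"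
    using Ps[of "insert (neg (subst \<phi> x t)) \<Gamma>" e] Induction(1) by (simp add: tr_neg)
  have p2: "der (ranked k) k \<beta> (insert (dual (?f n)) (insert (?f (Suc n)) (tr e b ` \<Gamma>)))" for n
    using Ps[of "insert (neg (subst \<phi> x (Var a))) (insert (subst \<phi> x (tplus1 (Var a))) \<Gamma>)" "e(a := n)"]
      Induction(1)
    by (simp add: tr_neg tr_eigenvariable[OF a] tr_tplus1[OF a] image_tr_fresh[OF Induction(7)])
  show ?thesis
    by (rule der.Ind[OF ranked_tr[OF Induction(2)] lt lt p1 _ p3]) (use p2 lt in blast)
next
  case (Cut \<phi>)
  have "der (ranked k) k \<beta> (insert (tr e b \<phi>) (tr e b ` \<Gamma>))"
    "der (ranked k) k \<beta> (insert (tr e b (neg \<phi>)) (tr e b ` \<Gamma>))"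
    using Ps[of "insert \<phi> \<Gamma>" e] Ps[of "insert (neg \<phi>) \<Gamma>" e] Cut by simp_all
  then show ?thesis using der_tr_Cut[OF rk_pSigma[OF Cut(2)]] ht Cut(1) by blast
qed

lemma der_derivation:
  assumes D: "ISigma_X_derivation k S \<tau> l"
  shows "der (ranked k) k (ord_of_nat (height \<tau>)) (tr e b ` S)"
proof -
  note D = D[unfolded ISigma_X_derivation_def rooted_tree_def]
  have le: "length v \<le> height \<tau>" if "v \<in> \<tau>" for v
    unfolding height_def using D that by (intro Max_ge) auto
  have "v \<in> \<tau> \<Longrightarrow> der (ranked k) k (ord_of_nat (height \<tau> - length v)) (tr e b ` l v)" for v e
  proof (induction "height \<tau> - length v" arbitrary: v e rule: less_induct)
    case less
    let ?m = "height \<tau> - length v"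
    obtain ks where ks: "set ks = {i. v @ [i] \<in> \<tau>}" "inference k (map (\<lambda>i. l (v @ [i])) ks) (l v)"
      using D less.prems by blast
    have child: "?m = Suc (height \<tau> - length (v @ [i]))" if "i \<in> set ks" for i
      using le[of "v @ [i]"] that ks(1) by auto
    show ?case
    proof (rule der_inference[OF ks(2), of "ord_of_nat (?m - 1)"])
      \<comment> \<open>At maximal depth \<open>?m - 1\<close> is truncated to 0; the strict
        inequality is demanded only of nodes with children.\<close>
      show "ord_of_nat (?m - 1) < ord_of_nat ?m" if "map (\<lambda>i. l (v @ [i])) ks \<noteq> []"
        using child[of "hd ks"] that by (simp add: ord_of_nat_less_iff del: ord_of_nat.simps)
      fix \<Delta> e assume "\<Delta> \<in> set (map (\<lambda>i. l (v @ [i])) ks)"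
      then obtain i where i: "i \<in> set ks" "\<Delta> = l (v @ [i])" by auto
      then show "der (ranked k) k (ord_of_nat (?m - 1)) (tr e b ` \<Delta>)"
        using less.hyps[of "v @ [i]" e] child[OF i(1)] ks(1) by simp
    qed
  qed
  from this[of "[]" e] show ?thesis using D by auto
qed

text \<open>The sequent contains no literals, so its last rule has premises. This supplies
  \<open>h \<ge> 1\<close> for the absorption of omega.\<close>

lemma derivation_height_pos:
  assumes "ISigma_X_derivation k (TI prec) \<tau> l"
  shows "height \<tau> \<noteq> 0"
proof
  note D = assms[unfolded ISigma_X_derivation_def rooted_tree_def]
  assume "height \<tau> = 0"
  moreover have "length v \<le> height \<tau>" if "v \<in> \<tau>" for v
    unfolding height_def using D that by (intro Max_ge) auto
  ultimately have "\<tau> \<subseteq> {[]}" by auto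
  have root: "[] \<in> \<tau>" and "l [] = TI prec" using D by auto
  then obtain ks where ks: "set ks = {i. [] @ [i] \<in> \<tau>}" "inference k (map (\<lambda>i. l ([] @ [i])) ks) (TI prec)"
    using D by metis
  have "{i. [] @ [i] \<in> \<tau>} = {}" using \<open>\<tau> \<subseteq> {[]}\<close> by auto
  then have "ks = []" using ks(1) by simp
  then have "inference k [] (TI prec)" using ks(2) by simp
  then obtain a where "Pos a \<in> TI prec" by cases
  then show False by (simp add: TI_def TI_all_def TI_prog_def Forall_def Exists_def)
qed

text \<open>One \<open>Ind\<close> derives the axiom without cuts. The height consists of
  \<open>2 * k\<close> for identities, two for a conjunction under an existential quantifier, one
  each for \<open>Ind\<close> and the universal quantifier, and four because both sides of each of
  the two nested disjunctions are used.\<close>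

lemma der_induction_axiom:
  assumes \<phi>: "\<phi> \<in> pSigma_X k" and ax: "tr e b (induction_axiom x \<phi>) \<in> \<Gamma>"
  shows "der (ranked k) r (ord_of_nat (2 * k + 8)) \<Gamma>"
proof -
  let ?\<phi>0 = "subst \<phi> x tzero" and ?\<phi>S = "subst \<phi> x (tplus1 (Var x))"
  let ?R = "replace_fm x Bnd 0 (Imp \<phi> ?\<phi>S)"
  let ?X = "Or (neg ?\<phi>0) (ExistsB (neg ?R))"
  let ?f = "\<lambda>n. tr (e(x := n)) b \<phi>"
  have lf: "lformula \<phi>" using \<phi> lformula_pSigma_pPi by blast
  have ax': "tr e b (Or ?X (Forall x \<phi>)) \<in> \<Gamma>"
    using ax by (simp only: induction_axiom_def neg.simps Forall_def)
  have id: "der (ranked k) r (ord_of_nat (2 * k)) \<Delta>" if "?f n \<in> \<Delta>" "dual (?f n) \<in> \<Delta>" for n \<Delta>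
    using der_identity[OF rk_pSigma[OF \<phi>] that] .
  have bound: "tr (e(x := n)) (case_nat n b) \<phi> = ?f n" for n
    using alike_bound[OF lf] unfolding alike_def by blast
  have S: "tr (e(x := n)) (case_nat n b) ?\<phi>S = ?f (Suc n)" for n
  proof -
    have "tr (e(x := n)) (case_nat n b) ?\<phi>S = tr (e(x := n, x := Suc n)) (case_nat n b) \<phi>"
      by (subst tr_subst) (simp_all add: tplus1_def Fn_sym_def)
    also have "\<dots> = ?f (Suc n)" using alike_bound[OF lf] unfolding alike_def fun_upd_upd by blast
    finally show ?thesis .
  qed
  have R: "tr e (case_nat n b) (neg ?R) = tr (e(x := n)) (case_nat n b) (And \<phi> (neg ?\<phi>S))" for n
  proof -
    have "tr e (case_nat n b) (neg ?R) = dual (tr (e(x := n)) (case_nat n b) (Imp \<phi> ?\<phi>S))"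
      by (simp only: tr_neg tr_Bnd)
    also have "\<dots> = tr (e(x := n)) (case_nat n b) (neg (Imp \<phi> ?\<phi>S))" by (simp only: tr_neg)
    finally show ?thesis by (simp only: neg.simps neg_neg)
  qed
  have step: "der (ranked k) r (ord_of_nat (2 * k + 2)) \<Delta>"
    if "tr e b (ExistsB (neg ?R)) \<in> \<Delta>" "dual (?f n) \<in> \<Delta>" "?f (Suc n) \<in> \<Delta>" for \<Delta> n
  proof (rule der_ExistsB[OF that(1), of "ord_of_nat (2 * k + 1)" _ _ _ n])
    show "ord_of_nat (2 * k + 1) < ord_of_nat (2 * k + 2)" unfolding ord_of_nat_less_iff by simp
    show "der (ranked k) r (ord_of_nat (2 * k + 1)) (insert (tr e (case_nat n b) (neg ?R)) \<Delta>)"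
    proof (rule der_And[of "e(x := n)" "case_nat n b" \<phi> "neg ?\<phi>S" _ "ord_of_nat (2 * k)"])
      show "ord_of_nat (2 * k) < ord_of_nat (2 * k + 1)" unfolding ord_of_nat_less_iff by simp
      show "tr (e(x := n)) (case_nat n b) (And \<phi> (neg ?\<phi>S)) \<in> insert (tr e (case_nat n b) (neg ?R)) \<Delta>"
        by (simp only: R insertI1)
      show "der (ranked k) r (ord_of_nat (2 * k)) (insert (tr (e(x := n)) (case_nat n b) \<phi>)
          (insert (tr e (case_nat n b) (neg ?R)) \<Delta>))"
        by (rule id[of n]) (use that bound in simp_all)
      show "der (ranked k) r (ord_of_nat (2 * k)) (insert (tr (e(x := n)) (case_nat n b) (neg ?\<phi>S))
          (insert (tr e (case_nat n b) (neg ?R)) \<Delta>))"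
        by (rule id[of "Suc n"]) (use that S in \<open>simp_all add: tr_neg\<close>)
    qed
  qed
  have main: "der (ranked k) r (ord_of_nat (2 * k + 3)) \<Delta>"
    if "tr e b (ExistsB (neg ?R)) \<in> \<Delta>" "tr e b (neg ?\<phi>0) \<in> \<Delta>" "?f m \<in> \<Delta>" for \<Delta> m
  proof (rule der.Ind[OF ranked_tr[OF \<phi>, of e x b]])
    show "ord_of_nat (2 * k) < ord_of_nat (2 * k + 3)" "ord_of_nat (2 * k) < ord_of_nat (2 * k + 3)"
      unfolding ord_of_nat_less_iff by simp_all
    show "der (ranked k) r (ord_of_nat (2 * k)) (insert (?f 0) \<Delta>)"
      by (rule id[of 0]) (use that in \<open>simp_all add: tr_neg tr_tzero\<close>)
    show "der (ranked k) r (ord_of_nat (2 * k)) (insert (dual (?f m)) \<Delta>)"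
      by (rule id[of m]) (use that in simp_all)
    show "\<exists>\<gamma><ord_of_nat (2 * k + 3). der (ranked k) r \<gamma> (insert (dual (?f n)) (insert (?f (Suc n)) \<Delta>))" for n
    proof (intro exI conjI)
      show "ord_of_nat (2 * k + 2) < ord_of_nat (2 * k + 3)" unfolding ord_of_nat_less_iff by simp
      show "der (ranked k) r (ord_of_nat (2 * k + 2)) (insert (dual (?f n)) (insert (?f (Suc n)) \<Delta>))"
        by (rule step[of _ n]) (use that in simp_all)
    qed
  qed
  have lt: "ord_of_nat (2 * k + i) < ord_of_nat (2 * k + j)" if "i < j" for i j
    unfolding ord_of_nat_less_iff using that by simp
  show ?thesis
  proof (rule der_Or[OF ax' _ lt[of 7 8]])
    let ?\<Gamma>1 = "insert (tr e b ?X) \<Gamma>"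
    let ?\<Gamma>2 = "insert (tr e b (neg ?\<phi>0)) ?\<Gamma>1"
    let ?\<Gamma>3 = "insert (tr e b (ExistsB (neg ?R))) ?\<Gamma>2"
    let ?\<Gamma>4 = "insert (tr e b (Forall x \<phi>)) ?\<Gamma>3"
    have "der (ranked k) r (ord_of_nat (2 * k + 4)) ?\<Gamma>4"
    proof (rule der_Forall[OF lf, of e b x _ "ord_of_nat (2 * k + 3)"])
      show "der (ranked k) r (ord_of_nat (2 * k + 3)) (insert (?f n) ?\<Gamma>4)" for n
        by (rule main[of _ n]) (simp_all del: tr.simps)
    qed (use lt in \<open>simp_all del: tr.simps\<close>)
    then have "der (ranked k) r (ord_of_nat (2 * k + 5)) ?\<Gamma>3"
      by (rule der_Or[of e b ?X "Forall x \<phi>" _ "Forall x \<phi>", rotated 3])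
        (use ax' lt in \<open>simp_all del: tr.simps\<close>)
    then have "der (ranked k) r (ord_of_nat (2 * k + 6)) ?\<Gamma>2"
      by (rule der_Or[of e b "neg ?\<phi>0" "ExistsB (neg ?R)" _ "ExistsB (neg ?R)", rotated 3])
        (use lt in \<open>simp_all del: tr.simps\<close>)
    then show "der (ranked k) r (ord_of_nat (2 * k + 7)) ?\<Gamma>1"
      by (rule der_Or[of e b "neg ?\<phi>0" "ExistsB (neg ?R)" _ "neg ?\<phi>0", rotated 3])
        (use lt in \<open>simp_all del: tr.simps\<close>)
  qed simp_all
qed

lemma der_ISigma_axiom:
  assumes "\<phi> \<in> ISigma_X k" "\<phi> \<in> \<Gamma>"
  shows "der (ranked k) r (ord_of_nat (2 * k + 8)) (tr e b ` \<Gamma>)"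
  using assms(1) unfolding ISigma_X_def
proof
  assume "\<phi> \<in> ThN"
  then have "Lit UNIV \<in> tr e b ` \<Gamma>" using assms(2) tr_ThN by (metis imageI)
  then show ?thesis by (intro der_axiom) blast
next
  assume "\<phi> \<in> {induction_axiom x \<phi> |x \<phi>. \<phi> \<in> pSigma_X k}"
  then show ?thesis using der_induction_axiom assms(2) by blast
qed

section \<open>First-order proofs with arbitrary cuts\<close>

lemma der_max:
  assumes "der I r (ord_of_nat m) \<Gamma>"
  shows "der I (max r r') (ord_of_nat (max m m')) \<Gamma>" "der I (max r' r) (ord_of_nat (max m' m)) \<Gamma>"
proof -
  have "der I (max r r') (ord_of_nat m) \<Gamma>" by (rule der_weaken[OF assms]) auto
  then show *: "der I (max r r') (ord_of_nat (max m m')) \<Gamma>"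
    by (rule der_mono_height) (simp add: ord_of_nat_le_iff)
  then show "der I (max r' r) (ord_of_nat (max m' m)) \<Gamma>" by (simp add: max.commute)
qed

text \<open>Rank and height are fixed before \<open>e\<close>, since the universal rule needs one
  bound for all values of the eigenvariable.\<close>

lemma der_proves:
  "proves (ISigma_X k) \<Gamma> \<Longrightarrow> \<exists>r n. \<forall>e. der (ranked k) r (ord_of_nat n) (tr e b ` \<Gamma>)"
proof (induction rule: proves.induct)
  case (Axiom \<Gamma> \<phi>)
  then show ?case using der_ISigma_axiom by blast
next
  case (Initial \<Gamma> a)
  have "der (ranked k) 0 (ord_of_nat 0) (tr e b ` \<Gamma>)" for e
  proof (rule der_axiom)
    have "Lit {A. aval A e b a} \<in> tr e b ` \<Gamma>" "Lit {A. \<not> aval A e b a} \<in> tr e b ` \<Gamma>"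
      using imageI[OF Initial(2), of "tr e b"] imageI[OF Initial(3), of "tr e b"] by simp_all
    then show "UNIV \<subseteq> \<Union>{T. Lit T \<in> tr e b ` \<Gamma>}" by blast
  qed
  then show ?case by blast
next
  case (Refl \<Gamma> t)
  have "der (ranked k) 0 (ord_of_nat 0) (tr e b ` \<Gamma>)" for e
  proof (rule der_axiom)
    have "Lit UNIV \<in> tr e b ` \<Gamma>"
      using imageI[OF Refl(2), of "tr e b"] by (simp add: binrel_def)
    then show "UNIV \<subseteq> \<Union>{T. Lit T \<in> tr e b ` \<Gamma>}" by blast
  qed
  then show ?case by blast
next
  case (Replace \<Gamma> a s t x)
  have "der (ranked k) 0 (ord_of_nat 0) (tr e b ` \<Gamma>)" for e
  proof (rule der_axiom)
    let ?s = "tval e b s" and ?t = "tval e b t"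
    have "tr e b (Neg (Eq s t)) \<in> tr e b ` \<Gamma>" "tr e b (subst (Neg a) x s) \<in> tr e b ` \<Gamma>"
      "tr e b (subst (Pos a) x t) \<in> tr e b ` \<Gamma>"
      using Replace(5) by blast+
    then have lits: "Lit {A. ?t \<noteq> ?s} \<in> tr e b ` \<Gamma>"
      "Lit {A. \<not> aval A (e(x := ?s)) b a} \<in> tr e b ` \<Gamma>"
      "Lit {A. aval A (e(x := ?t)) b a} \<in> tr e b ` \<Gamma>"
      by (simp_all add: binrel_def aval_replace)
    show "UNIV \<subseteq> \<Union>{T. Lit T \<in> tr e b ` \<Gamma>}"
    proof
      fix A
      \<comment> \<open>If the two values differ, the first set is everything; if they agree, the
        other two are complementary.\<close>
      have "A \<in> {A. ?t \<noteq> ?s} \<union> {A. \<not> aval A (e(x := ?s)) b a} \<union> {A. aval A (e(x := ?t)) b a}"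
        by (cases "?s = ?t") auto
      then show "A \<in> \<Union>{T. Lit T \<in> tr e b ` \<Gamma>}" using lits by blast
    qed
  qed
  then show ?case by blast
next
  case (OrI \<phi> \<psi> \<Gamma>)
  then obtain r n where IH: "\<And>e. der (ranked k) r (ord_of_nat n) (tr e b ` insert \<phi> (insert \<psi> \<Gamma>))"
    by blast
  have "der (ranked k) r (ord_of_nat (Suc (Suc n))) (tr e b ` \<Gamma>)" for e
  proof (rule der_Or[OF imageI[OF OrI(1), of "tr e b"] _ less_ord_Suc])
    show "der (ranked k) r (ord_of_nat (Suc n)) (insert (tr e b \<psi>) (tr e b ` \<Gamma>))"
      by (rule der_Or[of e b \<phi> \<psi> _ \<phi>, OF _ _ less_ord_Suc])
        (use IH[of e] imageI[OF OrI(1), of "tr e b"] in \<open>simp_all del: tr.simps ord_of_nat.simps\<close>)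
  qed simp
  then show ?case by blast
next
  case (AndI \<phi> \<psi> \<Gamma>)
  then obtain r n r' n' where IH: "\<And>e. der (ranked k) r (ord_of_nat n) (tr e b ` insert \<phi> \<Gamma>)"
      "\<And>e. der (ranked k) r' (ord_of_nat n') (tr e b ` insert \<psi> \<Gamma>)"
    by blast
  have "der (ranked k) (max r r') (ord_of_nat (Suc (max n n'))) (tr e b ` \<Gamma>)" for e
    by (rule der_And[OF imageI[OF AndI(1), of "tr e b"] less_ord_Suc])
      (use der_max[OF IH(1)] der_max[OF IH(2)] in simp_all)
  then show ?case by blast
next
  case (ExistsI x \<phi> \<Gamma> t)
  then obtain r n where IH: "\<And>e. der (ranked k) r (ord_of_nat n) (tr e b ` insert (subst \<phi> x t) \<Gamma>)"
    by blast
  have "der (ranked k) r (ord_of_nat (Suc n)) (tr e b ` \<Gamma>)" for e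
  proof (rule der_Exists[OF ExistsI(2) imageI[OF ExistsI(1), of "tr e b"] less_ord_Suc])
    have "tr e b (subst \<phi> x t) = tr (e(x := tval e b t)) b \<phi>"
      by (rule tr_subst) (rule tval_lterm[OF ExistsI(3)])
    then show "der (ranked k) r (ord_of_nat n) (insert (tr (e(x := tval e b t)) b \<phi>) (tr e b ` \<Gamma>))"
      using IH[of e] by simp
  qed
  then show ?case by blast
next
  case (ForallI x \<phi> \<Gamma> a)
  then obtain r n where IH: "\<And>e. der (ranked k) r (ord_of_nat n) (tr e b ` insert (subst \<phi> x (Var a)) \<Gamma>)"
    by blast
  have "der (ranked k) r (ord_of_nat (Suc n)) (tr e b ` \<Gamma>)" for e
    by (rule der_Forall[OF ForallI(2) imageI[OF ForallI(1), of "tr e b"] less_ord_Suc])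
      (use IH in \<open>simp only: image_tr_eigenvariable[OF ForallI(3) fv_Forall_subset[OF ForallI(1)], symmetric]\<close>)
  then show ?case by blast
next
  case (Cut \<phi> \<Gamma>)
  then obtain r n r' n' where IH: "\<And>e. der (ranked k) r (ord_of_nat n) (tr e b ` insert \<phi> \<Gamma>)"
      "\<And>e. der (ranked k) r' (ord_of_nat n') (tr e b ` insert (neg \<phi>) \<Gamma>)"
    by blast
  let ?r = "max (size \<phi>) (max r r')"
  have "der (ranked k) ?r (ord_of_nat (Suc (max n n'))) (tr e b ` \<Gamma>)" for e
  proof (rule der_tr_Cut[OF _ less_ord_Suc])
    show "rk ?r (tr e b \<phi>)" by (rule rk_mono[OF rk_tr_size]) simp
    show "der (ranked k) ?r (ord_of_nat (max n n')) (insert (tr e b \<phi>) (tr e b ` \<Gamma>))"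
      by (rule der_weaken[OF der_max(1)[OF IH(1), of r' n']]) auto
    show "der (ranked k) ?r (ord_of_nat (max n n')) (insert (tr e b (neg \<phi>)) (tr e b ` \<Gamma>))"
      by (rule der_weaken[OF der_max(2)[OF IH(2), of r n]]) auto
  qed
  then show ?case by blast
qed

text \<open>The disjunction is split by a cut against its dual, which follows from identities. The
  surplus ranks are then removed while \<open>Ind\<close> is still present, so the height remains
  finite.\<close>

lemma der_provable_Or:
  assumes "provable (ISigma_X k) (Or \<phi> \<psi>)"
  obtains n where "der (ranked k) k (ord_of_nat n) (tr e b ` {\<phi>, \<psi>})"
proof -
  obtain r n where "\<And>e. der (ranked k) r (ord_of_nat n) (tr e b ` {Or \<phi> \<psi>})"
    using assms der_proves unfolding provable_def by blast
  then have D: "der (ranked k) r (ord_of_nat n) {tr e b (Or \<phi> \<psi>)}" by (simp del: tr.simps)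
  \<comment> \<open>Written as \<open>k\<close> plus a surplus, so that eliminating the surplus
    leaves rank \<open>k\<close>.\<close>
  define s where "s = k + max r (size (Or \<phi> \<psi>))"
  define N where "N = max n (2 * size (Or \<phi> \<psi>) + 1)"
  have id: "der (ranked k) s (ord_of_nat (2 * size (Or \<phi> \<psi>))) \<Delta>"
    if "tr e b \<chi> \<in> \<Delta>" "dual (tr e b \<chi>) \<in> \<Delta>" "\<chi> \<in> {\<phi>, \<psi>}" for \<chi> \<Delta>
    by (rule der_identity[OF rk_mono[OF rk_tr_size] that(1,2)]) (use that(3) in auto)
  have "der (ranked k) s (ord_of_nat (Suc N)) (tr e b ` {\<phi>, \<psi>})"
  proof (rule der_tr_Cut[OF _ less_ord_Suc])
    show "rk s (tr e b (Or \<phi> \<psi>))" by (rule rk_mono[OF rk_tr_size]) (simp add: s_def)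
    have "der (ranked k) s (ord_of_nat n) (insert (tr e b (Or \<phi> \<psi>)) (tr e b ` {\<phi>, \<psi>}))"
      by (rule der_weaken[OF D]) (auto simp: s_def simp del: tr.simps)
    then show "der (ranked k) s (ord_of_nat N) (insert (tr e b (Or \<phi> \<psi>)) (tr e b ` {\<phi>, \<psi>}))"
      by (rule der_mono_height) (simp add: N_def ord_of_nat_le_iff)
    show "der (ranked k) s (ord_of_nat N) (insert (tr e b (neg (Or \<phi> \<psi>))) (tr e b ` {\<phi>, \<psi>}))"
    proof (rule der_And[of e b "neg \<phi>" "neg \<psi>" _ "ord_of_nat (2 * size (Or \<phi> \<psi>))"])
      show "ord_of_nat (2 * size (Or \<phi> \<psi>)) < ord_of_nat N" unfolding ord_of_nat_less_iff N_def by simp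
      show "der (ranked k) s (ord_of_nat (2 * size (Or \<phi> \<psi>)))
          (insert (tr e b (neg \<phi>)) (insert (tr e b (neg (Or \<phi> \<psi>))) (tr e b ` {\<phi>, \<psi>})))"
        by (rule id[of \<phi>]) (simp_all add: tr_neg del: tr.simps)
      show "der (ranked k) s (ord_of_nat (2 * size (Or \<phi> \<psi>)))
          (insert (tr e b (neg \<psi>)) (insert (tr e b (neg (Or \<phi> \<psi>))) (tr e b ` {\<phi>, \<psi>})))"
        by (rule id[of \<psi>]) (simp_all add: tr_neg del: tr.simps)
    qed (simp del: tr.simps)
  qed
  then have "der (ranked k) (k + max r (size (Or \<phi> \<psi>))) (ord_of_nat (Suc N)) (tr e b ` {\<phi>, \<psi>})"
    by (simp only: s_def)
  then have *: "der (ranked k) k (tower (ord_of_nat 2) (max r (size (Or \<phi> \<psi>))) (ord_of_nat (Suc N)))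
      (tr e b ` {\<phi>, \<psi>})" by (rule cut_elimination)
  have "tower (ord_of_nat 2) j (ord_of_nat m) < \<omega>" for j m
    by (induction j) (simp_all add: oexp_two_less_omega del: ord_of_nat.simps)
  then obtain n' where "tower (ord_of_nat 2) (max r (size (Or \<phi> \<psi>))) (ord_of_nat (Suc N)) = ord_of_nat n'"
    using less_omega_iff by blast
  then show ?thesis using * that by metis
qed

section \<open>Unprovability of transfinite induction\<close>

text \<open>Being undecided, the formula stays a \<open>Dis\<close> and never counts as a literal in
  \<open>Sem\<close>, as boundedness requires. The inner quantifier may be decided, for instance
  when \<open>x\<close> has finitely many predecessors, hence the two shapes of
  \<open>g\<close>.\<close>

lemma tr_TI_prog:
  assumes irrefl: "\<And>x. (x, x) \<notin> prec"
  obtains g where "tr e b (TI_prog prec) = Dis g"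
    "\<And>x. g x = Lit (\<Inter>y. minimal_instance prec x y) \<or> g x = Con (\<lambda>y. Lit (minimal_instance prec x y))"
proof -
  let ?M = "And (Pos (InX (Bnd 1))) (Or (Neg (InX (Bnd 0))) (Neg (binrel prec (Bnd 0) (Bnd 1))))"
  have eq: "TI_prog prec = ExistsB (ForallB ?M)"
    by (simp add: TI_prog_def Forall_def Exists_def binrel_def)
  have M: "tr e (case_nat y (case_nat x b)) ?M = Lit (minimal_instance prec x y)"
    "sat A e (case_nat y (case_nat x b)) ?M \<longleftrightarrow> A \<in> minimal_instance prec x y" for x y A
    by (auto simp: minimal_instance_def binrel_def)
  have "\<not> decided e b (ExistsB (ForallB ?M))"
  proof
    assume "decided e b (ExistsB (ForallB ?M))"
    then obtain N where N: "\<And>A. (\<exists>x. \<forall>y. A \<in> minimal_instance prec x y) \<Longrightarrow>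
        \<exists>x<N. \<forall>y. A \<in> minimal_instance prec x y"
      unfolding decided.simps(6) sat.simps(5) M by blast
    \<comment> \<open>The singleton of \<open>N\<close> has \<open>N\<close> as its only minimal
      element, so no bound on the witnesses serves all interpretations.\<close>
    have "\<forall>y. {N} \<in> minimal_instance prec N y" using irrefl by (simp add: minimal_instance_def)
    then obtain x where "x < N" "{N} \<in> minimal_instance prec x 0" using N by blast
    then show False by (simp add: minimal_instance_def)
  qed
  then have "tr e b (TI_prog prec) = Dis (\<lambda>x. tr e (case_nat x b) (ForallB ?M))"
    unfolding eq by (simp only: tr.simps if_False)
  moreover have "tr e (case_nat x b) (ForallB ?M) = Lit (\<Inter>y. minimal_instance prec x y) \<or>
      tr e (case_nat x b) (ForallB ?M) = Con (\<lambda>y. Lit (minimal_instance prec x y))" for x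
  proof (cases "decided e (case_nat x b) (ForallB ?M)")
    case True
    then have "tr e (case_nat x b) (ForallB ?M) = Lit {A. \<forall>y. A \<in> minimal_instance prec x y}"
      by (simp only: tr_decided sat.simps(5) M)
    then show ?thesis by (simp add: Collect_all_eq)
  next
    case False
    then have "tr e (case_nat x b) (ForallB ?M) = Con (\<lambda>y. tr e (case_nat y (case_nat x b)) ?M)"
      by (simp only: tr.simps if_False)
    then show ?thesis by (intro disjI2) (simp only: M)
  qed
  ultimately show ?thesis using that by blast
qed

lemma refuted_TI_all: "refuted {A. m \<in> A} (tr e b TI_all)"
proof (cases "decided e b TI_all")
  case True
  then show ?thesis by (auto simp: tr_decided, auto simp: TI_all_def Forall_def)
next
  case False
  then show ?thesis by (auto simp: TI_all_def Forall_def simp del: decided.simps)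
qed

text \<open>Rank \<open>k + 1\<close> costs \<open>k + 1\<close> exponentials. Unfolded inductions
  end strictly below \<open>omega * (h + 1)\<close>, so the innermost exponential stays below
  \<open>omega^(h+1)\<close>, and the other \<open>k\<close> form the tower.\<close>

lemma otype_le_tower:
  assumes r: "well_order_on UNIV r" and "k \<ge> 1" "h \<ge> 1"
    and D: "der (ranked (k + 1)) (k + 1) (ord_of_nat h) (tr e b ` TI (r - Id))"
  shows "otype r \<le> tower (ord_of_nat 2) k (oexp \<omega> (ord_of_nat (h + 1)))"
proof -
  let ?\<gamma> = "tower (ord_of_nat 2) k (oexp \<omega> (ord_of_nat (h + 1)))"
  obtain \<alpha> where \<alpha>: "\<alpha> < \<omega> * (ord_of_nat h + 1)" "der {} (k + 1) \<alpha> (tr e b ` TI (r - Id))"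
    using induction_elimination[OF _ D] by (auto simp: ranked_def)
  obtain g where g: "tr e b (TI_prog (r - Id)) = Dis g"
    "\<And>x. g x = Lit (\<Inter>y. minimal_instance (r - Id) x y) \<or>
         g x = Con (\<lambda>y. Lit (minimal_instance (r - Id) x y))"
    using tr_TI_prog[of "r - Id" e b] by blast
  have "der {} 0 (tower (ord_of_nat 2) (Suc k) \<alpha>) {tr e b TI_all, Dis g}"
    using cut_elimination[of "{}" 0 "Suc k" \<alpha> "tr e b ` TI (r - Id)"] \<alpha>(2) g(1) by (simp add: TI_def)
  then have "otype r \<le> \<omega> * tower (ord_of_nat 2) (Suc k) \<alpha>"
    by (rule boundedness[OF r g(2) refuted_TI_all])
  also have "\<dots> \<le> \<omega> * ?\<gamma>"
  proof (rule times_mono_cord)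
    have "oexp (ord_of_nat 2) \<alpha> < oexp (ord_of_nat 2) (\<omega> * ord_of_nat (h + 1))"
      using \<alpha>(1) by (intro oexp_strict_mono) simp_all
    then have "oexp (ord_of_nat 2) \<alpha> < oexp \<omega> (ord_of_nat (h + 1))"
      by (simp only: oexp_two_omega_times)
    then show "tower (ord_of_nat 2) (Suc k) \<alpha> \<le> ?\<gamma>"
      unfolding tower_Suc_inner by (rule less_imp_le[OF tower_strict_mono[OF order_refl]])
  qed
  also have "\<dots> = ?\<gamma>" by (rule omega_times_tower) fact+
  finally show ?thesis .
qed

theorem corollary4p13:
  fixes r :: "nat rel" and k :: nat
  assumes "well_order_on UNIV r" and "k \<ge> 1"
  shows "(\<forall>(h :: nat) \<tau> l.
            ISigma_X_derivation (k + 1) (TI (r - Id)) \<tau> l \<longrightarrow>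
            otype r > tower (ord_of_nat 2) k (oexp \<omega> (ord_of_nat (h + 1))) * ord_of_nat 2 + \<omega> \<longrightarrow>
            height \<tau> > h) \<and>
         (otype r \<ge> tower \<omega> (k + 2) 1 \<longrightarrow>
            \<not> provable (ISigma_X (k + 1)) (Or TI_all (TI_prog (r - Id))))"
proof (intro conjI allI impI)
  fix h \<tau> l
  let ?\<gamma> = "tower (ord_of_nat 2) k (oexp \<omega> (ord_of_nat (h + 1)))"
  assume D: "ISigma_X_derivation (k + 1) (TI (r - Id)) \<tau> l"
    and large: "otype r > ?\<gamma> * ord_of_nat 2 + \<omega>"
  show "height \<tau> > h"
  proof (rule ccontr)
    assume "\<not> height \<tau> > h"
    then have h: "height \<tau> \<le> h" "h \<ge> 1" using derivation_height_pos[OF D] by auto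
    have "der (ranked (k + 1)) (k + 1) (ord_of_nat h) (tr e b ` TI (r - Id))" for e b
      by (rule der_mono_height[OF der_derivation[OF D]]) (simp add: ord_of_nat_le_iff h(1))
    then have "otype r \<le> ?\<gamma>" by (rule otype_le_tower[OF assms h(2)])
    also have "\<dots> \<le> ?\<gamma> * ord_of_nat 2 + \<omega>"
      using le_times_cord[OF two_nonzero] plus_least(1) order_trans by blast
    finally show False using large by simp
  qed
next
  assume large: "otype r \<ge> tower \<omega> (k + 2) 1"
  show "\<not> provable (ISigma_X (k + 1)) (Or TI_all (TI_prog (r - Id)))"
  proof
    assume "provable (ISigma_X (k + 1)) (Or TI_all (TI_prog (r - Id)))"
    then obtain n where D: "der (ranked (k + 1)) (k + 1) (ord_of_nat n)
        (tr (\<lambda>_. 0) (\<lambda>_. 0) ` {TI_all, TI_prog (r - Id)})"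
      by (rule der_provable_Or)
    \<comment> \<open>Raising the height by one secures \<open>?h \<ge> 1\<close>.\<close>
    let ?h = "Suc n"
    have "der (ranked (k + 1)) (k + 1) (ord_of_nat ?h) (tr (\<lambda>_. 0) (\<lambda>_. 0) ` TI (r - Id))"
      unfolding TI_def by (rule der_mono_height[OF D less_imp_le[OF less_ord_Suc]])
    then have "otype r \<le> tower (ord_of_nat 2) k (oexp \<omega> (ord_of_nat (?h + 1)))"
      by (rule otype_le_tower[OF assms, rotated]) simp
    also have "\<dots> \<le> tower \<omega> k (oexp \<omega> (ord_of_nat (?h + 1)))"
      by (rule tower_mono_base[OF two_le_omega])
    also have "\<dots> < tower \<omega> k (oexp \<omega> (oexp \<omega> 1))"
    proof (intro tower_strict_mono oexp_strict_mono two_le_omega)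
      \<comment> \<open>Every finite exponent is passed by \<open>omega^1\<close>, so the bound
        stays below the omega-tower of k + 2 levels whatever \<open>n\<close> is.\<close>
      have "\<omega> \<le> oexp \<omega> 1" using oexp_two_omega_times[of 1] by (simp add: zero_plus_cord oexp_two_omega)
      then show "ord_of_nat (?h + 1) < oexp \<omega> 1" using ord_of_nat_less_omega less_le_trans by blast
    qed
    also have "\<dots> = tower \<omega> (k + 2) 1" by (simp only: tower_Suc_inner add_2_eq_Suc')
    finally show False using large by simp
  qed
qed

end
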